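(* For functions $P_1,\dots,P_m$ and $\xi=(\xi_1,\dots,\xi_m)\in\mathbb{T}^m$ write $$S_N(\xi)=\frac1N\sum_{n=1}^N e\left(\xi_1\lfloor P_1(n)\rfloor+\dots+\xi_m\lfloor P_m(n)\rfloor\right).$$ (a) Let $\{P_1,\dots,P_m\}\in\mathcal{P}$. For every $\varepsilon>0$ and $\lambda>1$ there is a constant $C$, depending only on $\varepsilon,\lambda,P_1,\dots,P_m,m$, such that for every $\lambda$-lacunary set $\mathbb{D}\subseteq\mathbb{N}$, every $\delta>0$ and every $\xi\in\mathbb{T}^m$, $$\mathcal{N}_\delta\left(S_N(\xi)\right)_{N\in\mathbb{D}}\le C\delta^{-(2+\varepsilon)}.$$ (b) Let $\{P_1,\dots,P_m\}\in\mathcal{P}'$. For every $\varepsilon>0$ there is a constant $C$, depending only on $\varepsilon,P_1,\dots,P_m,m$, such that for every $\delta>0$ and every $\xi\in\mathbb{T}^m$, $$\mathcal{N}_\delta\left(S_N(\xi)\right)_{N\in\mathbb{N}}\le C\delta^{-(2+\varepsilon)}.$$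
   Context: $\mathbb{N}=\{1,2,\dots\}$, $\mathbb{T}=\mathbb{R}/\mathbb{Z}$ and $e(x)=e^{2\pi i x}$. A germ at infinity is an equivalence class of smooth real functions, each defined on some interval $(u,\infty)$, two functions being equivalent if they agree for all sufficiently large $t$. Germs form a ring under pointwise operations. A Hardy field is a subfield of this ring closed under differentiation. For $P$ in a Hardy field, its type (growth rate) is $\tau(P)=\inf\{\alpha\in\mathbb{R}: |P(t)|\le t^\alpha \text{ for all sufficiently large } t\}$; $P$ is of polynomial growth if $0<\tau(P)<\infty$. Each germ is identified with a representative, which is also given some real value at any positive integer where it is not already defined. The class $\mathcal{P}$: a collection $\{P_1,\dots,P_m\}$ of functions from a Hardy field belongs to $\mathcal{P}$ if (i) each $P_i$ is of polynomial growth; (ii) for each $i$ and each $k\in\mathbb{N}$, $\lim_{t\to\infty}P_i(t)/t^k=0$ or $\lim_{t\to\infty}t^k/P_i(t)=0$; (iii) $\tau(P_1),\dots,\tau(P_m)$ are distinct; (iv) for each $i$, $P_i(t/2)\sim P_i(t)$ and $tP_i'(t)\sim P_i(t)$ for all sufficiently large $t$, where $X\sim Y$ means $C^{-1}|Y|\le|X|\le C|Y|$ with a constant $C>0$ depending only on $P_1,\dots,P_m$. The class $\mathcal{P}'$: a collection $\{P_1,\dots,P_m\}$ of functions from a Hardy field belongs to $\mathcal{P}'$ if there exist non-integer real numbers $0<c_1<\dots<c_m$ such that $\lim_{t\to\infty}P_i(t)/t^{c_i}$ is a non-zero (finite) constant for each $i$. A set $\mathbb{D}\subseteq\mathbb{N}$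 is $\lambda$-lacunary if $N_2/N_1>\lambda$ for all $N_1<N_2$ in $\mathbb{D}$. For $\delta>0$, $\mathcal{N}_\delta(a_N)_{N\in\mathbb{D}}$ is the supremum of all $J\in\mathbb{N}$ for which there exist $N_0\le\dots\le N_J$ in $\mathbb{D}$ with $|a_{N_{j+1}}-a_{N_j}|\ge\delta$ for all $0\le j\le J-1$ (and $0$ if there is no such $J$). *)

theory Defs
  imports "HOL-Analysis.Analysis"
begin

section \<open>Germs at infinity and Hardy fields\<close>

text \<open>A partial function defined on some interval \<open>(u, \<infinity>)\<close> is represented by any total function
  extending it; the values outside the interval play no role for its germ.\<close>

definition smooth_beyond :: "real \<Rightarrow> (real \<Rightarrow> real) \<Rightarrow> bool" where
  "smooth_beyond u f \<longleftrightarrow> (\<forall>n. \<forall>t>u. (deriv ^^ n) f differentiable (at t))"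

definition smooth_at_top :: "(real \<Rightarrow> real) \<Rightarrow> bool" where
  "smooth_at_top f \<longleftrightarrow> (\<exists>u. smooth_beyond u f)"

definition germ_rel :: "(real \<Rightarrow> real) \<Rightarrow> (real \<Rightarrow> real) \<Rightarrow> bool" where
  "germ_rel f g \<longleftrightarrow> smooth_at_top f \<and> smooth_at_top g \<and> eventually (\<lambda>t. f t = g t) at_top"

lemma deriv_cong_beyond:
  fixes f g :: "real \<Rightarrow> real"
  assumes "\<And>t. t > u \<Longrightarrow> f t = g t" and "t > u"
  shows "deriv f t = deriv g t"
proof (rule deriv_cong_ev)
  show "\<forall>\<^sub>F x in nhds t. f x = g x"
    using assms by (auto simp: eventually_nhds intro!: exI[of _ "{u<..}"])
qed simp

lemma differentiable_cong_beyond: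
  fixes f g :: "real \<Rightarrow> real"
  assumes "\<And>t. t > u \<Longrightarrow> f t = g t" and "t > u" and "f differentiable (at t)"
  shows "g differentiable (at t)"
proof -
  from assms(3) obtain D where "(f has_derivative D) (at t)"
    by (auto simp: differentiable_def)
  then have "(g has_derivative D) (at t)"
    by (rule has_derivative_transform_within_open[where s = "{u<..}"]) (use assms in auto)
  then show ?thesis
    by (auto simp: differentiable_def)
qed

lemma smooth_beyond_mono: "smooth_beyond u f \<Longrightarrow> u \<le> v \<Longrightarrow> smooth_beyond v f"
  by (auto simp: smooth_beyond_def)

lemma smooth_beyond_deriv: "smooth_beyond u f \<Longrightarrow> smooth_beyond u (deriv f)"
  unfolding smooth_beyond_def by (metis comp_apply funpow_Suc_right)

lemma smooth_beyond_differentiable: "smooth_beyond u f \<Longrightarrow> t > u \<Longrightarrow> f differentiable (at t)"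
  unfolding smooth_beyond_def by (metis funpow_0)

lemma smooth_beyond_field_differentiable:
  "smooth_beyond u f \<Longrightarrow> t > u \<Longrightarrow> f field_differentiable (at t)"
  using smooth_beyond_differentiable
  by (metis differentiable_def field_differentiable_def has_field_derivative_def
      real_differentiable_def)

lemma smooth_beyond_coinduct:
  assumes "A f"
    and step: "\<And>f t. A f \<Longrightarrow> t > u \<Longrightarrow> f differentiable (at t)"
    and closed: "\<And>f. A f \<Longrightarrow> \<exists>g. A g \<and> (\<forall>t>u. deriv f t = g t)"
  shows "smooth_beyond u f"
proof -
  have "\<exists>g. A g \<and> (\<forall>t>u. (deriv ^^ n) f t = g t)" for n
  proof (induction n)
    case 0
    then show ?case using assms(1) by auto
  next
    case (Suc n)
    then obtain g where g: "A g" "\<forall>t>u. (deriv ^^ n) f t = g t" by blast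
    from closed[OF g(1)] obtain h where h: "A h" "\<forall>t>u. deriv g t = h t" by blast
    have "(deriv ^^ Suc n) f t = h t" if "t > u" for t
      using deriv_cong_beyond[of u "(deriv ^^ n) f" g t] g(2) h(2) that by simp
    then show ?case using h(1) by blast
  qed
  then show ?thesis
    unfolding smooth_beyond_def by (metis step differentiable_cong_beyond)
qed

lemma smooth_beyond_cong:
  assumes "smooth_beyond u f" "\<And>t. t > u \<Longrightarrow> f t = g t"
  shows "smooth_beyond u g"
proof (rule smooth_beyond_coinduct[where A = "\<lambda>g. \<exists>f. smooth_beyond u f \<and> (\<forall>t>u. f t = g t)"])
  show "\<exists>f. smooth_beyond u f \<and> (\<forall>t>u. f t = g t)" using assms by blast
next
  fix g t assume "\<exists>f. smooth_beyond u f \<and> (\<forall>t>u. f t = g t)" "t > u"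
  then show "g differentiable (at t)"
    by (meson differentiable_cong_beyond smooth_beyond_differentiable)
next
  fix g assume "\<exists>f. smooth_beyond u f \<and> (\<forall>t>u. f t = g t)"
  then obtain f where f: "smooth_beyond u f" "\<forall>t>u. f t = g t" by blast
  have "\<forall>t>u. deriv f t = deriv g t" using deriv_cong_beyond[of u f g] f(2) by blast
  then show "\<exists>h. (\<exists>f. smooth_beyond u f \<and> (\<forall>t>u. f t = h t)) \<and> (\<forall>t>u. deriv g t = h t)"
    using smooth_beyond_deriv[OF f(1)] by blast
qed

lemma smooth_beyond_const: "smooth_beyond u (\<lambda>_. c)"
  by (rule smooth_beyond_coinduct[where A = "\<lambda>f. \<exists>c. f = (\<lambda>_. c)"]) auto

lemma smooth_beyond_add:
  assumes "smooth_beyond u f" "smooth_beyond u g"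
  shows "smooth_beyond u (\<lambda>t. f t + g t)"
proof (rule smooth_beyond_coinduct[where A =
      "\<lambda>h. \<exists>f g. smooth_beyond u f \<and> smooth_beyond u g \<and> h = (\<lambda>t. f t + g t)"], goal_cases)
  case 1
  then show ?case using assms by blast
next
  case (2 h t)
  then show ?case using smooth_beyond_differentiable by (auto intro!: differentiable_add)
next
  case (3 h)
  then obtain f g where "smooth_beyond u f" "smooth_beyond u g" "h = (\<lambda>t. f t + g t)" by blast
  then show ?case
    using smooth_beyond_deriv[of u f] smooth_beyond_deriv[of u g]
      smooth_beyond_field_differentiable[of u f] smooth_beyond_field_differentiable[of u g]
    by (intro exI[of _ "\<lambda>t. deriv f t + deriv g t"]) auto
qed

text \<open>The invariant for products: finite sums of products of smooth functions.\<close>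

inductive sum_of_prods :: "real \<Rightarrow> (real \<Rightarrow> real) \<Rightarrow> bool" for u where
  "smooth_beyond u f \<Longrightarrow> smooth_beyond u g \<Longrightarrow> sum_of_prods u (\<lambda>t. f t * g t)"
| "sum_of_prods u f \<Longrightarrow> sum_of_prods u g \<Longrightarrow> sum_of_prods u (\<lambda>t. f t + g t)"

lemma sum_of_prods_differentiable:
  "sum_of_prods u h \<Longrightarrow> t > u \<Longrightarrow> h differentiable (at t)"
  by (induction rule: sum_of_prods.induct)
    (use smooth_beyond_differentiable in \<open>blast intro: differentiable_add differentiable_mult\<close>)+

lemma sum_of_prods_deriv:
  "sum_of_prods u h \<Longrightarrow> \<exists>k. sum_of_prods u k \<and> (\<forall>t>u. deriv h t = k t)"
proof (induction rule: sum_of_prods.induct)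
  case (1 f g)
  have "sum_of_prods u (\<lambda>t. f t * deriv g t + deriv f t * g t)"
    using 1 by (intro sum_of_prods.intros smooth_beyond_deriv)
  moreover have "deriv (\<lambda>t. f t * g t) t = f t * deriv g t + deriv f t * g t" if "t > u" for t
    using 1 that by (simp add: smooth_beyond_field_differentiable)
  ultimately show ?case by blast
next
  case (2 f g)
  then obtain k l where kl: "sum_of_prods u k" "\<forall>t>u. deriv f t = k t"
    "sum_of_prods u l" "\<forall>t>u. deriv g t = l t" by blast
  have "deriv (\<lambda>t. f t + g t) t = k t + l t" if "t > u" for t
  proof -
    have "f field_differentiable (at t)" "g field_differentiable (at t)"
      using sum_of_prods_differentiable[OF 2(1) that] sum_of_prods_differentiable[OF 2(2) that]
      by (auto simp: field_differentiable_def real_differentiable_def)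
    then show ?thesis using kl that by simp
  qed
  then show ?case using sum_of_prods.intros(2)[OF kl(1) kl(3)] by blast
qed

lemma smooth_beyond_mult:
  assumes "smooth_beyond u f" "smooth_beyond u g"
  shows "smooth_beyond u (\<lambda>t. f t * g t)"
  by (rule smooth_beyond_coinduct[where A = "sum_of_prods u"])
    (use assms in \<open>auto intro: sum_of_prods.intros sum_of_prods_differentiable sum_of_prods_deriv\<close>)

lemma smooth_at_top_const: "smooth_at_top (\<lambda>_. c)"
  using smooth_beyond_const by (auto simp: smooth_at_top_def)

lemma smooth_at_top_deriv: "smooth_at_top f \<Longrightarrow> smooth_at_top (deriv f)"
  using smooth_beyond_deriv by (auto simp: smooth_at_top_def)

lemma smooth_at_top_common:
  assumes "smooth_at_top f" "smooth_at_top g"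
  obtains u where "smooth_beyond u f" "smooth_beyond u g"
proof -
  from assms obtain v w where "smooth_beyond v f" "smooth_beyond w g"
    by (auto simp: smooth_at_top_def)
  then show ?thesis
    using that[of "max v w"] smooth_beyond_mono[of v f "max v w"] smooth_beyond_mono[of w g "max v w"]
    by simp
qed

lemma smooth_at_top_add:
  "smooth_at_top f \<Longrightarrow> smooth_at_top g \<Longrightarrow> smooth_at_top (\<lambda>t. f t + g t)"
  using smooth_beyond_add by (metis smooth_at_top_common smooth_at_top_def)

lemma smooth_at_top_mult:
  "smooth_at_top f \<Longrightarrow> smooth_at_top g \<Longrightarrow> smooth_at_top (\<lambda>t. f t * g t)"
  using smooth_beyond_mult by (metis smooth_at_top_common smooth_at_top_def)

lemma smooth_at_top_uminus: "smooth_at_top f \<Longrightarrow> smooth_at_top (\<lambda>t. - f t)"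
  using smooth_at_top_mult[OF smooth_at_top_const[of "-1"], of f] by simp

lemma smooth_at_top_diff:
  "smooth_at_top f \<Longrightarrow> smooth_at_top g \<Longrightarrow> smooth_at_top (\<lambda>t. f t - g t)"
  using smooth_at_top_add[OF _ smooth_at_top_uminus, of f g] by simp

lemma deriv_cong_at_top:
  fixes f g :: "real \<Rightarrow> real"
  assumes "eventually (\<lambda>t. f t = g t) at_top"
  shows "eventually (\<lambda>t. deriv f t = deriv g t) at_top"
proof -
  from assms obtain u where "\<And>t. t > u \<Longrightarrow> f t = g t"
    by (auto simp: eventually_at_top_dense)
  then have "\<forall>t>u. deriv f t = deriv g t"
    using deriv_cong_beyond by blast
  then show ?thesis
    by (auto simp: eventually_at_top_dense)
qed

quotient_type germ = "real \<Rightarrow> real" / partial: germ_rel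
proof (rule part_equivpI)
  show "\<exists>f. germ_rel f f"
    using smooth_at_top_const by (auto simp: germ_rel_def)
  show "symp germ_rel"
    by (auto simp: symp_def germ_rel_def elim: eventually_mono)
  show "transp germ_rel"
    by (auto simp: transp_def germ_rel_def elim: eventually_elim2)
qed

instantiation germ :: comm_ring_1
begin

lift_definition zero_germ :: germ is "\<lambda>_. 0"
  by (simp add: germ_rel_def smooth_at_top_const)

lift_definition one_germ :: germ is "\<lambda>_. 1"
  by (simp add: germ_rel_def smooth_at_top_const)

lift_definition plus_germ :: "germ \<Rightarrow> germ \<Rightarrow> germ" is "\<lambda>f g t. f t + g t"
  by (auto simp: germ_rel_def intro: smooth_at_top_add elim: eventually_elim2)

lift_definition minus_germ :: "germ \<Rightarrow> germ \<Rightarrow> germ" is "\<lambda>f g t. f t - g t"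
  by (auto simp: germ_rel_def intro: smooth_at_top_diff elim: eventually_elim2)

lift_definition uminus_germ :: "germ \<Rightarrow> germ" is "\<lambda>f t. - f t"
  by (auto simp: germ_rel_def intro: smooth_at_top_uminus elim: eventually_mono)

lift_definition times_germ :: "germ \<Rightarrow> germ \<Rightarrow> germ" is "\<lambda>f g t. f t * g t"
  by (auto simp: germ_rel_def intro: smooth_at_top_mult elim: eventually_elim2)

instance
proof
  show "(0::germ) \<noteq> 1"
    by transfer (simp add: germ_rel_def)
qed (transfer; auto simp: germ_rel_def algebra_simps
      intro: smooth_at_top_add smooth_at_top_diff smooth_at_top_uminus smooth_at_top_mult
        smooth_at_top_const)+

end

lift_definition deriv_germ :: "germ \<Rightarrow> germ" is "deriv"
  by (auto simp: germ_rel_def intro: smooth_at_top_deriv deriv_cong_at_top)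

definition hardy_field :: "germ set \<Rightarrow> bool" where
  "hardy_field H \<longleftrightarrow>
     0 \<in> H \<and> 1 \<in> H \<and>
     (\<forall>x\<in>H. \<forall>y\<in>H. x + y \<in> H \<and> x - y \<in> H \<and> x * y \<in> H) \<and>
     (\<forall>x\<in>H. x \<noteq> 0 \<longrightarrow> (\<exists>y\<in>H. x * y = 1)) \<and>
     (\<forall>x\<in>H. deriv_germ x \<in> H)"

text \<open>\<open>abs_germ f\<close> is meaningful only for \<open>f\<close> in the domain of \<open>germ_rel\<close>, hence the first conjunct.\<close>

definition represents_in :: "(real \<Rightarrow> real) \<Rightarrow> germ set \<Rightarrow> bool" where
  "represents_in f H \<longleftrightarrow> smooth_at_top f \<and> abs_germ f \<in> H"

definition from_hardy_field :: "nat \<Rightarrow> (nat \<Rightarrow> real \<Rightarrow> real) \<Rightarrow> bool" where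
  "from_hardy_field m P \<longleftrightarrow> (\<exists>H. hardy_field H \<and> (\<forall>i\<in>{1..m}. represents_in (P i) H))"


section \<open>The classes of functions\<close>

definition growth_type :: "(real \<Rightarrow> real) \<Rightarrow> ereal" where
  "growth_type f = Inf {ereal \<alpha> | \<alpha>. eventually (\<lambda>t. \<bar>f t\<bar> \<le> t powr \<alpha>) at_top}"

definition polynomial_growth :: "(real \<Rightarrow> real) \<Rightarrow> bool" where
  "polynomial_growth f \<longleftrightarrow> 0 < growth_type f \<and> growth_type f < \<infinity>"

definition comparable_at_top :: "(real \<Rightarrow> real) \<Rightarrow> (real \<Rightarrow> real) \<Rightarrow> bool" where
  "comparable_at_top X Y \<longleftrightarrow>
     (\<exists>C>0. eventually (\<lambda>t. inverse C * \<bar>Y t\<bar> \<le> \<bar>X t\<bar> \<and> \<bar>X t\<bar> \<le> C * \<bar>Y t\<bar>) at_top)"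

definition class_P :: "nat \<Rightarrow> (nat \<Rightarrow> real \<Rightarrow> real) \<Rightarrow> bool" where
  "class_P m P \<longleftrightarrow>
     from_hardy_field m P \<and>
     (\<forall>i\<in>{1..m}. polynomial_growth (P i)) \<and>
     (\<forall>i\<in>{1..m}. \<forall>k::nat. k \<ge> 1 \<longrightarrow>
        ((\<lambda>t. P i t / t ^ k) \<longlongrightarrow> 0) at_top \<or> ((\<lambda>t. t ^ k / P i t) \<longlongrightarrow> 0) at_top) \<and>
     inj_on (\<lambda>i. growth_type (P i)) {1..m} \<and>
     (\<forall>i\<in>{1..m}. comparable_at_top (\<lambda>t. P i (t / 2)) (P i) \<and>
        comparable_at_top (\<lambda>t. t * deriv (P i) t) (P i))"

definition class_P' :: "nat \<Rightarrow> (nat \<Rightarrow> real \<Rightarrow> real) \<Rightarrow> bool" where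
  "class_P' m P \<longleftrightarrow>
     from_hardy_field m P \<and>
     (\<exists>c::nat \<Rightarrow> real.
        (\<forall>i\<in>{1..m}. 0 < c i \<and> c i \<notin> \<int>) \<and>
        strict_mono_on {1..m} c \<and>
        (\<forall>i\<in>{1..m}. \<exists>L. L \<noteq> 0 \<and> ((\<lambda>t. P i t / t powr c i) \<longlongrightarrow> L) at_top))"


section \<open>Exponential averages and jump counting\<close>

definition e :: "real \<Rightarrow> complex" where
  "e x = exp (2 * pi * \<i> * x)"

text \<open>A point of \<open>\<real>/\<int>\<close> is given by any real representative: the coefficients of \<open>\<xi>\<close> below are
  integers, so the average depends only on the classes of the \<open>\<xi> i\<close> modulo \<open>1\<close>.\<close>

definition exp_avg :: "nat \<Rightarrow> (nat \<Rightarrow> real \<Rightarrow> real) \<Rightarrow> (nat \<Rightarrow> real) \<Rightarrow> nat \<Rightarrow> complex" where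
  "exp_avg m P \<xi> N =
     1 / of_nat N * (\<Sum>n=1..N. e (\<Sum>i=1..m. \<xi> i * of_int \<lfloor>P i (real n)\<rfloor>))"

definition lacunary :: "real \<Rightarrow> nat set \<Rightarrow> bool" where
  "lacunary l D \<longleftrightarrow> D \<subseteq> {1..} \<and> (\<forall>N\<^sub>1\<in>D. \<forall>N\<^sub>2\<in>D. N\<^sub>1 < N\<^sub>2 \<longrightarrow> real N\<^sub>2 / real N\<^sub>1 > l)"

text \<open>The supremum is taken in \<open>enat\<close>, so it may be infinite and is \<open>0\<close> over the empty set.\<close>

definition jump_count :: "real \<Rightarrow> (nat \<Rightarrow> complex) \<Rightarrow> nat set \<Rightarrow> enat" where
  "jump_count \<delta> a D =
     (SUP J \<in> {J. J \<ge> 1 \<and> (\<exists>N :: nat \<Rightarrow> nat. (\<forall>j\<le>J. N j \<in> D) \<and>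
                 (\<forall>j<J. N j \<le> N (Suc j) \<and> cmod (a (N (Suc j)) - a (N j)) \<ge> \<delta>))}. enat J)"

end

theory Submission
  imports Defs
begin

text \<open>Since \<open>\<bar>S\<^sub>M - S\<^sub>N\<bar> \<le> 2 (1 - N / M)\<close>, consecutive terms of a
  \<open>\<delta>\<close>-jump chain are \<open>\<delta> / 2\<close>-separated on the logarithmic scale, so a set of \<open>N\<close> of logarithmic
  diameter \<open>\<Lambda>\<close> carries only \<open>O(\<Lambda> / \<delta> + 1)\<close> terms. Normalise \<open>\<bar>\<xi>\<^sub>i\<bar> \<le> 1/2\<close> and let \<open>R\<close> be of order
  \<open>1 / \<delta>\<close>. Outside boundedly many sets of logarithmic diameter \<open>O(log R)\<close>, \<open>S\<^sub>N\<close> is within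
  \<open>\<delta> / 2\<close> of \<open>1\<close> (if all \<open>\<bar>\<xi>\<^sub>i P\<^sub>i(N)\<bar>\<close> are tiny) or of \<open>0\<close> (if some \<open>\<bar>\<xi>\<^sub>i P\<^sub>i(N)\<bar>\<close> is large), and
  the passage from the first regime to the second happens at most once. This yields \<open>O(\<delta>\<^bsup>-2\<^esup>)\<close> jumps.

  For the second regime the floors are removed by Fejer kernels, which replaces \<open>\<xi>\<close> by \<open>\<xi> + h\<close> with
  integer \<open>h\<close> of size at most \<open>R\<^sup>3\<close>. Weyl differencing then bounds the sums of
  \<open>e (\<Sum> (\<xi>\<^sub>i + h\<^sub>i) P\<^sub>i(n))\<close>, using the first derivative if the phase is at most \<open>\<surd> N\<close> and a derivative of
  fixed high order otherwise. No cancellation between the terms of these derivatives can occur unless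
  two of them have comparable size; as the types are distinct, the ratio of two terms is a regular
  function of nonzero type, so this happens only on a set of small logarithmic diameter, which
  is added to the exceptional sets. The regularity rests on the fact that \<open>t P' / P\<close> has a limit for
  every \<open>P\<close> in a Hardy field: \<open>(P / P')'\<close> lies in the field, hence has a limit.\<close>

section \<open>Growth of functions with controlled logarithmic derivative\<close>

text \<open>A fixed power of \<open>R\<close> is free throughout: widening a window of sizes from
  constants to \<open>R ^ F\<close> adds only a multiple of \<open>ln R\<close> to its logarithmic
  diameter, because all functions and quotients in play move at a rate of at least \<open>g\<close>
  on the logarithmic scale. So the factor \<open>R ^ (3 * m)\<close> from expanding the Fejer
  polynomials, the change of the derivatives over a range of ratio \<open>R ^ a\<close> and the size
  of the shifts are all paid for by larger exponents.

  Two orders of differentiation are forced by integer types. If the type of P is k, the k-th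
  derivative has slope 0, so the next one may fall short of its expected size by a factor that beats
  every constant, though no power. The first derivative has no such loss, as types are positive, and
  it detects phases as small as a power of \<open>R\<close>, but it is usable only for phases well
  below \<open>N\<close>. The order \<open>K\<close> loses at most \<open>N powr (1/16)\<close>,
  harmless once the phase exceeds the square root of \<open>N\<close>; and since the K-th
  derivatives are small, this one order serves all types.\<close>

definition slope :: "(real \<Rightarrow> real) \<Rightarrow> real \<Rightarrow> bool" where
  "slope Q \<sigma> \<longleftrightarrow> eventually (\<lambda>t. Q t \<noteq> 0) at_top \<and> ((\<lambda>t. t * deriv Q t / Q t) \<longlongrightarrow> \<sigma>) at_top"

lemma smooth_at_top_DERIV:
  assumes "smooth_at_top f"
  shows "eventually (\<lambda>t. (f has_real_derivative deriv f t) (at t)) at_top"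
proof -
  from assms obtain u where "smooth_beyond u f" by (auto simp: smooth_at_top_def)
  then have "\<And>t. t > u \<Longrightarrow> (f has_real_derivative deriv f t) (at t)"
    using smooth_beyond_field_differentiable DERIV_deriv_iff_field_differentiable by blast
  then show ?thesis by (auto simp: eventually_at_top_dense)
qed

lemma smooth_at_top_funpow_deriv: "smooth_at_top f \<Longrightarrow> smooth_at_top ((deriv ^^ k) f)"
  by (induction k) (auto intro: smooth_at_top_deriv)

text \<open>\<open>t * Q' t / Q t\<close> is the derivative of ln |Q| with respect to ln t, so a
  bound on it integrates to a comparison with a power of \<open>b / a\<close>.\<close>

lemma log_growth_ge:
  fixes Q :: "real \<Rightarrow> real"
  assumes "0 < a" "a \<le> b"
    and "\<And>t. t \<in> {a..b} \<Longrightarrow> (Q has_real_derivative Q' t) (at t)"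
    and "\<And>t. t \<in> {a..b} \<Longrightarrow> Q t \<noteq> 0"
    and "\<And>t. t \<in> {a..b} \<Longrightarrow> r \<le> t * Q' t / Q t"
  shows "(b / a) powr r * \<bar>Q a\<bar> \<le> \<bar>Q b\<bar>"
proof -
  \<comment> \<open>The square spares a distinction by the sign of \<open>Q\<close>; hence the
    factors 2.\<close>
  have "ln ((Q a)\<^sup>2) - 2 * r * ln a \<le> ln ((Q b)\<^sup>2) - 2 * r * ln b"
  proof (rule DERIV_nonneg_imp_nondecreasing[OF assms(2)])
    fix t assume "a \<le> t" "t \<le> b"
    then have t: "t \<in> {a..b}" "t > 0" using assms(1) by auto
    have "((\<lambda>t. ln ((Q t)\<^sup>2) - 2 * r * ln t) has_real_derivative 2 * (Q' t / Q t) - 2 * r * (1 / t)) (at t)"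
      using assms(3,4)[OF t(1)] t(2)
      by (auto intro!: derivative_eq_intros simp: power2_eq_square) (metis not_real_square_gt_zero)
    moreover have "0 \<le> 2 * (Q' t / Q t) - 2 * r * (1 / t)"
    proof -
      have "r / t \<le> Q' t / Q t" using assms(5)[OF t(1)] t(2) by (simp add: pos_divide_le_eq mult_ac)
      then show ?thesis by simp
    qed
    ultimately show "\<exists>y. ((\<lambda>t. ln ((Q t)\<^sup>2) - 2 * r * ln t) has_real_derivative y) (at t) \<and> 0 \<le> y" by blast
  qed
  moreover have ne: "Q a \<noteq> 0" "Q b \<noteq> 0" using assms by auto
  moreover have "ln (x\<^sup>2) = 2 * ln \<bar>x\<bar>" if "x \<noteq> 0" for x :: real
    using ln_realpow[of "\<bar>x\<bar>" 2] that by simp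
  ultimately have "ln \<bar>Q a\<bar> + r * (ln b - ln a) \<le> ln \<bar>Q b\<bar>"
    by (simp add: algebra_simps)
  then have "exp (ln \<bar>Q a\<bar> + r * (ln b - ln a)) \<le> exp (ln \<bar>Q b\<bar>)" by simp
  moreover have "exp (ln \<bar>Q a\<bar> + r * (ln b - ln a)) = (b / a) powr r * \<bar>Q a\<bar>"
    using ne assms(1,2) by (simp add: exp_add powr_def ln_div)
  ultimately show ?thesis using ne by simp
qed

text \<open>The lower bound applied to \<open>1 / Q\<close>, whose logarithmic derivative is the
  negative one.\<close>

lemma log_growth_le:
  fixes Q :: "real \<Rightarrow> real"
  assumes "0 < a" "a \<le> b"
    and D: "\<And>t. t \<in> {a..b} \<Longrightarrow> (Q has_real_derivative Q' t) (at t)"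
    and ne: "\<And>t. t \<in> {a..b} \<Longrightarrow> Q t \<noteq> 0"
    and "\<And>t. t \<in> {a..b} \<Longrightarrow> t * Q' t / Q t \<le> r"
  shows "\<bar>Q b\<bar> \<le> (b / a) powr r * \<bar>Q a\<bar>"
proof -
  have "(b / a) powr (-r) * \<bar>inverse (Q a)\<bar> \<le> \<bar>inverse (Q b)\<bar>"
  proof (rule log_growth_ge[OF assms(1,2), where Q' = "\<lambda>t. - (Q' t / (Q t)\<^sup>2)"])
    fix t assume t: "t \<in> {a..b}"
    show "((\<lambda>t. inverse (Q t)) has_real_derivative - (Q' t / (Q t)\<^sup>2)) (at t)"
      using D[OF t] ne[OF t] by (auto intro!: derivative_eq_intros simp: power2_eq_square field_simps)
    have eq: "t * - (Q' t / (Q t)\<^sup>2) / inverse (Q t) = - (t * Q' t / Q t)"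
      using ne[OF t] by (simp add: power2_eq_square divide_inverse)
    show "- r \<le> t * - (Q' t / (Q t)\<^sup>2) / inverse (Q t)" unfolding eq using assms(5)[OF t] by simp
  qed (use ne in auto)
  moreover have "Q a \<noteq> 0" "Q b \<noteq> 0" using assms by auto
  moreover have "(b / a) powr r > 0" using assms by simp
  ultimately show ?thesis by (simp add: powr_minus field_simps)
qed

lemma eventually_powr_dominates:
  fixes c :: real
  assumes "c > 0" "\<alpha> < \<beta>"
  shows "eventually (\<lambda>t. t powr \<alpha> \<le> c * t powr \<beta>) at_top"
proof -
  have "eventually (\<lambda>t::real. 1 / c \<le> t powr (\<beta> - \<alpha>)) at_top"
    using eventually_ge_at_top[of "(1 / c) powr (1 / (\<beta> - \<alpha>))"]
  proof eventually_elim
    case (elim t)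
    then have "((1 / c) powr (1 / (\<beta> - \<alpha>))) powr (\<beta> - \<alpha>) \<le> t powr (\<beta> - \<alpha>)"
      using assms by (intro powr_mono2) auto
    then show ?case using assms by (simp add: powr_powr)
  qed
  then show ?thesis using eventually_gt_at_top[of 0]
  proof eventually_elim
    case (elim t)
    then have "t powr \<alpha> * 1 \<le> t powr \<alpha> * (c * t powr (\<beta> - \<alpha>))"
      using assms by (intro mult_left_mono) (auto simp: field_simps)
    also have "\<dots> = c * t powr \<beta>" using elim by (simp add: powr_diff)
    finally show ?case by simp
  qed
qed

text \<open>The strict inequality \<alpha> < r absorbs the constant that depends on the starting
  point \<open>a\<close>.\<close>

lemma log_derivative_ge_imp_powr_le:
  assumes "smooth_at_top Q" "eventually (\<lambda>t. Q t \<noteq> 0) at_top"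
    and "eventually (\<lambda>t. r \<le> t * deriv Q t / Q t) at_top" "\<alpha> < r"
  shows "eventually (\<lambda>t. t powr \<alpha> \<le> \<bar>Q t\<bar>) at_top"
proof -
  from eventually_conj[OF smooth_at_top_DERIV[OF assms(1)] eventually_conj[OF assms(2,3)]]
  obtain T where T: "\<And>t. t \<ge> T \<Longrightarrow> (Q has_real_derivative deriv Q t) (at t) \<and> Q t \<noteq> 0 \<and> r \<le> t * deriv Q t / Q t"
    by (auto simp: eventually_at_top_linorder)
  define a where "a = max T 1"
  have a: "a \<ge> T" "a > 0" by (auto simp: a_def)
  have "\<bar>Q a\<bar> / a powr r > 0" using T[of a] a by auto
  from eventually_powr_dominates[OF this assms(4)] show ?thesis
    using eventually_ge_at_top[of a]
  proof eventually_elim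
    case (elim t)
    have "(t / a) powr r * \<bar>Q a\<bar> \<le> \<bar>Q t\<bar>"
      by (rule log_growth_ge[where Q' = "deriv Q"]) (use T a elim in auto)
    moreover have "(t / a) powr r = t powr r / a powr r" using a elim by (simp add: powr_divide)
    ultimately show ?case using elim by (simp add: mult_ac)
  qed
qed

lemma log_derivative_le_imp_le_powr:
  assumes "smooth_at_top Q" "eventually (\<lambda>t. Q t \<noteq> 0) at_top"
    and "eventually (\<lambda>t. t * deriv Q t / Q t \<le> r) at_top" "r < \<alpha>"
  shows "eventually (\<lambda>t. \<bar>Q t\<bar> \<le> t powr \<alpha>) at_top"
proof -
  from eventually_conj[OF smooth_at_top_DERIV[OF assms(1)] eventually_conj[OF assms(2,3)]]
  obtain T where T: "\<And>t. t \<ge> T \<Longrightarrow> (Q has_real_derivative deriv Q t) (at t) \<and> Q t \<noteq> 0 \<and> t * deriv Q t / Q t \<le> r"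
    by (auto simp: eventually_at_top_linorder)
  define a where "a = max T 1"
  have a: "a \<ge> T" "a > 0" by (auto simp: a_def)
  have "a powr r / \<bar>Q a\<bar> > 0" using T[of a] a by auto
  from eventually_powr_dominates[OF this assms(4)] show ?thesis
    using eventually_ge_at_top[of a]
  proof eventually_elim
    case (elim t)
    have "\<bar>Q t\<bar> \<le> (t / a) powr r * \<bar>Q a\<bar>"
      by (rule log_growth_le[where Q' = "deriv Q"]) (use T a elim in auto)
    also have "(t / a) powr r = t powr r / a powr r" using a elim by (simp add: powr_divide)
    also have "t powr r / a powr r * \<bar>Q a\<bar> \<le> t powr \<alpha>" using elim T[of a] a by (simp add: field_simps)
    finally show ?case .
  qed
qed

lemma slope_powr_le:
  assumes "smooth_at_top Q" "slope Q \<sigma>" "\<alpha> < \<sigma>"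
  shows "eventually (\<lambda>t. t powr \<alpha> \<le> \<bar>Q t\<bar>) at_top"
proof -
  have "eventually (\<lambda>t. (\<alpha> + \<sigma>) / 2 < t * deriv Q t / Q t) at_top"
    using assms by (intro order_tendstoD(1)[of _ \<sigma>]) (auto simp: slope_def)
  then show ?thesis
    by (intro log_derivative_ge_imp_powr_le[where r = "(\<alpha> + \<sigma>) / 2"])
      (use assms in \<open>auto simp: slope_def elim: eventually_mono\<close>)
qed

lemma slope_le_powr:
  assumes "smooth_at_top Q" "slope Q \<sigma>" "\<sigma> < \<alpha>"
  shows "eventually (\<lambda>t. \<bar>Q t\<bar> \<le> t powr \<alpha>) at_top"
proof -
  have "eventually (\<lambda>t. t * deriv Q t / Q t < (\<alpha> + \<sigma>) / 2) at_top"
    using assms by (intro order_tendstoD(2)[of _ \<sigma>]) (auto simp: slope_def)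
  then show ?thesis
    by (intro log_derivative_le_imp_le_powr[where r = "(\<alpha> + \<sigma>) / 2"])
      (use assms in \<open>auto simp: slope_def elim: eventually_mono\<close>)
qed

lemma powr_not_eventually_le:
  fixes \<alpha> \<beta> :: real
  assumes "\<alpha> < \<beta>" "eventually (\<lambda>t. t powr \<beta> \<le> f t) at_top" "eventually (\<lambda>t. f t \<le> t powr \<alpha>) at_top"
  shows False
proof -
  have "eventually (\<lambda>t::real. t powr \<alpha> \<le> (1/2) * t powr \<beta>) at_top"
    by (rule eventually_powr_dominates) (use assms in auto)
  with assms(2,3) eventually_gt_at_top[of 0] have "eventually (\<lambda>t::real. False) at_top"
  proof eventually_elim
    case (elim t)
    have "t powr \<beta> > 0" using elim by simp
    then show ?case using elim by linarith
  qed
  then show False by simp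
qed

section \<open>Logarithmic derivatives in a Hardy field\<close>

lemma represents_inD: "represents_in f H \<Longrightarrow> smooth_at_top f"
  by (simp add: represents_in_def)

lemma germ_rel_refl: "smooth_at_top f \<Longrightarrow> germ_rel f f"
  by (simp add: germ_rel_def)

lemma abs_germ_eqD: "abs_germ f = abs_germ g \<Longrightarrow> smooth_at_top f \<Longrightarrow> smooth_at_top g \<Longrightarrow> eventually (\<lambda>t. f t = g t) at_top"
  using Quotient_rel[OF Quotient_germ, of f g] by (auto simp: germ_rel_def)

lemma represents_in_add:
  assumes "hardy_field H" "represents_in f H" "represents_in g H"
  shows "represents_in (\<lambda>t. f t + g t) H"
proof -
  have "abs_germ f + abs_germ g = abs_germ (\<lambda>t. f t + g t)"
    by (rule plus_germ.abs_eq) (use assms in \<open>auto simp: represents_in_def germ_rel_refl\<close>)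
  moreover have "abs_germ f + abs_germ g \<in> H"
    using assms by (simp add: hardy_field_def represents_in_def)
  ultimately show ?thesis
    using assms by (simp add: represents_in_def smooth_at_top_add)
qed

lemma represents_in_diff:
  assumes "hardy_field H" "represents_in f H" "represents_in g H"
  shows "represents_in (\<lambda>t. f t - g t) H"
proof -
  have "abs_germ f - abs_germ g = abs_germ (\<lambda>t. f t - g t)"
    by (rule minus_germ.abs_eq) (use assms in \<open>auto simp: represents_in_def germ_rel_refl\<close>)
  moreover have "abs_germ f - abs_germ g \<in> H"
    using assms by (simp add: hardy_field_def represents_in_def)
  ultimately show ?thesis
    using assms by (simp add: represents_in_def smooth_at_top_diff)
qed

lemma represents_in_mult:
  assumes "hardy_field H" "represents_in f H" "represents_in g H"
  shows "represents_in (\<lambda>t. f t * g t) H"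
proof -
  have "abs_germ f * abs_germ g = abs_germ (\<lambda>t. f t * g t)"
    by (rule times_germ.abs_eq) (use assms in \<open>auto simp: represents_in_def germ_rel_refl\<close>)
  moreover have "abs_germ f * abs_germ g \<in> H"
    using assms by (simp add: hardy_field_def represents_in_def)
  ultimately show ?thesis
    using assms by (simp add: represents_in_def smooth_at_top_mult)
qed

lemma represents_in_deriv:
  assumes "hardy_field H" "represents_in f H"
  shows "represents_in (deriv f) H"
proof -
  have "deriv_germ (abs_germ f) = abs_germ (deriv f)"
    by (rule deriv_germ.abs_eq) (use assms in \<open>auto simp: represents_in_def germ_rel_refl\<close>)
  moreover have "deriv_germ (abs_germ f) \<in> H"
    using assms by (simp add: hardy_field_def represents_in_def)
  ultimately show ?thesis
    using assms by (simp add: represents_in_def smooth_at_top_deriv)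
qed

lemma represents_in_0: "hardy_field H \<Longrightarrow> represents_in (\<lambda>_. 0) H"
  by (auto simp: represents_in_def hardy_field_def smooth_at_top_const simp flip: zero_germ.abs_eq)

lemma represents_in_1: "hardy_field H \<Longrightarrow> represents_in (\<lambda>_. 1) H"
  by (auto simp: represents_in_def hardy_field_def smooth_at_top_const simp flip: one_germ.abs_eq)

lemma represents_in_of_int:
  assumes "hardy_field H"
  shows "represents_in (\<lambda>_. of_int n) H"
proof (induction n rule: int_induct[where k = 0])
  case (step1 i)
  then show ?case using represents_in_add[OF assms _ represents_in_1[OF assms]] by simp
next
  case (step2 i)
  then show ?case using represents_in_diff[OF assms _ represents_in_1[OF assms]] by simp
qed (use represents_in_0[OF assms] in simp)

text \<open>Vanishing eventually is the same as representing the germ 0, so otherwise the field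
  supplies an inverse. Zeros of \<open>f\<close> at arbitrarily large arguments are thereby
  excluded.\<close>

lemma represents_in_inverse:
  assumes H: "hardy_field H" and f: "represents_in f H" and nz: "\<not> eventually (\<lambda>t. f t = 0) at_top"
  obtains g where "represents_in g H" "eventually (\<lambda>t. f t * g t = 1) at_top"
proof -
  have "abs_germ f \<noteq> 0"
  proof
    assume "abs_germ f = 0"
    then have "eventually (\<lambda>t. f t = 0) at_top"
      unfolding zero_germ.abs_eq by (rule abs_germ_eqD) (use f in \<open>auto simp: represents_in_def smooth_at_top_const\<close>)
    then show False using nz by simp
  qed
  with H f obtain y where y: "y \<in> H" "abs_germ f * y = 1"
    unfolding hardy_field_def represents_in_def by blast
  define g where "g = rep_germ y"
  \<comment> \<open>The partial equivalence is reflexive only on functions that are smooth near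
    infinity; this is how smoothness of the chosen representative is recovered.\<close>
  have "germ_rel g g" unfolding g_def by (rule Quotient_rep_reflp[OF Quotient_germ])
  then have sg: "smooth_at_top g" by (simp add: germ_rel_def)
  have yg: "y = abs_germ g" unfolding g_def by (rule Quotient_abs_rep[OF Quotient_germ, symmetric])
  have "abs_germ (\<lambda>t. f t * g t) = abs_germ (\<lambda>_. 1)"
    using y f sg unfolding yg one_germ.abs_eq
    by (subst (asm) times_germ.abs_eq) (auto simp: germ_rel_refl represents_in_def)
  then have "eventually (\<lambda>t. f t * g t = 1) at_top"
    by (rule abs_germ_eqD) (use f sg in \<open>auto simp: represents_in_def smooth_at_top_const smooth_at_top_mult\<close>)
  moreover have "represents_in g H" using sg y yg by (simp add: represents_in_def)
  ultimately show thesis by (rule that[rotated])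
qed

text \<open>An inverse forbids zeros beyond some point, and a continuous function without zeros
  keeps its sign.\<close>

lemma represents_in_nonzero:
  assumes "hardy_field H" "represents_in f H" "\<not> eventually (\<lambda>t. f t = 0) at_top"
  shows "eventually (\<lambda>t. f t > 0) at_top \<or> eventually (\<lambda>t. f t < 0) at_top"
proof -
  obtain g where g: "eventually (\<lambda>t. f t * g t = 1) at_top"
    using represents_in_inverse[OF assms] by blast
  from eventually_conj[OF g smooth_at_top_DERIV[OF represents_inD[OF assms(2)]]]
  obtain T where T: "\<And>t. t \<ge> T \<Longrightarrow> f t * g t = 1 \<and> (f has_real_derivative deriv f t) (at t)"
    by (auto simp: eventually_at_top_linorder)
  have ne: "f t \<noteq> 0" if "t \<ge> T" for t using T[OF that] by auto
  have cont: "isCont f t" if "t \<ge> T" for t using T[OF that] DERIV_isCont by blast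
  have "f T > 0 \<Longrightarrow> f t > 0" if tT: "t \<ge> T" for t
  proof (rule ccontr)
    assume "f T > 0" "\<not> f t > 0"
    then obtain x where "T \<le> x" "x \<le> t" "f x = 0"
      using IVT2[of f t 0 T] tT cont by auto
    then show False using ne by auto
  qed
  moreover have "f T < 0 \<Longrightarrow> f t < 0" if tT: "t \<ge> T" for t
  proof (rule ccontr)
    assume "f T < 0" "\<not> f t < 0"
    then obtain x where "T \<le> x" "x \<le> t" "f x = 0"
      using IVT[of f T 0 t] tT cont by auto
    then show False using ne by auto
  qed
  moreover have "f T > 0 \<or> f T < 0" using ne[of T] by auto
  ultimately show ?thesis unfolding eventually_at_top_linorder by blast
qed

text \<open>The thresholds are rational because a Hardy field contains the integers, but perhaps no
  irrational constants. Clearing the denominator keeps the difference inside the field.\<close>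

lemma represents_in_compare_rat:
  assumes "hardy_field H" "represents_in f H" "q \<in> \<rat>"
  shows "eventually (\<lambda>t. f t > q) at_top \<or> eventually (\<lambda>t. f t \<le> q) at_top"
proof -
  from assms(3) obtain a b where q: "q = of_int a / of_int b" "b > 0"
    by (rule Rats_cases') auto
  have rep: "represents_in (\<lambda>t. of_int b * f t - of_int a) H"
    by (intro represents_in_diff represents_in_mult represents_in_of_int assms)
  have iff: "f t > q \<longleftrightarrow> of_int b * f t - of_int a > 0" for t using q(2) by (simp add: q(1) pos_divide_less_eq mult_ac)
  show ?thesis
  proof (cases "eventually (\<lambda>t. of_int b * f t - of_int a = 0) at_top")
    case True
    then have "eventually (\<lambda>t. f t \<le> q) at_top"
      by eventually_elim (metis iff less_irrefl not_le)
    then show ?thesis ..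
  next
    case False
    from represents_in_nonzero[OF assms(1) rep False] show ?thesis
    proof
      assume "eventually (\<lambda>t. of_int b * f t - of_int a > 0) at_top"
      then show ?thesis unfolding iff ..
    next
      assume "eventually (\<lambda>t. of_int b * f t - of_int a < 0) at_top"
      then have "eventually (\<lambda>t. f t \<le> q) at_top"
        by eventually_elim (metis iff less_asym not_le)
      then show ?thesis ..
    qed
  qed
qed

text \<open>Each rational is either eventually exceeded or eventually not exceeded, so
  \<open>f\<close> determines a Dedekind cut. Its supremum in the extended reals is the
  limit.\<close>

lemma represents_in_ereal_limit:
  assumes "hardy_field H" "represents_in f H"
  obtains l :: ereal where "((\<lambda>t. ereal (f t)) \<longlongrightarrow> l) at_top"
proof -
  define A where "A = {ereal q | q. q \<in> \<rat> \<and> eventually (\<lambda>t. f t > q) at_top}"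
  have "((\<lambda>t. ereal (f t)) \<longlongrightarrow> Sup A) at_top"
  proof (rule order_tendstoI)
    fix x assume "x < Sup A"
    then obtain q where q: "x < ereal q" "eventually (\<lambda>t. f t > q) at_top"
      by (auto simp: less_Sup_iff A_def)
    from q(2) show "eventually (\<lambda>t. x < ereal (f t)) at_top"
      by eventually_elim (use q(1) in \<open>auto intro: less_trans\<close>)
  next
    fix x assume "Sup A < x"
    then obtain r :: rat where r: "Sup A < ereal (of_rat r)" "ereal (of_rat r) < x"
      using ereal_dense3 by blast
    have "ereal (of_rat r) \<notin> A" using r(1) Sup_upper[of _ A] by (auto simp: not_le[symmetric])
    then have "\<not> eventually (\<lambda>t. f t > of_rat r) at_top" by (auto simp: A_def)
    then have "eventually (\<lambda>t. f t \<le> of_rat r) at_top"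
      using represents_in_compare_rat[OF assms, of "of_rat r"] by auto
    then show "eventually (\<lambda>t. ereal (f t) < x) at_top"
    proof eventually_elim
      case (elim t)
      then have "ereal (f t) \<le> ereal (of_rat r)" by simp
      then show ?case using r(2) by (rule le_less_trans)
    qed
  qed
  then show thesis by (rule that)
qed

section \<open>Existence of the slope and its behaviour under differentiation\<close>

lemma DERIV_ge_imp_eventually_ge:
  fixes w :: "real \<Rightarrow> real"
  assumes "eventually (\<lambda>t. (w has_real_derivative w' t) (at t)) at_top"
    and "eventually (\<lambda>t. c < w' t) at_top" "b < c"
  shows "eventually (\<lambda>t. b * t \<le> w t) at_top"
proof -
  from eventually_conj[OF assms(1,2)]
  obtain T where T: "\<And>t. t \<ge> T \<Longrightarrow> (w has_real_derivative w' t) (at t) \<and> c < w' t"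
    by (auto simp: eventually_at_top_linorder)
  have *: "w T - c * T \<le> w t - c * t" if "T \<le> t" for t
  proof (rule DERIV_nonneg_imp_nondecreasing[OF that])
    fix x assume "T \<le> x"
    then have "((\<lambda>t. w t - c * t) has_real_derivative w' x - c) (at x)" "0 \<le> w' x - c"
      using T[of x] by (auto intro!: derivative_eq_intros)
    then show "\<exists>y. ((\<lambda>t. w t - c * t) has_real_derivative y) (at x) \<and> 0 \<le> y" by blast
  qed
  show ?thesis
    using eventually_ge_at_top[of T] eventually_ge_at_top[of "(c * T - w T) / (c - b)"]
  proof eventually_elim
    case (elim t)
    then have "c * T - w T \<le> (c - b) * t" using assms(3) by (simp add: field_simps)
    then show ?case using *[OF elim(1)] by (simp add: algebra_simps)
  qed
qed

lemma filterlim_quotient_id_at_top: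
  fixes w :: "real \<Rightarrow> real"
  assumes "eventually (\<lambda>t. (w has_real_derivative w' t) (at t)) at_top" "filterlim w' at_top at_top"
  shows "filterlim (\<lambda>t. w t / t) at_top at_top"
  unfolding filterlim_at_top
proof
  fix Z :: real
  have "eventually (\<lambda>t. Z + 1 < w' t) at_top" using assms(2) by (simp add: filterlim_at_top_dense)
  then have "eventually (\<lambda>t. Z * t \<le> w t) at_top"
    by (rule DERIV_ge_imp_eventually_ge[OF assms(1)]) simp
  with eventually_gt_at_top[of 0]
  show "eventually (\<lambda>t. Z \<le> w t / t) at_top"
    by eventually_elim (auto simp: field_simps)
qed

text \<open>The field need not contain \<open>t\<close>, so \<open>t Q' / Q\<close> may lie outside it. But \<open>w = Q / Q'\<close> lies in it, so
  \<open>w'\<close> has an extended limit, and \<open>w / t\<close> has the same one by l'Hospital's rule.\<close>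

lemma slope_trichotomy:
  assumes H: "hardy_field H" and Q: "represents_in Q H"
    and nz: "\<not> eventually (\<lambda>t. Q t = 0) at_top" "\<not> eventually (\<lambda>t. deriv Q t = 0) at_top"
  shows "(\<exists>\<sigma>. slope Q \<sigma>) \<or> (\<forall>r. eventually (\<lambda>t. t powr r \<le> \<bar>Q t\<bar>) at_top) \<or>
    (\<forall>r. eventually (\<lambda>t. \<bar>Q t\<bar> \<le> t powr r) at_top)"
proof -
  note sQ = represents_inD[OF Q]
  have Q0: "eventually (\<lambda>t. Q t \<noteq> 0) at_top"
    using represents_in_nonzero[OF H Q nz(1)] by (auto elim: eventually_mono)
  obtain g where g: "represents_in g H" "eventually (\<lambda>t. deriv Q t * g t = 1) at_top"
    using represents_in_inverse[OF H represents_in_deriv[OF H Q] nz(2)] by blast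
  define w where "w = (\<lambda>t. Q t * g t)"
  have w: "represents_in w H" unfolding w_def by (intro represents_in_mult H Q g)
  have u_eq: "eventually (\<lambda>t. inverse (w t / t) = t * deriv Q t / Q t) at_top"
    using g(2) Q0 eventually_gt_at_top[of 0]
  proof eventually_elim
    case (elim t)
    then have "deriv Q t \<noteq> 0" by auto
    with elim have "g t = 1 / deriv Q t" by (simp add: field_simps)
    then show ?case by (simp add: w_def)
  qed
  have w0: "\<not> eventually (\<lambda>t. w t = 0) at_top"
  proof
    assume "eventually (\<lambda>t. w t = 0) at_top"
    with Q0 g(2) have "eventually (\<lambda>t::real. False) at_top"
      by eventually_elim (auto simp: w_def)
    then show False by simp
  qed
  note Dw = smooth_at_top_DERIV[OF represents_inD[OF w]]
  have large: ?thesis if "filterlim (\<lambda>t. t * deriv Q t / Q t) at_top at_top"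
  proof (rule disjI2, rule disjI1, rule allI)
    fix r
    have "eventually (\<lambda>t. r + 1 \<le> t * deriv Q t / Q t) at_top" using that by (simp add: filterlim_at_top)
    from log_derivative_ge_imp_powr_le[OF sQ Q0 this]
    show "eventually (\<lambda>t. t powr r \<le> \<bar>Q t\<bar>) at_top" by simp
  qed
  have small: ?thesis if "filterlim (\<lambda>t. t * deriv Q t / Q t) at_bot at_top"
  proof (rule disjI2, rule disjI2, rule allI)
    fix r
    have "eventually (\<lambda>t. t * deriv Q t / Q t \<le> r - 1) at_top" using that by (simp add: filterlim_at_bot)
    from log_derivative_le_imp_le_powr[OF sQ Q0 this]
    show "eventually (\<lambda>t. \<bar>Q t\<bar> \<le> t powr r) at_top" by simp
  qed
  have mid: ?thesis if "((\<lambda>t. inverse (w t / t)) \<longlongrightarrow> \<sigma>) at_top" for \<sigma>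
    using tendsto_cong[OF u_eq, of \<sigma>] that Q0 by (auto simp: slope_def)
  obtain l where l: "((\<lambda>t. ereal (deriv w t)) \<longlongrightarrow> l) at_top"
    using represents_in_ereal_limit[OF H represents_in_deriv[OF H w]] by blast
  show ?thesis
  proof (cases l)
    case (real r)
    have lim: "((\<lambda>t. w t / t) \<longlongrightarrow> r) at_top"
    proof (rule lhospital_at_top_at_top[where f' = "deriv w" and g' = "\<lambda>_. 1"])
      show "((\<lambda>t. deriv w t / 1) \<longlongrightarrow> r) at_top" using l real by simp
    qed (use Dw filterlim_ident in auto)
    show ?thesis
    proof (cases "r = 0")
      case False
      then show ?thesis using mid tendsto_inverse[OF lim] by blast
    next
      case True
      \<comment> \<open>The limit 0 is approached from one side, because \<open>w\<close> has a
        constant sign. The reciprocal therefore tends to one definite infinity, which means growth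
        beyond, or decay below, every power.\<close>
      from represents_in_nonzero[OF H w w0] show ?thesis
      proof
        assume "eventually (\<lambda>t. w t > 0) at_top"
        then have "eventually (\<lambda>t. 0 < w t / t) at_top"
          using eventually_gt_at_top[of 0] by eventually_elim auto
        with lim True have "filterlim (\<lambda>t. inverse (w t / t)) at_top at_top"
          by (intro filterlim_inverse_at_top) auto
        then show ?thesis using filterlim_cong[OF refl refl u_eq] large by blast
      next
        assume "eventually (\<lambda>t. w t < 0) at_top"
        then have "eventually (\<lambda>t. w t / t < 0) at_top"
          using eventually_gt_at_top[of 0] by eventually_elim (auto simp: divide_less_0_iff)
        with lim True have "filterlim (\<lambda>t. inverse (w t / t)) at_bot at_top"
          by (intro filterlim_inverse_at_bot) auto
        then show ?thesis using filterlim_cong[OF refl refl u_eq] small by blast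
      qed
    qed
  next
    case PInf
    then have "filterlim (deriv w) at_top at_top"
      using l by (simp add: tendsto_PInfty filterlim_at_top_dense)
    from filterlim_quotient_id_at_top[OF Dw this] show ?thesis
      by (intro mid[of 0] tendsto_inverse_0_at_top)
  next
    case MInf
    then have "filterlim (\<lambda>t. - deriv w t) at_top at_top"
      using l by (simp add: tendsto_MInfty filterlim_at_bot_dense flip: filterlim_uminus_at_bot)
    moreover have "eventually (\<lambda>t. ((\<lambda>t. - w t) has_real_derivative - deriv w t) (at t)) at_top"
      using Dw by eventually_elim (rule DERIV_minus)
    ultimately have "filterlim (\<lambda>t. - w t / t) at_top at_top"
      by (intro filterlim_quotient_id_at_top)
    from tendsto_minus[OF tendsto_inverse_0_at_top[OF this]] show ?thesis
      by (intro mid[of 0]) (simp add: divide_inverse)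
  qed
qed

lemma eventually_nonzero_of_powr_le:
  fixes f :: "real \<Rightarrow> real"
  assumes "eventually (\<lambda>t. t powr \<alpha> \<le> \<bar>f t\<bar>) at_top"
  shows "\<not> eventually (\<lambda>t. f t = 0) at_top"
proof
  assume "eventually (\<lambda>t. f t = 0) at_top"
  with assms eventually_gt_at_top[of 0] have "eventually (\<lambda>t::real. False) at_top"
  proof eventually_elim
    case (elim t)
    then have "t powr \<alpha> > 0" by simp
    then show ?case using elim by simp
  qed
  then show False by simp
qed

text \<open>The trichotomy supplies the regularity, so rough bounds identify the slope; the lower
  one is only asked for at arbitrarily large arguments, not at all large ones.\<close>

lemma slopeI_of_bounds:
  assumes H: "hardy_field H" and Q: "represents_in Q H"
    and nz: "\<not> eventually (\<lambda>t. Q t = 0) at_top" "\<not> eventually (\<lambda>t. deriv Q t = 0) at_top"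
    and upper: "\<And>\<alpha>. \<sigma> < \<alpha> \<Longrightarrow> eventually (\<lambda>t. \<bar>Q t\<bar> \<le> t powr \<alpha>) at_top"
    and lower: "\<And>\<alpha>. \<alpha> < \<sigma> \<Longrightarrow> \<not> eventually (\<lambda>t. \<bar>Q t\<bar> \<le> t powr \<alpha>) at_top"
  shows "slope Q \<sigma>"
proof -
  from slope_trichotomy[OF H Q nz] consider \<mu> where "slope Q \<mu>"
    | "\<forall>r. eventually (\<lambda>t. t powr r \<le> \<bar>Q t\<bar>) at_top" | "\<forall>r. eventually (\<lambda>t. \<bar>Q t\<bar> \<le> t powr r) at_top"
    by blast
  then show ?thesis
  proof cases
    case 1
    have "\<not> \<mu> < \<sigma>"
    proof
      assume "\<mu> < \<sigma>"
      then show False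
        using slope_le_powr[OF represents_inD[OF Q] 1, of "(\<mu> + \<sigma>) / 2"] lower[of "(\<mu> + \<sigma>) / 2"] by simp
    qed
    moreover have "\<not> \<sigma> < \<mu>"
    proof
      assume "\<sigma> < \<mu>"
      \<comment> \<open>The two points that trisect the interval from \<sigma> to \<mu>:
        \<open>Q\<close> would eventually be below the smaller power and above the larger
        one.\<close>
      then show False
        using slope_powr_le[OF represents_inD[OF Q] 1, of "(2 * \<mu> + \<sigma>) / 3"] upper[of "(\<mu> + 2 * \<sigma>) / 3"]
          powr_not_eventually_le[of "(\<mu> + 2 * \<sigma>) / 3" "(2 * \<mu> + \<sigma>) / 3"] by simp
    qed
    ultimately show ?thesis using 1 by (metis linorder_neqE_linordered_idom)
  next
    case 2
    then show ?thesis using upper[of "\<sigma> + 1"] powr_not_eventually_le[of "\<sigma> + 1" "\<sigma> + 2" "\<lambda>t. \<bar>Q t\<bar>"] by auto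
  next
    case 3
    then show ?thesis using lower[of "\<sigma> - 1"] by auto
  qed
qed

text \<open>Comparison with the tail integral of \<open>t powr \<alpha>\<close> bounds
  \<open>Q\<close>. The Hardy field provides the limit, and the same comparison then yields the
  rate.\<close>

lemma convergent_of_deriv_le_powr:
  assumes H: "hardy_field H" and Q: "represents_in Q H"
    and small: "eventually (\<lambda>t. \<bar>deriv Q t\<bar> \<le> t powr \<alpha>) at_top" and \<alpha>: "\<alpha> < -1"
  obtains l where "(Q \<longlongrightarrow> l) at_top"
    "eventually (\<lambda>t. \<bar>Q t - l\<bar> \<le> t powr (\<alpha> + 1) / - (\<alpha> + 1)) at_top"
proof -
  define b where "b = - (\<alpha> + 1)"
  have b: "b > 0" "- b - 1 = \<alpha>" "\<alpha> + 1 = - b" using \<alpha> by (auto simp: b_def)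
  \<comment> \<open>The integral of \<open>s powr \<alpha>\<close> over s > t. Adding it to
    \<open>Q\<close> gives a decreasing function, subtracting it an increasing one.\<close>
  define \<psi> where "\<psi> = (\<lambda>t::real. t powr (-b) / b)"
  have D\<psi>: "(\<psi> has_real_derivative - (t powr \<alpha>)) (at t)" if "t > 0" for t
    unfolding \<psi>_def using that b(1) by (auto intro!: derivative_eq_intros simp flip: b(2))
  from eventually_conj[OF smooth_at_top_DERIV[OF represents_inD[OF Q]] eventually_conj[OF small eventually_gt_at_top[of 0]]]
  obtain T where T: "\<And>t. t \<ge> T \<Longrightarrow> (Q has_real_derivative deriv Q t) (at t) \<and> \<bar>deriv Q t\<bar> \<le> t powr \<alpha> \<and> t > 0"
    by (auto simp: eventually_at_top_linorder)
  have bound: "\<bar>Q t - Q s\<bar> \<le> \<psi> s" if "T \<le> s" "s \<le> t" for s t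
  proof -
    have "Q t + \<psi> t \<le> Q s + \<psi> s"
    proof (rule DERIV_nonpos_imp_nonincreasing[OF that(2)])
      fix x assume "s \<le> x"
      then have x: "T \<le> x" using that by simp
      have "((\<lambda>t. Q t + \<psi> t) has_real_derivative deriv Q x + - (x powr \<alpha>)) (at x)" "deriv Q x + - (x powr \<alpha>) \<le> 0"
        using T[OF x] DERIV_add[OF _ D\<psi>[of x]] by auto
      then show "\<exists>y. ((\<lambda>t. Q t + \<psi> t) has_real_derivative y) (at x) \<and> y \<le> 0" by blast
    qed
    moreover have "Q s - \<psi> s \<le> Q t - \<psi> t"
    proof (rule DERIV_nonneg_imp_nondecreasing[OF that(2)])
      fix x assume "s \<le> x"
      then have x: "T \<le> x" using that by simp
      have "((\<lambda>t. Q t - \<psi> t) has_real_derivative deriv Q x - - (x powr \<alpha>)) (at x)" "deriv Q x - - (x powr \<alpha>) \<ge> 0"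
        using T[OF x] DERIV_diff[OF _ D\<psi>[of x]] by auto
      then show "\<exists>y. ((\<lambda>t. Q t - \<psi> t) has_real_derivative y) (at x) \<and> 0 \<le> y" by blast
    qed
    moreover have "\<psi> t \<ge> 0" using b by (simp add: \<psi>_def)
    ultimately show ?thesis by linarith
  qed
  obtain l where l: "((\<lambda>t. ereal (Q t)) \<longlongrightarrow> l) at_top"
    using represents_in_ereal_limit[OF H Q] by blast
  have "eventually (\<lambda>t. ereal (Q t) \<le> ereal (Q T + \<psi> T)) at_top"
    using eventually_ge_at_top[of T] by eventually_elim (use bound[of T] in force)
  from tendsto_upperbound[OF l this] have lu: "l \<le> ereal (Q T + \<psi> T)" by simp
  have "eventually (\<lambda>t. ereal (Q t) \<ge> ereal (Q T - \<psi> T)) at_top"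
    using eventually_ge_at_top[of T] by eventually_elim (use bound[of T] in force)
  from tendsto_lowerbound[OF l this] have ll: "l \<ge> ereal (Q T - \<psi> T)" by simp
  from lu ll obtain r where r: "l = ereal r" by (cases l) auto
  have lim: "(Q \<longlongrightarrow> r) at_top" using l r by simp
  have "\<bar>Q s - r\<bar> \<le> \<psi> s" if "T \<le> s" for s
  proof -
    have "((\<lambda>t. \<bar>Q t - Q s\<bar>) \<longlongrightarrow> \<bar>r - Q s\<bar>) at_top" by (intro tendsto_intros lim)
    moreover have "eventually (\<lambda>t. \<bar>Q t - Q s\<bar> \<le> \<psi> s) at_top"
      using eventually_ge_at_top[of s] by eventually_elim (rule bound[OF that])
    ultimately have "\<bar>r - Q s\<bar> \<le> \<psi> s" by (rule tendsto_upperbound) simp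
    then show ?thesis by (simp add: abs_minus_commute)
  qed
  then have "eventually (\<lambda>t. \<bar>Q t - r\<bar> \<le> \<psi> t) at_top"
    by (auto simp: eventually_at_top_linorder)
  moreover have "\<psi> t = t powr (\<alpha> + 1) / - (\<alpha> + 1)" for t by (simp add: \<psi>_def b_def add.commute)
  ultimately show thesis using that[of r] lim by simp
qed

text \<open>The delicate case is \<open>\<sigma> = 0\<close>: there \<open>t Q' / Q\<close> tends to \<open>0\<close> and does not determine the size of
  \<open>Q'\<close>. If \<open>Q'\<close> were smaller than expected, \<open>Q\<close> would converge, which \<open>nlim\<close> (condition (ii) in the
  application) rules out unless the limit is \<open>0\<close>.\<close>

lemma slope_deriv:
  assumes H: "hardy_field H" and Q: "represents_in Q H" and sl: "slope Q \<sigma>"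
    and nz: "\<not> eventually (\<lambda>t. deriv Q t = 0) at_top" "\<not> eventually (\<lambda>t. deriv (deriv Q) t = 0) at_top"
    and nlim: "\<And>l. l \<noteq> 0 \<Longrightarrow> \<not> (Q \<longlongrightarrow> l) at_top"
  shows "slope (deriv Q) (\<sigma> - 1)"
proof (rule slopeI_of_bounds[OF H represents_in_deriv[OF H Q] nz])
  note sQ = represents_inD[OF Q]
  have lim: "((\<lambda>t. t * deriv Q t / Q t) \<longlongrightarrow> \<sigma>) at_top" and Q0: "eventually (\<lambda>t. Q t \<noteq> 0) at_top"
    using sl by (auto simp: slope_def)
  show "eventually (\<lambda>t. \<bar>deriv Q t\<bar> \<le> t powr \<alpha>) at_top" if \<alpha>: "\<sigma> - 1 < \<alpha>" for \<alpha>
  proof -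
    \<comment> \<open>The midpoint of \<sigma> and \<alpha> + 1: one half of the gap turns the slope
      into a bound for \<open>Q\<close>, the other absorbs the constant |\<sigma>| + 1.\<close>
    define \<beta> where "\<beta> = (\<sigma> + \<alpha> + 1) / 2"
    have \<beta>: "\<sigma> < \<beta>" "\<beta> - 1 < \<alpha>" using \<alpha> by (auto simp: \<beta>_def)
    have "eventually (\<lambda>t. \<bar>t * deriv Q t / Q t\<bar> < \<bar>\<sigma>\<bar> + 1) at_top"
      using tendsto_rabs[OF lim] by (rule order_tendstoD) simp
    moreover have "eventually (\<lambda>t. t powr (\<beta> - 1) \<le> 1 / (\<bar>\<sigma>\<bar> + 1) * t powr \<alpha>) at_top"
      by (rule eventually_powr_dominates) (use \<beta> in auto)
    ultimately show ?thesis
      using slope_le_powr[OF sQ sl \<beta>(1)] Q0 eventually_gt_at_top[of 0]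
    proof eventually_elim
      case (elim t)
      have "t * \<bar>deriv Q t\<bar> \<le> (\<bar>\<sigma>\<bar> + 1) * \<bar>Q t\<bar>"
        using elim by (simp add: abs_mult abs_divide field_simps)
      also have "\<dots> \<le> (\<bar>\<sigma>\<bar> + 1) * t powr \<beta>" using elim by (intro mult_left_mono) auto
      finally have "\<bar>deriv Q t\<bar> \<le> (\<bar>\<sigma>\<bar> + 1) * t powr (\<beta> - 1)"
        using elim by (simp add: powr_diff field_simps)
      also have "\<dots> \<le> (\<bar>\<sigma>\<bar> + 1) * (1 / (\<bar>\<sigma>\<bar> + 1) * t powr \<alpha>)" using elim by (intro mult_left_mono) auto
      also have "\<dots> = t powr \<alpha>" by simp
      finally show ?case .
    qed
  qed
  show "\<not> eventually (\<lambda>t. \<bar>deriv Q t\<bar> \<le> t powr \<alpha>) at_top" if \<alpha>: "\<alpha> < \<sigma> - 1" for \<alpha>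
  proof
    assume small: "eventually (\<lambda>t. \<bar>deriv Q t\<bar> \<le> t powr \<alpha>) at_top"
    define \<beta> where "\<beta> = (\<sigma> + \<alpha> + 1) / 2"
    have \<beta>: "\<beta> < \<sigma>" "\<alpha> + 1 < \<beta>" using \<alpha> by (auto simp: \<beta>_def)
    show False
    proof (cases "\<sigma> = 0")
      case False
      have "eventually (\<lambda>t. \<bar>\<sigma>\<bar> / 2 < \<bar>t * deriv Q t / Q t\<bar>) at_top"
        using tendsto_rabs[OF lim] by (rule order_tendstoD) (use False in simp)
      moreover have "eventually (\<lambda>t. t powr (\<alpha> + 1) \<le> \<bar>\<sigma>\<bar> / 2 * t powr \<beta>) at_top"
        by (rule eventually_powr_dominates) (use \<beta> False in auto)
      ultimately have "eventually (\<lambda>t::real. False) at_top"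
        using slope_powr_le[OF sQ sl \<beta>(1)] Q0 eventually_gt_at_top[of 0] small
      proof eventually_elim
        case (elim t)
        have "\<bar>\<sigma>\<bar> / 2 * t powr \<beta> \<le> \<bar>\<sigma>\<bar> / 2 * \<bar>Q t\<bar>" using elim by (intro mult_left_mono) auto
        also have "\<dots> < t * \<bar>deriv Q t\<bar>"
          using elim by (simp add: abs_mult abs_divide field_simps)
        also have "\<dots> \<le> t * t powr \<alpha>" using elim by (intro mult_left_mono) auto
        also have "\<dots> = t powr (\<alpha> + 1)" using elim by (simp add: powr_add)
        finally show ?case using elim by simp
      qed
      then show False by simp
    next
      case True
      obtain l where l: "(Q \<longlongrightarrow> l) at_top"
        "eventually (\<lambda>t. \<bar>Q t - l\<bar> \<le> t powr (\<alpha> + 1) / - (\<alpha> + 1)) at_top"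
        using convergent_of_deriv_le_powr[OF H Q small] \<alpha> True by auto
      \<comment> \<open>The error term now bounds \<open>Q\<close> itself by a power with exponent
        \<gamma> < \<beta> < 0, too small for a function of slope 0.\<close>
      have "l = 0" using nlim l by blast
      define \<gamma> where "\<gamma> = (\<alpha> + 1 + \<beta>) / 2"
      have \<gamma>: "\<alpha> + 1 < \<gamma>" "\<gamma> < \<beta>" using \<beta> by (auto simp: \<gamma>_def)
      have "eventually (\<lambda>t. t powr (\<alpha> + 1) \<le> - (\<alpha> + 1) * t powr \<gamma>) at_top"
        by (rule eventually_powr_dominates) (use \<gamma> \<alpha> True in auto)
      with l(2) have "eventually (\<lambda>t. \<bar>Q t\<bar> \<le> t powr \<gamma>) at_top"
      proof eventually_elim
        case (elim t)
        have "t powr (\<alpha> + 1) / - (\<alpha> + 1) \<le> t powr \<gamma>" using elim(2) \<alpha> True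
          by (subst pos_divide_le_eq) (auto simp: mult_ac)
        then show ?case using elim(1) \<open>l = 0\<close> by simp
      qed
      then show False using powr_not_eventually_le[OF \<gamma>(2) slope_powr_le[OF sQ sl \<beta>(1)]] by blast
    qed
  qed
qed

text \<open>Iterated l'Hospital. A nonzero limit of the k-th derivative becomes a nonzero limit of
  \<open>P t / t ^ k\<close>, a statement about \<open>P\<close> itself that condition (ii) can
  contradict.\<close>

lemma tendsto_quotient_power_of_funpow_deriv:
  assumes "smooth_at_top P" "((deriv ^^ k) P \<longlongrightarrow> l) at_top"
  shows "((\<lambda>t. P t / t ^ k) \<longlongrightarrow> l / fact k) at_top"
  using assms
proof (induction k arbitrary: P)
  case (Suc k)
  have "((\<lambda>t. deriv P t / t ^ k) \<longlongrightarrow> l / fact k) at_top"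
    by (rule Suc.IH) (use Suc.prems in \<open>auto intro: smooth_at_top_deriv simp: funpow_Suc_right simp del: funpow.simps\<close>)
  then have "((\<lambda>t. deriv P t / t ^ k / real (Suc k)) \<longlongrightarrow> l / fact k / real (Suc k)) at_top"
    by (rule tendsto_divide[OF _ tendsto_const]) auto
  moreover have "(\<lambda>t. deriv P t / t ^ k / real (Suc k)) = (\<lambda>t. deriv P t / (real (Suc k) * t ^ k))"
    by (auto simp: mult_ac)
  moreover have "l / fact k / real (Suc k) = l / fact (Suc k)" by (simp add: mult_ac)
  ultimately have lim: "((\<lambda>t. deriv P t / (real (Suc k) * t ^ k)) \<longlongrightarrow> l / fact (Suc k)) at_top"
    by (simp only:)
  show ?case
  proof (rule lhospital_at_top_at_top[where f' = "deriv P" and g' = "\<lambda>t. real (Suc k) * t ^ k"])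
    show "filterlim (\<lambda>t::real. t ^ Suc k) at_top at_top"
      by (intro filterlim_pow_at_top filterlim_ident) auto
    show "eventually (\<lambda>t. real (Suc k) * t ^ k \<noteq> 0) at_top"
      using eventually_gt_at_top[of 0] by eventually_elim auto
    show "eventually (\<lambda>t. ((\<lambda>t. t ^ Suc k) has_real_derivative real (Suc k) * t ^ k) (at t)) at_top"
      using DERIV_pow[of "Suc k"] by simp
  qed (use smooth_at_top_DERIV Suc.prems lim in auto)
qed simp

lemma eventually_const_of_deriv_0:
  assumes "smooth_at_top P" "eventually (\<lambda>t. deriv P t = 0) at_top"
  obtains c where "eventually (\<lambda>t. P t = c) at_top"
proof -
  from eventually_conj[OF assms(2) smooth_at_top_DERIV[OF assms(1)]]
  obtain T where T': "\<And>t. t \<ge> T \<Longrightarrow> deriv P t = 0 \<and> (P has_real_derivative deriv P t) (at t)"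
    unfolding eventually_at_top_linorder by blast
  have T: "(P has_real_derivative 0) (at t)" if "t \<ge> T" for t
    using T'[OF that] by metis
  have "P t = P T" if "t \<ge> T" for t
  proof (cases "t = T")
    case False
    then have "T < t" using that by simp
    from MVT2[OF this, of P "\<lambda>_. 0"] T show ?thesis by auto
  qed simp
  then have "eventually (\<lambda>t. P t = P T) at_top"
    unfolding eventually_at_top_linorder by blast
  then show thesis by (rule that)
qed

text \<open>The common ground of both classes and the only input of the rest of the proof. Slopes
  are demanded at every order, because the order \<open>K\<close> used later exceeds all
  types.\<close>

definition tame :: "nat \<Rightarrow> (nat \<Rightarrow> real \<Rightarrow> real) \<Rightarrow> (nat \<Rightarrow> real) \<Rightarrow> bool" where
  "tame m P \<tau> \<longleftrightarrow>
     (\<forall>i\<in>{1..m}. smooth_at_top (P i) \<and> 0 < \<tau> i \<and> (\<forall>k. slope ((deriv ^^ k) (P i)) (\<tau> i - real k))) \<and>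
     inj_on \<tau> {1..m}"

text \<open>Induction through \<open>slope_deriv\<close>, whose side conditions are that no
  derivative vanishes eventually and that none has a nonzero limit. The second yields the first: a
  vanishing derivative would make the previous one eventually a nonzero constant.\<close>

lemma slope_funpow_deriv:
  assumes H: "hardy_field H" and P: "represents_in P H" and sl: "slope P \<tau>" "0 < \<tau>"
    and pow: "\<And>k::nat. k \<ge> 1 \<Longrightarrow> ((\<lambda>t. P t / t ^ k) \<longlongrightarrow> 0) at_top \<or> ((\<lambda>t. t ^ k / P t) \<longlongrightarrow> 0) at_top"
  shows "slope ((deriv ^^ k) P) (\<tau> - real k)"
proof -
  note sP = represents_inD[OF P]
  have rep: "represents_in ((deriv ^^ k) P) H" for k
  proof (induction k)
    case (Suc k)
    then show ?case using represents_in_deriv[OF H] by simp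
  qed (use P in simp)
  have nlim: "\<not> ((deriv ^^ k) P \<longlongrightarrow> l) at_top" if "l \<noteq> 0" for k l
  proof
    assume "((deriv ^^ k) P \<longlongrightarrow> l) at_top"
    then have lim: "((\<lambda>t. P t / t ^ k) \<longlongrightarrow> l / fact k) at_top"
      by (rule tendsto_quotient_power_of_funpow_deriv[OF sP])
    show False
    proof (cases "k = 0")
      case True
      then have "(P \<longlongrightarrow> l) at_top" using lim by simp
      then have "eventually (\<lambda>t. \<bar>P t\<bar> < \<bar>l\<bar> + 1) at_top"
        by (intro order_tendstoD(2)[OF tendsto_rabs]) auto
      moreover have "eventually (\<lambda>t. t powr 0 \<le> 1 / (\<bar>l\<bar> + 1) * t powr (\<tau> / 3)) at_top"
        by (rule eventually_powr_dominates) (use sl in auto)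
      ultimately have "eventually (\<lambda>t. \<bar>P t\<bar> \<le> t powr (\<tau> / 3)) at_top"
        using eventually_gt_at_top[of 0] by eventually_elim (auto simp: field_simps)
      moreover have "eventually (\<lambda>t. t powr (\<tau> / 2) \<le> \<bar>P t\<bar>) at_top"
        by (rule slope_powr_le[OF sP sl(1)]) (use sl in auto)
      ultimately show False using powr_not_eventually_le[of "\<tau> / 3" "\<tau> / 2"] sl by auto
    next
      case False
      have "l / fact k \<noteq> 0" using that by simp
      from tendsto_inverse[OF lim this]
      have lim': "((\<lambda>t. t ^ k / P t) \<longlongrightarrow> inverse (l / fact k)) at_top" by simp
      have "inverse (l / fact k) \<noteq> 0" using that by simp
      with pow[of k] False lim lim' \<open>l / fact k \<noteq> 0\<close> show False
        by (metis One_nat_def Suc_leI neq0_conv tendsto_unique trivial_limit_at_top_linorder)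
    qed
  qed
  have nz: "\<not> eventually (\<lambda>t. (deriv ^^ k) P t = 0) at_top" for k
  proof (induction k)
    case 0
    then show ?case
      using eventually_nonzero_of_powr_le[OF slope_powr_le[OF sP sl(1), of "\<tau> / 2"]] sl by auto
  next
    case (Suc k)
    show ?case
    proof
      assume "eventually (\<lambda>t. (deriv ^^ Suc k) P t = 0) at_top"
      then obtain l where ev: "eventually (\<lambda>t. (deriv ^^ k) P t = l) at_top"
        using eventually_const_of_deriv_0[OF represents_inD[OF rep[of k]]] by auto
      then have "l \<noteq> 0" using Suc.IH by auto
      moreover have "((deriv ^^ k) P \<longlongrightarrow> l) at_top" using ev by (rule tendsto_eventually)
      ultimately show False using nlim by blast
    qed
  qed
  show ?thesis
  proof (induction k)
    case (Suc k)
    have "slope (deriv ((deriv ^^ k) P)) (\<tau> - real k - 1)"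
      by (rule slope_deriv[OF H rep Suc.IH]) (use nz[of "Suc k"] nz[of "Suc (Suc k)"] nlim in auto)
    then show ?case by (simp add: algebra_simps)
  qed (use sl in simp)
qed

section \<open>Both classes are tame\<close>

lemma growth_type_slope:
  assumes "smooth_at_top P" "slope P \<sigma>"
  shows "growth_type P = ereal \<sigma>"
  unfolding growth_type_def
proof (rule antisym)
  show "Inf {ereal \<alpha> |\<alpha>. eventually (\<lambda>t. \<bar>P t\<bar> \<le> t powr \<alpha>) at_top} \<le> ereal \<sigma>"
  proof (rule ereal_le_epsilon2)
    fix x :: real assume "0 < x"
    then have "eventually (\<lambda>t. \<bar>P t\<bar> \<le> t powr (\<sigma> + x)) at_top"
      by (intro slope_le_powr[OF assms]) auto
    then show "Inf {ereal \<alpha> |\<alpha>. eventually (\<lambda>t. \<bar>P t\<bar> \<le> t powr \<alpha>) at_top} \<le> ereal \<sigma> + ereal x"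
      by (intro Inf_lower) auto
  qed
  show "ereal \<sigma> \<le> Inf {ereal \<alpha> |\<alpha>. eventually (\<lambda>t. \<bar>P t\<bar> \<le> t powr \<alpha>) at_top}"
  proof (rule Inf_greatest, safe)
    fix \<alpha> assume *: "eventually (\<lambda>t. \<bar>P t\<bar> \<le> t powr \<alpha>) at_top"
    show "ereal \<sigma> \<le> ereal \<alpha>"
    proof (rule ccontr)
      assume "\<not> ereal \<sigma> \<le> ereal \<alpha>"
      then show False
        using powr_not_eventually_le[OF _ slope_powr_le[OF assms, of "(\<alpha> + \<sigma>) / 2"] *] by auto
    qed
  qed
qed

lemma growth_type_le:
  "eventually (\<lambda>t. \<bar>P t\<bar> \<le> t powr \<alpha>) at_top \<Longrightarrow> growth_type P \<le> ereal \<alpha>"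
  unfolding growth_type_def by (intro Inf_lower) auto

lemma eventually_abs_const_le_powr:
  fixes c \<alpha> :: real
  assumes "0 < \<alpha>"
  shows "eventually (\<lambda>t. \<bar>c\<bar> \<le> t powr \<alpha>) at_top"
proof -
  have "eventually (\<lambda>t::real. t powr 0 \<le> 1 / (\<bar>c\<bar> + 1) * t powr \<alpha>) at_top"
    by (rule eventually_powr_dominates) (use assms in auto)
  then show ?thesis using eventually_gt_at_top[of 0]
    by eventually_elim (auto simp: field_simps)
qed

text \<open>Polynomial growth excludes constants and the two extreme cases of the trichotomy, so the
  slope exists and equals the type; distinct types are then distinct slopes.\<close>

lemma class_P_tame:
  assumes "class_P m P"
  obtains \<tau> where "tame m P \<tau>"
proof -
  from assms obtain H where H: "hardy_field H" "\<And>i. i \<in> {1..m} \<Longrightarrow> represents_in (P i) H"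
    by (auto simp: class_P_def from_hardy_field_def)
  have sl: "\<exists>\<sigma>>0. slope (P i) \<sigma>" if i: "i \<in> {1..m}" for i
  proof -
    note rep = H(2)[OF i]
    note sP = represents_inD[OF rep]
    have pg: "0 < growth_type (P i)" "growth_type (P i) < \<infinity>"
      using assms i by (auto simp: class_P_def polynomial_growth_def)
    have nconst: "\<not> eventually (\<lambda>t. P i t = c) at_top" for c
    proof
      assume *: "eventually (\<lambda>t. P i t = c) at_top"
      have "growth_type (P i) \<le> ereal \<alpha>" if "0 < \<alpha>" for \<alpha>
      proof (rule growth_type_le)
        show "eventually (\<lambda>t. \<bar>P i t\<bar> \<le> t powr \<alpha>) at_top"
          using * eventually_abs_const_le_powr[OF that, of c] by eventually_elim auto
      qed
      then have "growth_type (P i) \<le> 0" using ereal_le_epsilon2[of "growth_type (P i)" 0] by auto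
      then show False using pg by simp
    qed
    have nz: "\<not> eventually (\<lambda>t. deriv (P i) t = 0) at_top"
      using eventually_const_of_deriv_0[OF sP] nconst by metis
    from slope_trichotomy[OF H(1) rep nconst nz] consider \<sigma> where "slope (P i) \<sigma>"
      | "\<forall>r. eventually (\<lambda>t. t powr r \<le> \<bar>P i t\<bar>) at_top" | "\<forall>r. eventually (\<lambda>t. \<bar>P i t\<bar> \<le> t powr r) at_top"
      by blast
    then show ?thesis
    proof cases
      case 1
      then show ?thesis using pg growth_type_slope[OF sP 1] by auto
    next
      case 2
      have "\<not> eventually (\<lambda>t. \<bar>P i t\<bar> \<le> t powr \<alpha>) at_top" for \<alpha>
        using powr_not_eventually_le[of \<alpha> "\<alpha> + 1" "\<lambda>t. \<bar>P i t\<bar>"] 2 by auto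
      then have "growth_type (P i) = \<infinity>" by (simp add: growth_type_def top_ereal_def)
      then show ?thesis using pg by simp
    next
      case 3
      have "growth_type (P i) \<le> ereal (-1)" using 3 by (intro growth_type_le) blast
      then show ?thesis using pg by (metis ereal_less_eq(5) less_le_trans neg_0_le_iff_le not_one_le_zero order.strict_implies_order)
    qed
  qed
  then obtain \<tau> where \<tau>: "\<And>i. i \<in> {1..m} \<Longrightarrow> 0 < \<tau> i \<and> slope (P i) (\<tau> i)" by metis
  have inj: "inj_on (\<lambda>i. growth_type (P i)) {1..m}"
    using assms unfolding class_P_def by (elim conjE)
  have "inj_on \<tau> {1..m}"
  proof (rule inj_onI)
    fix i j assume ij: "i \<in> {1..m}" "j \<in> {1..m}" "\<tau> i = \<tau> j"
    then have "growth_type (P i) = growth_type (P j)"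
      using \<tau> growth_type_slope represents_inD[OF H(2)] by metis
    with inj ij show "i = j" by (auto dest: inj_onD)
  qed
  moreover have pow: "\<forall>i\<in>{1..m}. \<forall>k::nat. k \<ge> 1 \<longrightarrow>
      ((\<lambda>t. P i t / t ^ k) \<longlongrightarrow> 0) at_top \<or> ((\<lambda>t. t ^ k / P i t) \<longlongrightarrow> 0) at_top"
    using assms unfolding class_P_def by (elim conjE)
  moreover have "slope ((deriv ^^ k) (P i)) (\<tau> i - real k)" if "i \<in> {1..m}" for i k
  proof (rule slope_funpow_deriv[OF H(1) H(2)[OF that]])
    show "((\<lambda>t. P i t / t ^ k) \<longlongrightarrow> 0) at_top \<or> ((\<lambda>t. t ^ k / P i t) \<longlongrightarrow> 0) at_top" if "k \<ge> 1" for k :: nat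
      using pow \<open>i \<in> {1..m}\<close> that by simp
  qed (use \<tau>[OF that] in auto)
  ultimately have "tame m P \<tau>" using \<tau> represents_inD[OF H(2)] by (auto simp: tame_def)
  then show thesis by (rule that)
qed

lemma tendsto_quotient_powr_bounds:
  fixes P :: "real \<Rightarrow> real"
  assumes "((\<lambda>t. P t / t powr c) \<longlongrightarrow> L) at_top" "L \<noteq> 0"
  shows "c < \<alpha> \<Longrightarrow> eventually (\<lambda>t. \<bar>P t\<bar> \<le> t powr \<alpha>) at_top"
    and "\<alpha> < c \<Longrightarrow> eventually (\<lambda>t. t powr \<alpha> \<le> \<bar>P t\<bar>) at_top"
proof -
  have lim: "((\<lambda>t. \<bar>P t / t powr c\<bar>) \<longlongrightarrow> \<bar>L\<bar>) at_top" by (intro tendsto_intros assms)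
  show "eventually (\<lambda>t. \<bar>P t\<bar> \<le> t powr \<alpha>) at_top" if "c < \<alpha>"
  proof -
    have "eventually (\<lambda>t. \<bar>P t / t powr c\<bar> < \<bar>L\<bar> + 1) at_top" using lim by (rule order_tendstoD) simp
    moreover have "eventually (\<lambda>t::real. t powr c \<le> 1 / (\<bar>L\<bar> + 1) * t powr \<alpha>) at_top"
      by (rule eventually_powr_dominates) (use that in auto)
    ultimately show ?thesis using eventually_gt_at_top[of 0]
    proof eventually_elim
      case (elim t)
      have "\<bar>P t\<bar> \<le> (\<bar>L\<bar> + 1) * t powr c" using elim by (simp add: abs_divide field_simps)
      also have "\<dots> \<le> t powr \<alpha>" using elim by (simp add: field_simps)
      finally show ?case .
    qed
  qed
  show "eventually (\<lambda>t. t powr \<alpha> \<le> \<bar>P t\<bar>) at_top" if "\<alpha> < c"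
  proof -
    have "eventually (\<lambda>t. \<bar>L\<bar> / 2 < \<bar>P t / t powr c\<bar>) at_top"
      using lim by (rule order_tendstoD) (use assms in simp)
    moreover have "eventually (\<lambda>t::real. t powr \<alpha> \<le> \<bar>L\<bar> / 2 * t powr c) at_top"
      by (rule eventually_powr_dominates) (use that assms in auto)
    ultimately show ?thesis using eventually_gt_at_top[of 0]
    proof eventually_elim
      case (elim t)
      have "\<bar>L\<bar> / 2 * t powr c \<le> \<bar>P t\<bar>" using elim by (simp add: abs_divide field_simps)
      then show ?case using elim by simp
    qed
  qed
qed

text \<open>Here the nonintegrality of \<open>c i\<close> decides, for each \<open>k\<close>, which
  of \<open>P i t / t ^ k\<close> and its reciprocal tends to 0.\<close>

lemma class_P'_tame:
  assumes "class_P' m P"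
  obtains \<tau> where "tame m P \<tau>"
proof -
  from assms obtain H where H: "hardy_field H" "\<And>i. i \<in> {1..m} \<Longrightarrow> represents_in (P i) H"
    by (auto simp: class_P'_def from_hardy_field_def)
  from assms have "\<exists>c::nat \<Rightarrow> real.
        (\<forall>i\<in>{1..m}. 0 < c i \<and> c i \<notin> \<int>) \<and> strict_mono_on {1..m} c \<and>
        (\<forall>i\<in>{1..m}. \<exists>L. L \<noteq> 0 \<and> ((\<lambda>t. P i t / t powr c i) \<longlongrightarrow> L) at_top)"
    unfolding class_P'_def by blast
  then obtain c where c: "\<And>i. i \<in> {1..m} \<Longrightarrow> 0 < c i \<and> c i \<notin> \<int>" "strict_mono_on {1..m} c"
    "\<And>i. i \<in> {1..m} \<Longrightarrow> \<exists>L. L \<noteq> 0 \<and> ((\<lambda>t. P i t / t powr c i) \<longlongrightarrow> L) at_top"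
    by blast
  have "slope ((deriv ^^ k) (P i)) (c i - real k)" if i: "i \<in> {1..m}" for i k
  proof (rule slope_funpow_deriv[OF H(1) H(2)[OF i]])
    obtain L where L: "L \<noteq> 0" "((\<lambda>t. P i t / t powr c i) \<longlongrightarrow> L) at_top" using c(3)[OF i] by blast
    note bounds = tendsto_quotient_powr_bounds[OF L(2,1)]
    have nconst: "\<not> eventually (\<lambda>t. P i t = x) at_top" for x
    proof
      assume "eventually (\<lambda>t. P i t = x) at_top"
      moreover have "eventually (\<lambda>t. \<bar>x\<bar> \<le> t powr (c i / 3)) at_top"
        by (rule eventually_abs_const_le_powr) (use c(1)[OF i] in auto)
      ultimately have "eventually (\<lambda>t. \<bar>P i t\<bar> \<le> t powr (c i / 3)) at_top"
        by eventually_elim auto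
      moreover have "eventually (\<lambda>t. t powr (c i / 2) \<le> \<bar>P i t\<bar>) at_top"
        using bounds(2) c(1)[OF i] by simp
      ultimately show False using powr_not_eventually_le[of "c i / 3" "c i / 2"] c(1)[OF i] by auto
    qed
    have nz: "\<not> eventually (\<lambda>t. deriv (P i) t = 0) at_top"
      using eventually_const_of_deriv_0[OF represents_inD[OF H(2)[OF i]]] nconst by metis
    show "slope (P i) (c i)"
    proof (rule slopeI_of_bounds[OF H(1) H(2)[OF i] nconst nz bounds(1)])
      fix \<alpha> assume "\<alpha> < c i"
      then show "\<not> eventually (\<lambda>t. \<bar>P i t\<bar> \<le> t powr \<alpha>) at_top"
        using powr_not_eventually_le[of \<alpha> "(\<alpha> + c i) / 2"] bounds(2)[of "(\<alpha> + c i) / 2"] by auto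
    qed auto
    show "0 < c i" using c i by auto
    fix k :: nat
    have "c i \<noteq> real k" using c(1)[OF i] by (metis Ints_of_nat)
    then consider "c i < real k" | "real k < c i" by linarith
    then show "((\<lambda>t. P i t / t ^ k) \<longlongrightarrow> 0) at_top \<or> ((\<lambda>t. t ^ k / P i t) \<longlongrightarrow> 0) at_top"
    proof cases
      case 1
      define \<alpha> where "\<alpha> = (c i + real k) / 2"
      have \<alpha>: "c i < \<alpha>" "\<alpha> - real k < 0" using 1 by (auto simp: \<alpha>_def)
      have "((\<lambda>t. P i t / t ^ k) \<longlongrightarrow> 0) at_top"
      proof (rule Lim_null_comparison)
        show "eventually (\<lambda>t. norm (P i t / t ^ k) \<le> t powr (\<alpha> - real k)) at_top"
          using bounds(1)[OF \<alpha>(1)] eventually_gt_at_top[of 0]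
          by eventually_elim (auto simp: powr_diff powr_realpow abs_divide divide_right_mono)
        show "((\<lambda>t::real. t powr (\<alpha> - real k)) \<longlongrightarrow> 0) at_top"
          by (rule tendsto_neg_powr[OF \<alpha>(2) filterlim_ident])
      qed
      then show ?thesis ..
    next
      case 2
      define \<alpha> where "\<alpha> = (c i + real k) / 2"
      have \<alpha>: "\<alpha> < c i" "real k - \<alpha> < 0" using 2 by (auto simp: \<alpha>_def)
      have "((\<lambda>t. t ^ k / P i t) \<longlongrightarrow> 0) at_top"
      proof (rule Lim_null_comparison)
        show "eventually (\<lambda>t. norm (t ^ k / P i t) \<le> t powr (real k - \<alpha>)) at_top"
          using bounds(2)[OF \<alpha>(1)] eventually_gt_at_top[of 0]
        proof eventually_elim
          case (elim t)
          have "t ^ k / \<bar>P i t\<bar> \<le> t ^ k / t powr \<alpha>" using elim by (intro divide_left_mono) (auto intro!: mult_pos_pos less_le_trans[OF _ elim(1)])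
          then show ?case using elim by (simp add: powr_diff powr_realpow abs_divide)
        qed
        show "((\<lambda>t::real. t powr (real k - \<alpha>)) \<longlongrightarrow> 0) at_top"
          by (rule tendsto_neg_powr[OF \<alpha>(2) filterlim_ident])
      qed
      then show ?thesis ..
    qed
  qed
  moreover have "inj_on c {1..m}" using c(2) by (rule strict_mono_on_imp_inj_on)
  ultimately have "tame m P c" using c represents_inD[OF H(2)] by (auto simp: tame_def)
  then show thesis by (rule that)
qed

section \<open>Weyl sums of smooth phases\<close>

lemma norm_e [simp]: "cmod (e x) = 1"
  using norm_exp_i_times[of "2 * pi * x"] by (simp add: e_def mult_ac)

lemma e_add: "e (x + y) = e x * e y"
  by (simp add: e_def exp_add[symmetric] algebra_simps)

lemma e_0 [simp]: "e 0 = 1"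
  by (simp add: e_def)

lemma e_minus: "e (- x) = cnj (e x)"
  by (simp add: e_def exp_cnj)

lemma e_of_int [simp]: "e (of_int n) = 1"
  using exp_integer_2pi[of "of_int n"] by (simp add: e_def mult_ac)

lemma e_diff: "e (x - y) = e x * cnj (e y)"
  using e_add[of x "- y"] by (simp add: e_minus)

lemma e_power: "e (real n * x) = e x ^ n"
  by (induction n) (simp_all add: e_add algebra_simps)

lemma e_sum: "finite A \<Longrightarrow> e (\<Sum>i\<in>A. f i) = (\<Prod>i\<in>A. e (f i))"
  by (induction A rule: finite_induct) (simp_all add: e_add)

lemma norm_e_minus_one: "cmod (e x - 1) = 2 * \<bar>sin (pi * x)\<bar>"
  using dist_exp_i_1[of "2 * pi * x"] by (simp add: e_def mult_ac)

lemma norm_e_diff: "cmod (e x - e y) = cmod (e (x - y) - 1)"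
proof -
  have "e x - e y = (e (x - y) - 1) * e y"
    using e_add[of "x - y" y] by (simp add: algebra_simps)
  then show ?thesis by (simp add: norm_mult)
qed

lemma e_Lipschitz: "cmod (e x - e y) \<le> 2 * pi * \<bar>x - y\<bar>"
  unfolding norm_e_diff norm_e_minus_one
  using abs_sin_x_le_abs_x[of "pi * (x - y)"] by (simp add: abs_mult)

text \<open>A weak form of Jordan's inequality: up to pi/3 the cosine is at least 1/2, and beyond it
  the sine is at least sqrt 3 / 2, more than pi/4.\<close>

lemma sin_ge_half:
  assumes "0 \<le> x" "x \<le> pi / 2"
  shows "x / 2 \<le> sin x"
proof (cases "x \<le> pi / 3")
  case True
  show ?thesis
  proof (cases "x = 0")
    case False
    then have "0 < x" using assms by simp
    from MVT2[OF this, of sin cos] obtain z where z: "0 < z" "z < x" "sin x - sin 0 = (x - 0) * cos z"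
      by (auto intro: DERIV_sin)
    have "cos z \<ge> cos (pi / 3)" by (rule cos_monotone_0_pi_le) (use z True in auto)
    then have "x * cos z \<ge> x * (1/2)" using \<open>0 < x\<close> by (intro mult_left_mono) (auto simp: cos_60)
    then show ?thesis using z by simp
  qed simp
next
  case False
  have "sin (pi/3) \<le> sin x" by (rule sin_monotone_2pi_le) (use False assms in auto)
  moreover have "sin (pi/3) = sqrt 3 / 2" by (rule sin_60)
  moreover have "sqrt 3 \<ge> 1.7" by (rule real_le_rsqrt) (simp add: power2_eq_square)
  moreover have "x < 1.61" using assms(2) pi_less_4 pi_approx by simp
  ultimately show ?thesis by simp
qed

lemma norm_e_minus_one_ge:
  assumes "\<bar>x\<bar> \<le> 1/2"
  shows "2 * \<bar>x\<bar> \<le> cmod (e x - 1)"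
proof -
  have "pi * \<bar>x\<bar> / 2 \<le> sin (pi * \<bar>x\<bar>)"
    by (rule sin_ge_half) (use assms in \<open>auto simp: mult_left_le\<close>)
  moreover have "\<bar>sin (pi * x)\<bar> = \<bar>sin (pi * \<bar>x\<bar>)\<bar>" by (cases "x \<ge> 0") auto
  moreover have "pi * \<bar>x\<bar> \<ge> 2 * \<bar>x\<bar>" using pi_ge_two by (intro mult_right_mono) auto
  ultimately show ?thesis unfolding norm_e_minus_one by linarith
qed

lemma norm_geometric_e_le:
  assumes "x \<noteq> 0" "\<bar>x\<bar> \<le> 1/2"
  shows "cmod (\<Sum>n<L. e (b + real n * x)) \<le> 1 / \<bar>x\<bar>"
proof -
  have ne: "e x \<noteq> 1" using norm_e_minus_one_ge[OF assms(2)] assms(1) by auto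
  have "(\<Sum>n<L. e (b + real n * x)) = e b * (\<Sum>n<L. e x ^ n)"
    by (simp add: e_add e_power sum_distrib_left)
  also have "\<dots> = e b * ((e x ^ L - 1) / (e x - 1))" using ne by (simp add: geometric_sum)
  finally have "cmod (\<Sum>n<L. e (b + real n * x)) = cmod (e x ^ L - 1) / cmod (e x - 1)"
    by (simp add: norm_mult norm_divide)
  also have "\<dots> \<le> 2 / (2 * \<bar>x\<bar>)"
  proof (rule frac_le)
    show "cmod (e x ^ L - 1) \<le> 2" using norm_triangle_ineq4[of "e x ^ L" 1] by (simp add: norm_power)
  qed (use assms norm_e_minus_one_ge in auto)
  finally show ?thesis by simp
qed

section \<open>Weyl differencing\<close>

lemma norm_sum_e_le: "cmod (\<Sum>n\<in>A. e (f n)) \<le> real (card A)"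
  using norm_sum[of "\<lambda>n. e (f n)" A] by simp

text \<open>The pairs of indices at distance \<open>h\<close> contribute two conjugate sums, the
  diagonal contributes \<open>L\<close>. The induction adds the pairs that contain the last
  index.\<close>

lemma weyl_identity:
  "(cmod (\<Sum>n<L. e (f n)))\<^sup>2 =
     real L + 2 * Re (\<Sum>h\<in>{1..<L}. \<Sum>n<L - h. e (f (n + h) - f n))"
proof (induction L)
  case 0 then show ?case by simp
next
  case (Suc L)
  have "(\<Sum>h\<in>{1..<Suc L}. \<Sum>n<Suc L - h. e (f (n + h) - f n)) =
        (\<Sum>h\<in>{1..<Suc L}. (\<Sum>n<L - h. e (f (n + h) - f n)) + e (f L - f (L - h)))"
    by (intro sum.cong) (auto simp: Suc_diff_le)
  also have "\<dots> = (\<Sum>h\<in>{1..<Suc L}. \<Sum>n<L - h. e (f (n + h) - f n)) + (\<Sum>h\<in>{1..<Suc L}. e (f L - f (L - h)))"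
    by (rule sum.distrib)
  also have "(\<Sum>h\<in>{1..<Suc L}. \<Sum>n<L - h. e (f (n + h) - f n)) = (\<Sum>h\<in>{1..<L}. \<Sum>n<L - h. e (f (n + h) - f n))"
    by (rule sum.mono_neutral_right) auto
  also have "(\<Sum>h\<in>{1..<Suc L}. e (f L - f (L - h))) = (\<Sum>n<L. e (f L - f n))"
    by (rule sum.reindex_bij_witness[of _ "\<lambda>n. L - n" "\<lambda>h. L - h"]) auto
  also have "\<dots> = e (f L) * cnj (\<Sum>n<L. e (f n))"
    by (simp add: e_diff sum_distrib_left)
  finally have 1: "(\<Sum>h\<in>{1..<Suc L}. \<Sum>n<Suc L - h. e (f (n + h) - f n)) =
    (\<Sum>h\<in>{1..<L}. \<Sum>n<L - h. e (f (n + h) - f n)) + e (f L) * cnj (\<Sum>n<L. e (f n))" .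
  have "(cmod (\<Sum>n<Suc L. e (f n)))\<^sup>2 = (cmod (\<Sum>n<L. e (f n)))\<^sup>2 + 1 + 2 * Re (e (f L) * cnj (\<Sum>n<L. e (f n)))"
  proof -
    have sq: "(cmod (z + w))\<^sup>2 = (cmod z)\<^sup>2 + (cmod w)\<^sup>2 + 2 * Re (w * cnj z)" for z w :: complex
      by (simp add: cmod_power2) (simp add: power2_eq_square algebra_simps)
    show ?thesis unfolding sum.lessThan_Suc sq by simp
  qed
  then show ?case unfolding 1 Suc plus_complex.sel by simp
qed

lemma weyl_squaring:
  "(cmod (\<Sum>n<L. e (f n)))\<^sup>2 \<le> real L + 2 * (\<Sum>h\<in>{1..<L}. cmod (\<Sum>n<L - h. e (f (n + h) - f n)))"
proof -
  note weyl_identity[of f L]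
  also have "Re (\<Sum>h\<in>{1..<L}. \<Sum>n<L - h. e (f (n + h) - f n)) \<le> cmod (\<Sum>h\<in>{1..<L}. \<Sum>n<L - h. e (f (n + h) - f n))"
    by (rule complex_Re_le_cmod)
  also have "\<dots> \<le> (\<Sum>h\<in>{1..<L}. cmod (\<Sum>n<L - h. e (f (n + h) - f n)))"
    by (rule norm_sum)
  finally show ?thesis by simp
qed

text \<open>Each summand is at most twice the increment of the square root.\<close>

lemma sum_inverse_sqrt_le: "(\<Sum>h=1..L. 1 / sqrt (real h)) \<le> 2 * sqrt (real L)"
proof (induction L)
  case (Suc L)
  define a b where "a = sqrt (real L)" and "b = sqrt (real (Suc L))"
  have ab: "0 \<le> a" "a \<le> b" "0 < b" "b * b = a * a + 1" by (simp_all add: a_def b_def)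
  have "1 \<le> 2 * (b - a) * b"
    using ab sum_squares_ge_zero[of "b - a" 0] by (simp add: algebra_simps)
  then have "1 / b \<le> 2 * (b - a)" using ab by (simp add: field_simps)
  then show ?case using Suc by (simp add: a_def b_def)
qed simp

text \<open>Comparison with the linear phase of slope \<gamma>, whose sum is geometric. The
  exponents 1/2 are weaker than what this gives, but they have the form \<open>1 / 2 ^ Suc k\<close>
  that survives the differencing. The constant 7 exceeds 2 pi.\<close>

lemma weyl_smooth_base:
  fixes D :: "nat \<Rightarrow> real \<Rightarrow> real"
  assumes D: "\<And>t. t \<in> {a..a + real L'} \<Longrightarrow> (D 0 has_real_derivative D 1 t) (at t)"
    and near: "\<And>t. t \<in> {a..a + real L'} \<Longrightarrow> \<bar>D 1 t - \<gamma>\<bar> \<le> \<rho>"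
    and g: "\<gamma> \<noteq> 0" "\<bar>\<gamma>\<bar> \<le> 1/2" and L: "1 \<le> L" "L' \<le> L"
  shows "cmod (\<Sum>n<L'. e (D 0 (a + real n))) \<le>
    7 * real L * ((real L * \<bar>\<gamma>\<bar>) powr (-(1/2)) + (real L * \<rho>) powr (1/2))"
proof -
  define S where "S = (\<Sum>n<L'. e (D 0 (a + real n)))"
  define G where "G = (\<Sum>n<L'. e (D 0 a + real n * \<gamma>))"
  define U where "U = real L * \<bar>\<gamma>\<bar>"
  define V where "V = real L * \<rho>"
  have "\<rho> \<ge> 0" using near[of a] by force
  then have V0: "V \<ge> 0" by (simp add: V_def)
  have U0: "U > 0" using g L by (simp add: U_def)
  have triv: "cmod S \<le> real L" "cmod G \<le> real L"
    using norm_sum_e_le[of "\<lambda>n. D 0 (a + real n)" "{..<L'}"]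
      norm_sum_e_le[of "\<lambda>n. D 0 a + real n * \<gamma>" "{..<L'}"] L
    by (simp_all add: S_def G_def)
  have pt: "\<bar>D 0 (a + real n) - (D 0 a + real n * \<gamma>)\<bar> \<le> V" if "n < L'" for n
  proof (cases "n = 0")
    case False
    then have "a < a + real n" by simp
    from MVT2[OF this, of "D 0" "D 1"] D that obtain z where
      z: "a < z" "z < a + real n" "D 0 (a + real n) - D 0 a = real n * D 1 z" by force
    have "D 0 (a + real n) - (D 0 a + real n * \<gamma>) = real n * (D 1 z - \<gamma>)"
      using z(3) by (simp add: algebra_simps)
    then have "\<bar>D 0 (a + real n) - (D 0 a + real n * \<gamma>)\<bar> = real n * \<bar>D 1 z - \<gamma>\<bar>"
      by (simp add: abs_mult)
    also have "\<dots> \<le> real L * \<rho>"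
      by (rule mult_mono) (use near[of z] z that L in auto)
    finally show ?thesis by (simp add: V_def)
  qed (use V0 in auto)
  have "cmod (S - G) \<le> (\<Sum>n<L'. cmod (e (D 0 (a + real n)) - e (D 0 a + real n * \<gamma>)))"
    unfolding S_def G_def sum_subtractf[symmetric] by (rule norm_sum)
  also have "\<dots> \<le> (\<Sum>n<L'. 2 * pi * V)"
    by (intro sum_mono order_trans[OF e_Lipschitz] mult_left_mono pt) auto
  also have "\<dots> \<le> real L * (2 * pi * V)" using L V0 by (simp add: mult_right_mono)
  finally have SG: "cmod (S - G) \<le> real L * (2 * pi * V)" .
  have Gle: "cmod G \<le> real L * U powr (-(1/2))"
  proof (cases "U \<le> 1")
    case True
    then have "U powr 0 \<le> U powr (-(1/2))" using U0 by (intro powr_mono') auto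
    then have "real L * 1 \<le> real L * U powr (-(1/2))" using U0 by (intro mult_left_mono) auto
    then show ?thesis using triv by simp
  next
    case False
    have "cmod G \<le> 1 / \<bar>\<gamma>\<bar>" unfolding G_def by (rule norm_geometric_e_le) (use g in auto)
    also have "\<dots> = real L * U powr (-1)" using U0 L by (simp add: U_def powr_minus divide_simps)
    also have "\<dots> \<le> real L * U powr (-(1/2))" using False by (intro mult_left_mono powr_mono) auto
    finally show ?thesis .
  qed
  have "cmod S \<le> 7 * real L * (U powr (-(1/2)) + V powr (1/2))"
  proof (cases "V \<ge> 1")
    case True
    have "1 \<le> 7 * (x + y)" if "0 \<le> x" "1 \<le> y" for x y :: real using that by simp
    from this[of "U powr (-(1/2))" "V powr (1/2)"] True
    have "1 \<le> 7 * (U powr (-(1/2)) + V powr (1/2))" by (simp add: ge_one_powr_ge_zero)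
    then have "real L * 1 \<le> real L * (7 * (U powr (-(1/2)) + V powr (1/2)))"
      by (intro mult_left_mono) auto
    then show ?thesis using order_trans[OF triv(1)] by (simp add: mult_ac)
  next
    case False
    have "V powr 1 \<le> V powr (1/2)" using V0 False by (intro powr_mono') auto
    then have "2 * pi * V \<le> 7 * V powr (1/2)"
      using V0 pi_approx by (intro mult_mono) auto
    then have "real L * (2 * pi * V) \<le> real L * (7 * V powr (1/2))" by (intro mult_left_mono) auto
    moreover have "cmod S \<le> cmod (S - G) + cmod G" by (metis diff_add_cancel norm_triangle_ineq)
    moreover have "real L * U powr (-(1/2)) \<ge> 0" by simp
    ultimately have "cmod S \<le> real L * (7 * V powr (1/2)) + 7 * (real L * U powr (-(1/2)))" using SG Gle by linarith
    then show ?thesis by (simp add: algebra_simps)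
  qed
  then show ?thesis by (simp add: S_def U_def V_def)
qed

text \<open>The scale \<open>L\<close> is kept apart from the number \<open>L'\<close> of terms, so that in the induction the shorter
  differenced sums are estimated at the same scale.\<close>

lemma weyl_smooth:
  "\<exists>C\<ge>1. \<forall>D a L L' \<gamma> \<rho>.
     (\<forall>j\<le>k. \<forall>t\<in>{a..a + real L'}. (D j has_real_derivative D (Suc j) t) (at t)) \<longrightarrow>
     (\<forall>t\<in>{a..a + real L'}. \<bar>D (Suc k) t - \<gamma>\<bar> \<le> \<rho>) \<longrightarrow>
     \<gamma> \<noteq> 0 \<longrightarrow> \<bar>\<gamma>\<bar> * real L ^ k \<le> 1/2 \<longrightarrow> 1 \<le> L \<longrightarrow> L' \<le> L \<longrightarrow>
     cmod (\<Sum>n<L'. e (D 0 (a + real n))) \<le>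
       C * real L * ((real L ^ Suc k * \<bar>\<gamma>\<bar>) powr (-(1 / 2 ^ Suc k)) + (real L ^ Suc k * \<rho>) powr (1 / 2 ^ Suc k))"
proof (induction k)
  case 0
  show ?case
    by (rule exI[of _ 7]) (auto intro!: weyl_smooth_base[simplified] simp: One_nat_def)
next
  case (Suc k)
  then obtain C where C: "C \<ge> 1" and IH: "\<And>D a L L' \<gamma> \<rho>.
     (\<forall>j\<le>k. \<forall>t\<in>{a..a + real L'}. (D j has_real_derivative D (Suc j) t) (at t)) \<Longrightarrow>
     (\<forall>t\<in>{a..a + real L'}. \<bar>D (Suc k) t - \<gamma>\<bar> \<le> \<rho>) \<Longrightarrow>
     \<gamma> \<noteq> 0 \<Longrightarrow> \<bar>\<gamma>\<bar> * real L ^ k \<le> 1/2 \<Longrightarrow> 1 \<le> L \<Longrightarrow> L' \<le> L \<Longrightarrow>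
     cmod (\<Sum>n<L'. e (D 0 (a + real n))) \<le>
       C * real L * ((real L ^ Suc k * \<bar>\<gamma>\<bar>) powr (-(1 / 2 ^ Suc k)) + (real L ^ Suc k * \<rho>) powr (1 / 2 ^ Suc k))"
    by blast
  show ?case
  proof (intro exI[of _ "5 * C"] conjI allI impI)
    show "5 * C \<ge> 1" using C by simp
    fix D :: "nat \<Rightarrow> real \<Rightarrow> real" and a \<gamma> \<rho> :: real and L L' :: nat
    assume D: "\<forall>j\<le>Suc k. \<forall>t\<in>{a..a + real L'}. (D j has_real_derivative D (Suc j) t) (at t)"
      and near: "\<forall>t\<in>{a..a + real L'}. \<bar>D (Suc (Suc k)) t - \<gamma>\<bar> \<le> \<rho>"
      and g: "\<gamma> \<noteq> 0" "\<bar>\<gamma>\<bar> * real L ^ Suc k \<le> 1/2" and L: "1 \<le> L" "L' \<le> L"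
    define c :: real where "c = 1 / 2 ^ Suc k"
    define U where "U = real L ^ Suc (Suc k) * \<bar>\<gamma>\<bar>"
    define V where "V = real L ^ Suc (Suc k) * \<rho>"
    define S where "S = cmod (\<Sum>n<L'. e (D 0 (a + real n)))"
    have c: "0 < c" "c \<le> 1/2"
      by (auto simp: c_def field_simps)
    have rho: "\<rho> \<ge> 0" using near by force
    then have V0: "V \<ge> 0" by (simp add: V_def)
    have U0: "U > 0" using g L by (simp add: U_def)
    have UL: "U \<le> real L"
      using mult_left_mono[OF g(2), of "real L"] L by (simp add: U_def mult_ac)
    have inner: "cmod (\<Sum>n<L' - h. e (D 0 (a + real (n + h)) - D 0 (a + real n)))
        \<le> C * real L * (U powr (-c) * sqrt (real L) * (1 / sqrt (real h)) + V powr c)"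
      if h: "h \<in> {1..<L'}" for h
    proof -
      \<comment> \<open>Differencing by \<open>h\<close> lowers the order by one and multiplies
        \<gamma> and \<rho> by \<open>h\<close>. As \<open>h \<le> L\<close>, this factor is paid
        for by one power of \<open>L\<close> in the smallness condition.\<close>
      define E where "E = (\<lambda>j t. D j (t + real h) - D j t)"
      have "cmod (\<Sum>n<L' - h. e (E 0 (a + real n))) \<le>
        C * real L * ((real L ^ Suc k * \<bar>real h * \<gamma>\<bar>) powr (-(1 / 2 ^ Suc k)) +
          (real L ^ Suc k * (real h * \<rho>)) powr (1 / 2 ^ Suc k))"
      proof (rule IH; (intro allI impI ballI)?)
        fix j t assume j: "j \<le> k" and t: "t \<in> {a..a + real (L' - h)}"
        then have 1: "t \<in> {a..a + real L'}" "t + real h \<in> {a..a + real L'}" using h by auto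
        have "((\<lambda>t. D j (t + real h)) has_real_derivative D (Suc j) (t + real h)) (at t)"
          using D j 1 by (intro DERIV_shift[THEN iffD1]) auto
        then show "(E j has_real_derivative E (Suc j) t) (at t)"
          unfolding E_def using D j 1 by (intro DERIV_diff) auto
      next
        fix t assume t: "t \<in> {a..a + real (L' - h)}"
        then have 1: "t \<ge> a" "t + real h \<le> a + real L'" using h by auto
        have "t < t + real h" using h by simp
        from MVT2[OF this, of "D (Suc k)" "D (Suc (Suc k))"] D 1 obtain z where
          z: "t < z" "z < t + real h" "E (Suc k) t = real h * D (Suc (Suc k)) z"
          unfolding E_def by (auto simp del: of_nat_Suc)
        have "E (Suc k) t - real h * \<gamma> = real h * (D (Suc (Suc k)) z - \<gamma>)"
          using z(3) by (simp add: algebra_simps)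
        then have "\<bar>E (Suc k) t - real h * \<gamma>\<bar> = real h * \<bar>D (Suc (Suc k)) z - \<gamma>\<bar>"
          by (simp add: abs_mult)
        also have "\<dots> \<le> real h * \<rho>" using near z 1 by (intro mult_left_mono) auto
        finally show "\<bar>E (Suc k) t - real h * \<gamma>\<bar> \<le> real h * \<rho>" .
      next
        show "real h * \<gamma> \<noteq> 0" using h g by auto
        have "\<bar>real h * \<gamma>\<bar> * real L ^ k = \<bar>\<gamma>\<bar> * (real h * real L ^ k)" by (simp add: abs_mult)
        also have "\<dots> \<le> \<bar>\<gamma>\<bar> * real L ^ Suc k"
          using h L by (intro mult_left_mono) (auto intro: mult_right_mono)
        finally show "\<bar>real h * \<gamma>\<bar> * real L ^ k \<le> 1/2" using g by simp
      qed (use L in auto)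
      moreover have "(real L ^ Suc k * \<bar>real h * \<gamma>\<bar>) powr (-c) \<le> U powr (-c) * sqrt (real L) * (1 / sqrt (real h))"
      proof -
        have h0: "0 < real h" "real h \<le> real L" using h L by auto
        have "real L ^ Suc k * \<bar>real h * \<gamma>\<bar> = U * (real h / real L)"
          using L by (simp add: U_def abs_mult)
        then have "(real L ^ Suc k * \<bar>real h * \<gamma>\<bar>) powr (-c) = U powr (-c) * (real h / real L) powr (-c)"
          using U0 by (simp add: powr_mult del: times_divide_eq_right)
        \<comment> \<open>Raising the exponent from c to 1/2 is allowed as \<open>h \<le> L\<close>,
          and makes the sum over \<open>h\<close> the same at every order.\<close>
        also have "\<dots> \<le> U powr (-c) * (real h / real L) powr (-(1/2))"
          using h0 c by (intro mult_left_mono powr_mono') auto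
        also have "(real h / real L) powr (-(1/2)) = sqrt (real L) * (1 / sqrt (real h))"
          using h0 by (simp add: powr_minus powr_half_sqrt real_sqrt_divide)
        finally show ?thesis by (simp only: mult.assoc)
      qed
      moreover have "(real L ^ Suc k * (real h * \<rho>)) powr c \<le> V powr c"
      proof (rule powr_mono2)
        have "real L ^ Suc k * (real h * \<rho>) = real L ^ Suc k * real h * \<rho>" by simp
        also have "\<dots> \<le> real L ^ Suc k * real L * \<rho>" using h L rho by (intro mult_right_mono mult_left_mono) auto
        finally show "real L ^ Suc k * (real h * \<rho>) \<le> V" by (simp add: V_def mult_ac)
      qed (use c rho in auto)
      ultimately have "cmod (\<Sum>n<L' - h. e (E 0 (a + real n)))
        \<le> C * real L * (U powr (-c) * sqrt (real L) * (1 / sqrt (real h)) + V powr c)"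
        unfolding c_def[symmetric] using C
        by (elim order_trans) (intro mult_left_mono add_mono, auto)
      then show ?thesis by (simp add: E_def algebra_simps)
    qed
    \<comment> \<open>The diagonal term is absorbed in the main term because
      \<open>U \<le> L\<close>.\<close>
    have LU: "real L \<le> (real L)\<^sup>2 * U powr (-c)"
    proof -
      have "real L powr (-1) \<le> real L powr (-c)" using L c by (intro powr_mono) auto
      also have "\<dots> \<le> U powr (-c)" using UL U0 c by (intro powr_mono2') auto
      finally have "(real L)\<^sup>2 * real L powr (-1) \<le> (real L)\<^sup>2 * U powr (-c)" by (intro mult_left_mono) auto
      then show ?thesis using L by (simp add: powr_minus power2_eq_square)
    qed
    have "S\<^sup>2 \<le> real L' + 2 * (\<Sum>h\<in>{1..<L'}. cmod (\<Sum>n<L' - h. e (D 0 (a + real (n + h)) - D 0 (a + real n))))"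
      unfolding S_def using weyl_squaring[of "\<lambda>n. D 0 (a + real n)" L'] by simp
    also have "\<dots> \<le> real L + 2 * (\<Sum>h\<in>{1..<L'}. C * real L * (U powr (-c) * sqrt (real L) * (1 / sqrt (real h)) + V powr c))"
      using inner L by (intro add_mono mult_left_mono sum_mono) auto
    also have "\<dots> \<le> real L + 2 * (\<Sum>h=1..L. C * real L * (U powr (-c) * sqrt (real L) * (1 / sqrt (real h)) + V powr c))"
      using L C by (intro add_mono mult_left_mono sum_mono2) auto
    also have "\<dots> = real L + 2 * C * real L * (U powr (-c) * sqrt (real L) * (\<Sum>h=1..L. 1 / sqrt (real h)) + real L * V powr c)"
      by (simp add: sum_distrib_left sum.distrib algebra_simps)
    also have "\<dots> \<le> real L + 2 * C * real L * (U powr (-c) * sqrt (real L) * (2 * sqrt (real L)) + real L * V powr c)"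
      using sum_inverse_sqrt_le[of L] C by (intro add_mono mult_left_mono) auto
    also have "\<dots> = real L + (real L)\<^sup>2 * (4 * C * U powr (-c) + 2 * C * V powr c)"
      by (simp add: power2_eq_square algebra_simps)
    also have "\<dots> \<le> (real L)\<^sup>2 * U powr (-c) + (real L)\<^sup>2 * (4 * C * U powr (-c) + 2 * C * V powr c)"
      using LU by simp
    also have "\<dots> \<le> (real L)\<^sup>2 * (5 * C * (U powr (-c) + V powr c))"
    proof -
      have "U powr (-c) \<le> C * U powr (-c)" "0 \<le> C * V powr c"
        using C mult_right_mono[of 1 C "U powr (-c)"] by auto
      then have "U powr (-c) + (4 * C * U powr (-c) + 2 * C * V powr c) \<le> 5 * C * (U powr (-c) + V powr c)"
        by (simp add: algebra_simps)
      from mult_left_mono[OF this, of "(real L)\<^sup>2"] show ?thesis by (simp add: algebra_simps)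
    qed
    \<comment> \<open>Taking the root halves the exponents, by u + v <= (sqrt u + sqrt v)^2.\<close>
    also have "\<dots> \<le> (5 * C * real L * (U powr (-(c/2)) + V powr (c/2)))\<^sup>2"
    proof -
      have "U powr (-c) + V powr c \<le> (U powr (-(c/2)) + V powr (c/2))\<^sup>2"
      proof -
        have "(U powr (-(c/2)))\<^sup>2 = U powr (-c)" "(V powr (c/2))\<^sup>2 = V powr c"
          by (simp_all add: power2_eq_square powr_add[symmetric])
        then show ?thesis by (simp add: power2_sum)
      qed
      moreover have "5 * C \<le> (5 * C)\<^sup>2" using C by (simp add: power2_eq_square)
      ultimately have "5 * C * (U powr (-c) + V powr c) \<le> (5 * C)\<^sup>2 * (U powr (-(c/2)) + V powr (c/2))\<^sup>2"
        using C by (intro mult_mono) auto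
      then have "(real L)\<^sup>2 * (5 * C * (U powr (-c) + V powr c)) \<le> (real L)\<^sup>2 * ((5 * C)\<^sup>2 * (U powr (-(c/2)) + V powr (c/2))\<^sup>2)"
        by (intro mult_left_mono) auto
      then show ?thesis by (simp only: power_mult_distrib mult_ac)
    qed
    finally have "S\<^sup>2 \<le> (5 * C * real L * (U powr (-(c/2)) + V powr (c/2)))\<^sup>2" .
    then have "S \<le> 5 * C * real L * (U powr (-(c/2)) + V powr (c/2))"
      by (rule power2_le_imp_le) (use C in auto)
    moreover have "c / 2 = 1 / 2 ^ Suc (Suc k)" by (simp add: c_def)
    ultimately show "cmod (\<Sum>n<L'. e (D 0 (a + real n))) \<le>
       5 * C * real L * ((real L ^ Suc (Suc k) * \<bar>\<gamma>\<bar>) powr (-(1 / 2 ^ Suc (Suc k))) + (real L ^ Suc (Suc k) * \<rho>) powr (1 / 2 ^ Suc (Suc k)))"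
      unfolding S_def U_def V_def by simp
  qed
qed

section \<open>Long sums cut into blocks\<close>

lemma block_sum_le:
  fixes z :: "nat \<Rightarrow> complex"
  assumes "\<And>a L'. n0 \<le> a \<Longrightarrow> L' \<le> L \<Longrightarrow> a + L' \<le> N \<Longrightarrow> cmod (\<Sum>n<L'. z (a + n)) \<le> \<beta>"
    and "1 \<le> L" "0 \<le> \<beta>"
  shows "cmod (\<Sum>n\<in>{n0..<N}. z n) \<le> \<beta> * (real (N - n0) / real L + 1)"
  using assms(1)
proof (induction "N - n0" arbitrary: n0 rule: less_induct)
  case less
  have shift: "(\<Sum>n\<in>{a..<a + l}. z n) = (\<Sum>n<l. z (a + n))" for a l
    using sum.shift_bounds_nat_ivl[of z 0 a l] by (simp add: atLeast0LessThan add_ac)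
  show ?case
  proof (cases "N - n0 \<le> L")
    case True
    show ?thesis
    proof (cases "n0 \<le> N")
      case le: True
      have "cmod (\<Sum>n\<in>{n0..<N}. z n) \<le> \<beta>"
        using shift[of n0 "N - n0"] less.prems[of n0 "N - n0"] True le by simp
      also have "\<dots> \<le> \<beta> * (real (N - n0) / real L + 1)"
        using assms by (simp add: algebra_simps)
      finally show ?thesis .
    qed (use assms in auto)
  next
    case False
    have "(\<Sum>n\<in>{n0..<N}. z n) = (\<Sum>n\<in>{n0..<n0 + L}. z n) + (\<Sum>n\<in>{n0 + L..<N}. z n)"
      using False by (subst sum.atLeastLessThan_concat) auto
    also have "cmod \<dots> \<le> cmod (\<Sum>n<L. z (n0 + n)) + cmod (\<Sum>n\<in>{n0 + L..<N}. z n)"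
      unfolding shift by (rule norm_triangle_ineq)
    also have "\<dots> \<le> \<beta> + \<beta> * (real (N - (n0 + L)) / real L + 1)"
      using False assms(2) by (intro add_mono less.prems less.hyps) auto
    also have "\<dots> = \<beta> * (real (N - n0) / real L + 1)"
      using False assms(2) by (simp add: of_nat_diff field_simps)
    finally show ?thesis .
  qed
qed

text \<open>\<open>X\<close> is the size of the phase as seen by its k-th derivative, \<sigma> a
  tolerance for the constants. On blocks of length about \<open>N * X powr (-b)\<close> the k-th
  derivative varies little, while its size times the k-th power of the length is still a positive
  power of \<open>X\<close>; so \<open>weyl_smooth\<close> gains on each block.\<close>

lemma smooth_sum_bound:
  assumes "k \<ge> 1"
  obtains c \<kappa> C where "0 < c" "0 < \<kappa>" "C \<ge> 1" and
    "\<And>D N N0 X \<sigma>.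
      (\<And>j t. j \<le> k \<Longrightarrow> t \<in> {real N0..real N} \<Longrightarrow> (D j has_real_derivative D (Suc j) t) (at t)) \<Longrightarrow>
      (\<And>t. t \<in> {real N0..real N} \<Longrightarrow> \<sigma> * X / real N ^ k \<le> \<bar>D k t\<bar> \<and> \<bar>D k t\<bar> \<le> X / (\<sigma> * real N ^ k) \<and>
           \<bar>D (Suc k) t\<bar> \<le> X / (\<sigma> * real N ^ Suc k)) \<Longrightarrow>
      1 \<le> N \<Longrightarrow> 1 \<le> X \<Longrightarrow> X \<le> real N powr (real k - 1/4) \<Longrightarrow> \<sigma> \<le> 1 \<Longrightarrow> X powr (-\<kappa>) \<le> \<sigma> \<Longrightarrow>
      cmod (\<Sum>n\<in>{N0..<N}. e (D 0 (real n))) \<le> C * real N * X powr (-c)"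
proof -
  from assms obtain q where k: "k = Suc q" by (cases k) auto
  from weyl_smooth[of q] obtain C where C: "C \<ge> 1" and weyl: "\<And>D a L L' \<gamma> \<rho>.
     (\<forall>j\<le>q. \<forall>t\<in>{a..a + real L'}. (D j has_real_derivative D (Suc j) t) (at t)) \<Longrightarrow>
     (\<forall>t\<in>{a..a + real L'}. \<bar>D k t - \<gamma>\<bar> \<le> \<rho>) \<Longrightarrow>
     \<gamma> \<noteq> 0 \<Longrightarrow> \<bar>\<gamma>\<bar> * real L ^ q \<le> 1/2 \<Longrightarrow> 1 \<le> L \<Longrightarrow> L' \<le> L \<Longrightarrow>
     cmod (\<Sum>n<L'. e (D 0 (a + real n))) \<le>
       C * real L * ((real L ^ k * \<bar>\<gamma>\<bar>) powr (-(1 / 2 ^ k)) + (real L ^ k * \<rho>) powr (1 / 2 ^ k))"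
    unfolding k by blast
  \<comment> \<open>Chosen such that the lower bound \<open>N powr (1 / (4 * k))\<close> for the
    block length is at least \<open>X powr (4 * \<kappa>)\<close>.\<close>
  define \<kappa> :: real where "\<kappa> = 1 / (16 * real k ^ 2)"
  define c :: real where "c = 1 / 2 ^ k"
  have k1: "real k \<ge> 1" using assms by simp
  have kap: "0 < \<kappa>" "\<kappa> \<le> 1/16" "\<kappa> \<le> 1 / (16 * real k)"
    using k1 by (auto simp: \<kappa>_def power2_eq_square field_simps intro: order_trans[OF k1])
  have c: "0 < c" "c \<le> 1" by (auto simp: c_def)
  \<comment> \<open>The second summand takes care of bounded \<open>X\<close>, where only the
    trivial estimate is used.\<close>
  define K where "K = 2 * C * (2 ^ k + 1) + 4 powr (1 / (2 * \<kappa>))"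
  have K: "K \<ge> 1" "2 * C * (2 ^ k + 1) \<le> K" "4 powr (1 / (2 * \<kappa>)) \<le> K"
  proof -
    have 1: "2 * C * (2 ^ k + 1) \<ge> 2 * 1 * (0 + 1)" using C by (intro mult_mono add_mono) auto
    have 2: "4 powr (1 / (2 * \<kappa>)) \<ge> (0::real)" by simp
    show "2 * C * (2 ^ k + 1) \<le> K" "4 powr (1 / (2 * \<kappa>)) \<le> K" unfolding K_def using 1 2 by auto
    then show "K \<ge> 1" using 1 by simp
  qed
  show thesis
  proof (rule that[of "\<kappa> * c / 2" "\<kappa> / 2" K])
    fix D :: "nat \<Rightarrow> real \<Rightarrow> real" and N N0 :: nat and X \<sigma> :: real
    assume D: "\<And>j t. j \<le> k \<Longrightarrow> t \<in> {real N0..real N} \<Longrightarrow> (D j has_real_derivative D (Suc j) t) (at t)"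
      and bd: "\<And>t. t \<in> {real N0..real N} \<Longrightarrow> \<sigma> * X / real N ^ k \<le> \<bar>D k t\<bar> \<and> \<bar>D k t\<bar> \<le> X / (\<sigma> * real N ^ k) \<and>
           \<bar>D (Suc k) t\<bar> \<le> X / (\<sigma> * real N ^ Suc k)"
      and N: "1 \<le> N" and X: "1 \<le> X" "X \<le> real N powr (real k - 1/4)"
      and \<sigma>: "\<sigma> \<le> 1" "X powr (-(\<kappa>/2)) \<le> \<sigma>"
    have s0: "\<sigma> > 0" using \<sigma>(2) X(1) by (smt (verit) powr_gt_zero)
    have sinv: "1 / \<sigma> \<le> X powr (\<kappa>/2)"
      using \<sigma>(2) s0 X(1) by (simp add: powr_minus field_simps)
    show "cmod (\<Sum>n\<in>{N0..<N}. e (D 0 (real n))) \<le> K * real N * X powr (-(\<kappa> * c / 2))"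
    proof (cases "X powr (2 * \<kappa>) < 4")
      case True
      have "cmod (\<Sum>n\<in>{N0..<N}. e (D 0 (real n))) \<le> real N"
        by (rule order_trans[OF norm_sum_e_le]) auto
      moreover have "X powr (\<kappa> * c / 2) \<le> K"
      proof -
        have "X = (X powr (2 * \<kappa>)) powr (1 / (2 * \<kappa>))" using X kap by (simp add: powr_powr)
        also have "\<dots> \<le> 4 powr (1 / (2 * \<kappa>))" using True kap by (intro powr_mono2) auto
        finally have "X \<le> K" using K by simp
        moreover have "\<kappa> * c \<le> 1 * 1" using kap c by (intro mult_mono) auto
        then have "X powr (\<kappa> * c / 2) \<le> X powr 1" using X by (intro powr_mono) auto
        ultimately show ?thesis using X by simp
      qed
      then have "K * X powr (-(\<kappa> * c / 2)) \<ge> 1" using X by (simp add: powr_minus field_simps)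
      then have "real N * 1 \<le> real N * (K * X powr (-(\<kappa> * c / 2)))" by (intro mult_left_mono) auto
      ultimately show ?thesis by (simp add: mult_ac)
    next
      case big: False
      \<comment> \<open>With this \<open>b\<close>, the k-th power of the relative block length
        times \<open>X\<close> is exactly \<open>X powr \<kappa>\<close> (\<open>Lrk\<close>),
        whereas one more power of the length makes it small (\<open>Lrk1\<close>).\<close>
      define b where "b = (1 - \<kappa>) / real k"
      have b: "0 \<le> b" using kap by (simp add: b_def)
      define Lr where "Lr = real N * X powr (-b)"
      define L where "L = nat \<lfloor>Lr\<rfloor>"
      have N0: "real N > 0" using N by simp
      have X0: "X > 0" using X by simp
      have Xb: "X powr b \<le> real N powr (1 - 1 / (4 * real k))"
      proof -
        have "X powr b \<le> X powr (1 / real k)"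
          using X kap k1 by (intro powr_mono) (auto simp: b_def divide_right_mono)
        also have "\<dots> \<le> (real N powr (real k - 1/4)) powr (1 / real k)"
          using X by (intro powr_mono2) auto
        also have "\<dots> = real N powr (1 - 1 / (4 * real k))"
          using k1 by (simp add: powr_powr field_simps)
        finally show ?thesis .
      qed
      have Lr_ge: "Lr \<ge> real N powr (1 / (4 * real k))"
      proof -
        have "real N powr (1 / (4 * real k)) * X powr b \<le> real N powr (1 / (4 * real k)) * real N powr (1 - 1 / (4 * real k))"
          by (intro mult_left_mono Xb) auto
        also have "\<dots> = real N" using N0 by (simp add: powr_add[symmetric])
        finally show ?thesis using X0 by (simp add: Lr_def powr_minus field_simps)
      qed
      \<comment> \<open>The margin for the condition on \<gamma> in \<open>weyl_smooth\<close>. It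
        requires long blocks, hence an \<open>X\<close> that stays below the k-th power of
        \<open>N\<close> by a fixed power.\<close>
      have Lr4: "4 * X powr \<kappa> * X powr (\<kappa>/2) \<le> Lr"
      proof -
        have "X powr (1 / real k) \<le> real N"
        proof -
          have "X \<le> real N powr real k" using N0 N by (intro order_trans[OF X(2)] powr_mono) auto
          then have "X powr (1 / real k) \<le> (real N powr real k) powr (1 / real k)" using X by (intro powr_mono2) auto
          then show ?thesis using k1 N0 by (simp add: powr_powr)
        qed
        then have "(X powr (1 / real k)) powr (1 / (4 * real k)) \<le> real N powr (1 / (4 * real k))"
          by (intro powr_mono2) auto
        moreover have "(X powr (1 / real k)) powr (1 / (4 * real k)) = X powr (4 * \<kappa>)"
          using k1 by (simp add: powr_powr \<kappa>_def power2_eq_square mult_ac)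
        ultimately have "X powr (4 * \<kappa>) \<le> Lr" using Lr_ge by simp
        moreover have "4 * X powr (2 * \<kappa>) \<le> X powr (2 * \<kappa>) * X powr (2 * \<kappa>)"
          using big by (intro mult_right_mono) auto
        then have "4 * X powr (2 * \<kappa>) \<le> X powr (4 * \<kappa>)" by (simp add: powr_add[symmetric])
        moreover have "X powr \<kappa> * X powr (\<kappa>/2) \<le> X powr (2 * \<kappa>)"
          unfolding powr_add[symmetric] using X kap by (intro powr_mono) auto
        ultimately show ?thesis by simp
      qed
      have "1 \<le> real N powr (1 / (4 * real k))" using N by (intro ge_one_powr_ge_zero) auto
      then have Lr1: "1 \<le> Lr" using Lr_ge by simp
      have L: "1 \<le> L" "real L \<le> Lr" "Lr / 2 \<le> real L"
      proof -
        have "1 \<le> \<lfloor>Lr\<rfloor>" using Lr1 by simp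
        then have "real L = of_int \<lfloor>Lr\<rfloor>" "1 \<le> \<lfloor>Lr\<rfloor>" unfolding L_def by simp_all
        then show "1 \<le> L" "real L \<le> Lr" "Lr / 2 \<le> real L" by linarith+
      qed
      have Lrk: "Lr ^ k * X = real N ^ k * X powr \<kappa>"
      proof -
        have "(X powr (-b)) ^ k * X = X powr (-b * real k + 1)"
        proof -
          have "(X powr (-b)) ^ k = X powr (-b * real k)" using X0 by (simp add: powr_powr flip: powr_realpow)
          then show ?thesis using X0 by (subst powr_add) simp
        qed
        also have "-b * real k + 1 = \<kappa>" using k1 by (simp add: b_def)
        finally show ?thesis by (simp add: Lr_def power_mult_distrib mult_ac)
      qed
      have Lrk1: "Lr ^ Suc k * X \<le> real N ^ Suc k * X powr (-\<kappa>)"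
      proof -
        have "Lr ^ Suc k * X = (Lr ^ k * X) * Lr" by simp
        also have "\<dots> = real N ^ Suc k * (X powr \<kappa> * X powr (-b))" unfolding Lrk by (simp add: Lr_def)
        also have "\<dots> = real N ^ Suc k * X powr (\<kappa> - b)" by (simp add: powr_diff powr_minus field_simps)
        also have "\<dots> \<le> real N ^ Suc k * X powr (-\<kappa>)"
        proof (intro mult_left_mono powr_mono)
          have "1 / real k \<ge> 16 * \<kappa>" using kap(3) k1 by (simp add: field_simps)
          moreover have "\<kappa> / real k \<le> \<kappa>" using kap k1 by (simp add: divide_le_eq)
          moreover have "b = 1 / real k - \<kappa> / real k" by (simp add: b_def diff_divide_distrib)
          ultimately show "\<kappa> - b \<le> -\<kappa>" using kap by simp
        qed (use X in auto)
        finally show ?thesis .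
      qed
      define \<beta> where "\<beta> = C * real L * ((2 ^ k + 1) * X powr (-(\<kappa> * c / 2)))"
      have "cmod (\<Sum>n\<in>{N0..<N}. e (D 0 (real n))) \<le> \<beta> * (real (N - N0) / real L + 1)"
      proof (rule block_sum_le)
        fix a L' assume a: "N0 \<le> a" "L' \<le> L" "a + L' \<le> N"
        define \<gamma> where "\<gamma> = D k (real a)"
        define \<rho> where "\<rho> = real L * (X / (\<sigma> * real N ^ Suc k))"
        have sub: "t \<in> {real N0..real N}" if "t \<in> {real a..real a + real L'}" for t
          using that a by auto
        have bg: "\<sigma> * X / real N ^ k \<le> \<bar>\<gamma>\<bar>" "\<bar>\<gamma>\<bar> \<le> X / (\<sigma> * real N ^ k)"
          using bd[of "real a"] sub[of "real a"] by (auto simp: \<gamma>_def)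
        have "\<bar>\<gamma>\<bar> > 0" using bg(1) s0 X0 N0 by (smt (verit) divide_pos_pos mult_pos_pos zero_less_power)
        then have g0: "\<gamma> \<noteq> 0" by simp
        have "cmod (\<Sum>n<L'. e (D 0 (real a + real n))) \<le>
          C * real L * ((real L ^ k * \<bar>\<gamma>\<bar>) powr (-(1 / 2 ^ k)) + (real L ^ k * \<rho>) powr (1 / 2 ^ k))"
        proof (rule weyl)
          show "\<forall>j\<le>q. \<forall>t\<in>{real a..real a + real L'}. (D j has_real_derivative D (Suc j) t) (at t)"
            using D sub k by auto
          show "\<forall>t\<in>{real a..real a + real L'}. \<bar>D k t - \<gamma>\<bar> \<le> \<rho>"
          proof
            fix t assume t: "t \<in> {real a..real a + real L'}"
            show "\<bar>D k t - \<gamma>\<bar> \<le> \<rho>"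
            proof (cases "t = real a")
              case True
              then show ?thesis using s0 X0 by (simp add: \<gamma>_def \<rho>_def)
            next
              case False
              then have lt: "real a < t" using t by simp
              obtain z where z: "real a < z" "z < t" "D k t - D k (real a) = (t - real a) * D (Suc k) z"
                using MVT2[OF lt, of "D k" "D (Suc k)"] D[of k] sub t by force
              have "z \<in> {real N0..real N}" using z t by (intro sub) auto
              then have "\<bar>D (Suc k) z\<bar> \<le> X / (\<sigma> * real N ^ Suc k)" using bd by blast
              then have "\<bar>t - real a\<bar> * \<bar>D (Suc k) z\<bar> \<le> \<rho>" unfolding \<rho>_def
                using t a lt by (intro mult_mono) auto
              then show ?thesis using z by (simp add: \<gamma>_def abs_mult)
            qed
          qed
          show "\<gamma> \<noteq> 0" by (rule g0)
          have "\<bar>\<gamma>\<bar> * real L ^ q * real L = \<bar>\<gamma>\<bar> * real L ^ k" by (simp add: k)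
          also have "\<dots> \<le> X / (\<sigma> * real N ^ k) * Lr ^ k"
            using bg(2) L(2) Lr1 X0 s0 by (intro mult_mono power_mono) auto
          also have "\<dots> = X powr \<kappa> / \<sigma>"
            using Lrk N0 s0 by (simp add: field_simps)
          also have "\<dots> \<le> X powr \<kappa> * X powr (\<kappa>/2)"
            using mult_left_mono[OF sinv, of "X powr \<kappa>"] by simp
          also have "\<dots> \<le> Lr / 4" using Lr4 by simp
          also have "\<dots> \<le> 1/2 * real L" using L by simp
          finally show "\<bar>\<gamma>\<bar> * real L ^ q \<le> 1/2" using L(1) by simp
        qed (use L a in auto)
        also have "\<dots> \<le> \<beta>"
        proof -
          have "(real L ^ k * \<bar>\<gamma>\<bar>) powr (-c) \<le> 2 ^ k * X powr (-(\<kappa> * c / 2))"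
          proof -
            have "(Lr / 2) ^ k * (\<sigma> * X / real N ^ k) \<le> real L ^ k * \<bar>\<gamma>\<bar>"
              using L Lr1 bg s0 X0 by (intro mult_mono power_mono) auto
            moreover have "(Lr / 2) ^ k * (\<sigma> * X / real N ^ k) = X powr \<kappa> * \<sigma> / 2 ^ k"
              using Lrk N0 by (simp add: power_divide field_simps)
            moreover have "X powr (\<kappa>/2) \<le> X powr \<kappa> * \<sigma>"
            proof -
              have "X powr \<kappa> * X powr (-(\<kappa>/2)) \<le> X powr \<kappa> * \<sigma>" using \<sigma> by (intro mult_left_mono) auto
              then show ?thesis by (simp add: powr_add[symmetric])
            qed
            then have "X powr (\<kappa>/2) / 2 ^ k \<le> X powr \<kappa> * \<sigma> / 2 ^ k" by (intro divide_right_mono) auto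
            ultimately have "X powr (\<kappa>/2) / 2 ^ k \<le> real L ^ k * \<bar>\<gamma>\<bar>" by simp
            then have "(real L ^ k * \<bar>\<gamma>\<bar>) powr (-c) \<le> (X powr (\<kappa>/2) / 2 ^ k) powr (-c)"
              using X0 c by (intro powr_mono2') auto
            also have "\<dots> = (2 ^ k) powr c * X powr (-(\<kappa> * c / 2))"
              using X0 by (simp add: powr_divide powr_powr powr_minus field_simps)
            also have "(2 ^ k) powr c \<le> (2 ^ k :: real) powr 1" using c by (intro powr_mono) auto
            finally show ?thesis by (simp add: mult_right_mono)
          qed
          moreover have "(real L ^ k * \<rho>) powr c \<le> X powr (-(\<kappa> * c / 2))"
          proof -
            have "real L ^ k * \<rho> = real L ^ Suc k * (X / (\<sigma> * real N ^ Suc k))" by (simp add: \<rho>_def)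
            also have "\<dots> \<le> Lr ^ Suc k * (X / (\<sigma> * real N ^ Suc k))"
              using L s0 X0 N0 by (intro mult_right_mono power_mono) auto
            also have "\<dots> = (Lr ^ Suc k * X) / real N ^ Suc k * (1 / \<sigma>)" by simp
            also have "\<dots> \<le> X powr (-\<kappa>) * X powr (\<kappa>/2)"
              using Lrk1 N0 sinv s0 Lr1 X0 by (intro mult_mono) (auto simp: divide_le_eq mult_ac simp del: power_Suc)
            also have "\<dots> = X powr (-(\<kappa>/2))" by (simp add: powr_add[symmetric])
            finally have "(real L ^ k * \<rho>) powr c \<le> (X powr (-(\<kappa>/2))) powr c"
              using c s0 X0 by (intro powr_mono2) (auto simp: \<rho>_def)
            then show ?thesis by (simp add: powr_powr)
          qed
          ultimately have "(real L ^ k * \<bar>\<gamma>\<bar>) powr (-c) + (real L ^ k * \<rho>) powr c \<le> (2 ^ k + 1) * X powr (-(\<kappa> * c / 2))"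
            by (simp add: algebra_simps)
          then show ?thesis unfolding \<beta>_def c_def[symmetric] using C by (intro mult_left_mono) auto
        qed
        finally show "cmod (\<Sum>n<L'. e (D 0 (real (a + n)))) \<le> \<beta>" by simp
      qed (use L C in \<open>auto simp: \<beta>_def\<close>)
      also have "\<dots> \<le> \<beta> * (2 * real N / real L)"
      proof (rule mult_left_mono)
        have "X powr (-b) \<le> X powr 0" using X b by (intro powr_mono) auto
        then have "Lr \<le> real N * 1" unfolding Lr_def using X0 by (intro mult_left_mono) auto
        then have "real L \<le> real N" using L by simp
        then have "1 \<le> real N / real L" using L by simp
        moreover have "real (N - N0) / real L \<le> real N / real L" by (intro divide_right_mono) auto
        ultimately show "real (N - N0) / real L + 1 \<le> 2 * real N / real L" by simp
      qed (use C in \<open>auto simp: \<beta>_def\<close>)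
      also have "\<dots> = (2 * C * (2 ^ k + 1)) * (real N * X powr (-(\<kappa> * c / 2)))"
        using L by (simp add: \<beta>_def)
      also have "\<dots> \<le> K * (real N * X powr (-(\<kappa> * c / 2)))"
        by (intro mult_right_mono K) auto
      finally show ?thesis by (simp add: mult_ac)
    qed
  qed (use kap c K in auto)
qed

section \<open>Removing the integer parts\<close>

text \<open>The squared modulus of a geometric sum, so that nonnegativity is immediate; the
  normalisation gives mean value 1 and the value \<open>H\<close> at the integers.\<close>

definition fejer :: "nat \<Rightarrow> real \<Rightarrow> real" where
  "fejer H x = (cmod (\<Sum>j<H. e (real j * x)))\<^sup>2 / real H"

lemma fejer_nonneg: "0 \<le> fejer H x"
  by (simp add: fejer_def)

lemma fejer_expand:
  "complex_of_real (fejer H x) = (\<Sum>j<H. \<Sum>k<H. e (of_int (int j - int k) * x)) / of_nat H"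
proof -
  have "complex_of_real ((cmod (\<Sum>j<H. e (real j * x)))\<^sup>2) = (\<Sum>j<H. e (real j * x)) * cnj (\<Sum>k<H. e (real k * x))"
    by (rule complex_norm_square)
  also have "\<dots> = (\<Sum>j<H. \<Sum>k<H. e (real j * x) * cnj (e (real k * x)))"
    by (simp add: sum_product)
  also have "\<dots> = (\<Sum>j<H. \<Sum>k<H. e (of_int (int j - int k) * x))"
    by (simp add: e_diff[symmetric] left_diff_distrib)
  finally show ?thesis by (simp add: fejer_def)
qed

lemma e_plus_of_int: "e (x + of_int n) = e x"
  by (simp add: e_add)

lemma fejer_plus_of_int: "fejer H (x + of_int n) = fejer H x"
proof -
  have "e (real j * (x + of_int n)) = e (real j * x)" for j
    using e_plus_of_int[of "real j * x" "int j * n"] by (simp add: algebra_simps)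
  then show ?thesis by (simp add: fejer_def)
qed

lemma e_eq_1_imp_Ints: "e x = 1 \<Longrightarrow> x \<in> \<int>"
proof -
  assume "e x = 1"
  then obtain n :: int where "2 * pi * x = of_int (2 * n) * pi"
    by (auto simp: e_def exp_eq_1)
  then have "x = of_int n" by simp
  then show ?thesis by simp
qed

text \<open>The frequencies \<open>j - k\<close> lie strictly between \<open>-H\<close> and
  \<open>H\<close>, so averaging over the H-th roots of unity removes all of them but
  \<open>j = k\<close>. The discrete mean is therefore exact, without an error term.\<close>

lemma fejer_mean:
  assumes "1 \<le> H"
  shows "(\<Sum>q<H. fejer H (x - real q / real H)) = real H"
proof -
  have root: "(\<Sum>q<H. e (of_int (int j - int k) * (x - real q / real H))) = (if j = k then of_nat H else 0)"
    if "j < H" "k < H" for j k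
  proof (cases "j = k")
    case False
    define d where "d = int j - int k"
    define z where "z = e (- (of_int d / real H))"
    have "z \<noteq> 1"
    proof
      assume "z = 1"
      then have "- (of_int d / real H) \<in> \<int>" unfolding z_def by (rule e_eq_1_imp_Ints)
      then obtain n where "- (of_int d / real H) = of_int n" by (rule Ints_cases)
      then have "- (of_int d) = of_int n * real H" using assms by (simp add: field_simps)
      then have "- d = n * int H" by (metis of_int_eq_iff of_int_minus of_int_mult of_int_of_nat_eq)
      moreover have "\<bar>d\<bar> < int H" "d \<noteq> 0" using that False by (auto simp: d_def)
      ultimately show False
        by (metis abs_minus_cancel abs_mult abs_of_nat dvd_triv_right dvd_minus_iff zdvd_not_zless zero_less_abs_iff dvd_abs_iff)
    qed
    moreover have "z ^ H = 1"
      using e_power[of H "- (of_int d / real H)"] e_of_int[of "- d"] assms by (simp add: z_def)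
    moreover have "e (of_int d * (x - real q / real H)) = e (of_int d * x) * z ^ q" for q
      unfolding z_def e_power[symmetric] e_add[symmetric] by (rule arg_cong[of _ _ e]) (simp add: algebra_simps)
    ultimately show ?thesis using False
      by (simp add: d_def[symmetric] sum_distrib_left[symmetric] geometric_sum)
  qed simp
  have "complex_of_real (\<Sum>q<H. fejer H (x - real q / real H)) =
    (\<Sum>q<H. (\<Sum>j<H. \<Sum>k<H. e (of_int (int j - int k) * (x - real q / real H))) / of_nat H)"
    by (simp only: of_real_sum fejer_expand)
  also have "\<dots> = (\<Sum>q<H. \<Sum>j<H. \<Sum>k<H. e (of_int (int j - int k) * (x - real q / real H))) / of_nat H"
    by (rule sum_divide_distrib[symmetric])
  also have "(\<Sum>q<H. \<Sum>j<H. \<Sum>k<H. e (of_int (int j - int k) * (x - real q / real H))) =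
    (\<Sum>j<H. \<Sum>k<H. \<Sum>q<H. e (of_int (int j - int k) * (x - real q / real H)))"
    by (subst sum.swap, rule sum.cong[OF refl], rule sum.swap)
  also have "\<dots> = (\<Sum>j<H. \<Sum>k<H. if j = k then of_nat H else 0)"
    by (intro sum.cong refl root) auto
  also have "\<dots> = of_nat H * of_nat H" by (simp add: sum.delta)
  finally have "complex_of_real (\<Sum>q<H. fejer H (x - real q / real H)) = complex_of_real (real H)"
    using assms by simp
  then show ?thesis using of_real_eq_iff by blast
qed

lemma fejer_le:
  assumes "\<delta> > 0" "\<delta> \<le> \<bar>y\<bar>" "\<bar>y\<bar> \<le> 1 - \<delta>"
  shows "fejer H y \<le> 1 / (real H * \<delta>\<^sup>2)"
proof -
  have *: "fejer H y \<le> 1 / (real H * \<delta>\<^sup>2)" if "\<delta> \<le> \<bar>y\<bar>" "\<bar>y\<bar> \<le> 1/2" for y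
  proof -
    have "cmod (\<Sum>j<H. e (0 + real j * y)) \<le> 1 / \<bar>y\<bar>"
      by (rule norm_geometric_e_le) (use that assms in auto)
    also have "\<dots> \<le> 1 / \<delta>" using that assms by (intro divide_left_mono) auto
    finally have "(cmod (\<Sum>j<H. e (real j * y)))\<^sup>2 \<le> (1 / \<delta>)\<^sup>2" by (intro power_mono) auto
    then have "fejer H y \<le> (1 / \<delta>)\<^sup>2 / real H" unfolding fejer_def by (intro divide_right_mono) auto
    then show ?thesis by (simp add: power_divide mult_ac)
  qed
  consider "\<bar>y\<bar> \<le> 1/2" | "y > 1/2" | "y < -1/2" by linarith
  then show ?thesis
  proof cases
    case 1 then show ?thesis using * assms by blast
  next
    case 2
    then show ?thesis using *[of "y + of_int (-1)"] assms unfolding fejer_plus_of_int by auto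
  next
    case 3
    then show ?thesis using *[of "y + of_int 1"] assms unfolding fejer_plus_of_int by auto
  qed
qed

text \<open>The constant 13 exceeds 4 pi: every term of the geometric sum then differs from 1 by
  less than 1/2, and at least half of the sum survives.\<close>

lemma fejer_ge:
  assumes "1 \<le> H" "\<bar>y\<bar> \<le> 1 / (13 * real H)"
  shows "real H / 4 \<le> fejer H y"
proof -
  have "cmod ((\<Sum>j<H. e (real j * y)) - of_nat H) = cmod (\<Sum>j<H. e (real j * y) - e 0)"
    by (simp add: sum_subtractf)
  also have "\<dots> \<le> (\<Sum>j<H. cmod (e (real j * y) - e 0))" by (rule norm_sum)
  also have "\<dots> \<le> (\<Sum>j<H. 1/2)"
  proof (rule sum_mono)
    fix j assume "j \<in> {..<H}"
    then have "real j * \<bar>y\<bar> \<le> real H * (1 / (13 * real H))" using assms by (intro mult_mono) auto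
    then have "real j * \<bar>y\<bar> \<le> 1/13" using assms by simp
    then have *: "2 * pi * (real j * \<bar>y\<bar>) \<le> 2 * 3.2 * (1/13)" using pi_approx by (intro mult_mono) auto
    have "cmod (e (real j * y) - e 0) \<le> 2 * pi * (real j * \<bar>y\<bar>)"
      using e_Lipschitz[of "real j * y" 0] by (simp add: abs_mult)
    also note *
    also have "(2 * 3.2 * (1/13) :: real) \<le> 1/2" by simp
    finally show "cmod (e (real j * y) - e 0) \<le> 1/2" .
  qed
  finally have "cmod ((\<Sum>j<H. e (real j * y)) - of_nat H) \<le> real H / 2" by simp
  moreover have "real H - cmod (\<Sum>j<H. e (real j * y)) \<le> cmod ((\<Sum>j<H. e (real j * y)) - of_nat H)"
    using norm_triangle_ineq2[of "of_nat H" "\<Sum>j<H. e (real j * y)"] by (simp add: norm_minus_commute)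
  ultimately have "real H / 2 \<le> cmod (\<Sum>j<H. e (real j * y))" by simp
  then have "(real H / 2)\<^sup>2 \<le> (cmod (\<Sum>j<H. e (real j * y)))\<^sup>2" by (intro power_mono) auto
  then show ?thesis using assms by (simp add: fejer_def power2_eq_square field_simps)
qed

text \<open>A discrete convolution of \<open>u \<mapsto> e (- \<xi> * u)\<close> on [0, 1) with the
  Fejer kernel. As a function of \<open>x\<close> it is a trigonometric polynomial with integer
  frequencies below \<open>H\<close>, and it approximates \<open>e (- \<xi> * frac x)\<close> away
  from the jump at the integers.\<close>

definition floor_approx :: "nat \<Rightarrow> real \<Rightarrow> real \<Rightarrow> complex" where
  "floor_approx H \<xi> x = (\<Sum>q<H. e (- \<xi> * (real q / real H)) * of_real (fejer H (x - real q / real H))) / of_nat H"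

lemma norm_floor_approx_le:
  assumes "1 \<le> H" shows "cmod (floor_approx H \<xi> x) \<le> 1"
proof -
  have "cmod (\<Sum>q<H. e (- \<xi> * (real q / real H)) * of_real (fejer H (x - real q / real H)))
      \<le> (\<Sum>q<H. fejer H (x - real q / real H))"
    by (rule order_trans[OF norm_sum]) (simp add: norm_mult fejer_nonneg)
  then show ?thesis using assms fejer_mean[OF assms, of x]
    by (simp add: floor_approx_def norm_divide)
qed

text \<open>Nodes within \<open>r\<close> of \<open>frac x\<close> cost the Lipschitz constant times
  \<open>r\<close>; at the others the kernel is small. The distance of \<open>frac x\<close> from 0
  and 1 keeps the peak of the kernel from reaching nodes across the jump.\<close>

lemma floor_approx_error:
  assumes H: "1 \<le> H" and \<xi>: "\<bar>\<xi>\<bar> \<le> 1/2" and r: "0 < r" "r \<le> frac x" "frac x \<le> 1 - r"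
  shows "cmod (floor_approx H \<xi> x - e (- \<xi> * frac x)) \<le> pi * r + 2 / (real H * r\<^sup>2)"
proof -
  define y where "y = frac x"
  have xy: "fejer H (x - real q / real H) = fejer H (y - real q / real H)" for q
    using fejer_plus_of_int[of H "y - real q / real H" "\<lfloor>x\<rfloor>"] by (simp add: y_def frac_def)
  have "of_nat H * (floor_approx H \<xi> x - e (- \<xi> * y)) =
    (\<Sum>q<H. e (- \<xi> * (real q / real H)) * of_real (fejer H (y - real q / real H))) -
    e (- \<xi> * y) * of_real (\<Sum>q<H. fejer H (y - real q / real H))"
    unfolding floor_approx_def xy fejer_mean[OF H] using H by (simp add: field_simps)
  also have "\<dots> = (\<Sum>q<H. (e (- \<xi> * (real q / real H)) - e (- \<xi> * y)) * of_real (fejer H (y - real q / real H)))"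
    by (simp add: sum_distrib_left sum_subtractf left_diff_distrib)
  finally have "real H * cmod (floor_approx H \<xi> x - e (- \<xi> * y)) =
    cmod (\<Sum>q<H. (e (- \<xi> * (real q / real H)) - e (- \<xi> * y)) * of_real (fejer H (y - real q / real H)))"
    by (metis norm_mult norm_of_nat)
  also have "\<dots> \<le> (\<Sum>q<H. cmod (e (- \<xi> * (real q / real H)) - e (- \<xi> * y)) * fejer H (y - real q / real H))"
    by (rule order_trans[OF norm_sum]) (simp add: norm_mult fejer_nonneg)
  also have "\<dots> \<le> (\<Sum>q<H. pi * r * fejer H (y - real q / real H) + 2 / (real H * r\<^sup>2))"
  proof (rule sum_mono)
    fix q assume q: "q \<in> {..<H}"
    define u where "u = real q / real H"
    have u: "0 \<le> u" "u < 1" using q by (auto simp: u_def)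
    have F0: "0 \<le> fejer H (y - u)" by (rule fejer_nonneg)
    show "cmod (e (- \<xi> * (real q / real H)) - e (- \<xi> * y)) * fejer H (y - real q / real H)
        \<le> pi * r * fejer H (y - real q / real H) + 2 / (real H * r\<^sup>2)"
      unfolding u_def[symmetric]
    proof (cases "\<bar>y - u\<bar> \<le> r")
      case True
      have "cmod (e (- \<xi> * u) - e (- \<xi> * y)) \<le> 2 * pi * \<bar>- \<xi> * u - - \<xi> * y\<bar>" by (rule e_Lipschitz)
      also have "\<bar>- \<xi> * u - - \<xi> * y\<bar> = \<bar>\<xi>\<bar> * \<bar>y - u\<bar>" by (simp add: abs_mult[symmetric] algebra_simps)
      also have "2 * pi * (\<bar>\<xi>\<bar> * \<bar>y - u\<bar>) \<le> 2 * pi * (1/2 * r)" using True \<xi> by (intro mult_left_mono mult_mono) auto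
      finally have "cmod (e (- \<xi> * u) - e (- \<xi> * y)) * fejer H (y - u) \<le> pi * r * fejer H (y - u)"
        using F0 by (intro mult_right_mono) auto
      moreover have "0 \<le> 2 / (real H * r\<^sup>2)" by simp
      ultimately show "cmod (e (- \<xi> * u) - e (- \<xi> * y)) * fejer H (y - u) \<le> pi * r * fejer H (y - u) + 2 / (real H * r\<^sup>2)" by linarith
    next
      case False
      have "fejer H (y - u) \<le> 1 / (real H * r\<^sup>2)"
        by (rule fejer_le) (use False r u in \<open>auto simp: y_def\<close>)
      moreover have "cmod (e (- \<xi> * u) - e (- \<xi> * y)) \<le> 2"
        using norm_triangle_ineq4[of "e (- \<xi> * u)" "e (- \<xi> * y)"] by simp
      ultimately have "cmod (e (- \<xi> * u) - e (- \<xi> * y)) * fejer H (y - u) \<le> 2 * (1 / (real H * r\<^sup>2))"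
        using F0 by (intro mult_mono) auto
      moreover have "0 \<le> pi * r * fejer H (y - u)" using F0 r by simp
      ultimately show "cmod (e (- \<xi> * u) - e (- \<xi> * y)) * fejer H (y - u) \<le> pi * r * fejer H (y - u) + 2 / (real H * r\<^sup>2)" by simp
    qed
  qed
  also have "\<dots> = real H * (pi * r + 2 / (real H * r\<^sup>2))"
    unfolding sum.distrib sum_distrib_left[symmetric] fejer_mean[OF H] by (simp add: algebra_simps)
  finally show ?thesis using H by (simp add: y_def)
qed

text \<open>The Fejer kernel of order \<open>R\<close> is nonnegative and at least
  \<open>R / 4\<close> near the integers, so up to this factor it majorises the indicator of these
  points. Its sum over \<open>n\<close> consists of the diagonal and of the sums assumed to be
  small.\<close>

lemma card_near_integer_le:
  fixes p :: "nat \<Rightarrow> real"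
  assumes R: "1 \<le> R" and \<rho>: "0 \<le> \<rho>"
    and sums: "\<And>j::int. 0 < \<bar>j\<bar> \<Longrightarrow> \<bar>j\<bar> < int R \<Longrightarrow> cmod (\<Sum>n=1..N. e (of_int j * p n)) \<le> \<rho> * real N"
  shows "real (card {n \<in> {1..N}. frac (p n) < 1 / (13 * real R) \<or> frac (p n) > 1 - 1 / (13 * real R)})
    \<le> (4 / real R + 4 * \<rho>) * real N"
proof -
  define B where "B = {n \<in> {1..N}. frac (p n) < 1 / (13 * real R) \<or> frac (p n) > 1 - 1 / (13 * real R)}"
  have big: "real R / 4 \<le> fejer R (p n)" if "n \<in> B" for n
  proof -
    have "fejer R (p n) = fejer R (frac (p n))"
      using fejer_plus_of_int[of R "frac (p n)" "\<lfloor>p n\<rfloor>"] by (simp add: frac_def)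
    moreover have "fejer R (frac (p n)) = fejer R (frac (p n) - 1)"
      using fejer_plus_of_int[of R "frac (p n) - 1" 1] by simp
    moreover have "\<bar>frac (p n)\<bar> \<le> 1 / (13 * real R) \<or> \<bar>frac (p n) - 1\<bar> \<le> 1 / (13 * real R)"
      using that frac_ge_0[of "p n"] frac_lt_1[of "p n"] unfolding B_def by auto
    ultimately show ?thesis using fejer_ge[OF R] by metis
  qed
  have "real (card B) * (real R / 4) = (\<Sum>n\<in>B. real R / 4)" by simp
  also have "\<dots> \<le> (\<Sum>n\<in>B. fejer R (p n))" by (rule sum_mono) (rule big)
  also have "\<dots> \<le> (\<Sum>n=1..N. fejer R (p n))"
    by (rule sum_mono2) (auto simp: B_def fejer_nonneg)
  also have "\<dots> \<le> real N + real R * (\<rho> * real N)"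
  proof -
    have "complex_of_real (\<Sum>n=1..N. fejer R (p n)) =
      (\<Sum>n=1..N. \<Sum>j<R. \<Sum>k<R. e (of_int (int j - int k) * p n)) / of_nat R"
      by (simp only: of_real_sum fejer_expand sum_divide_distrib)
    also have "(\<Sum>n=1..N. \<Sum>j<R. \<Sum>k<R. e (of_int (int j - int k) * p n)) =
      (\<Sum>j<R. \<Sum>k<R. \<Sum>n=1..N. e (of_int (int j - int k) * p n))"
      by (subst sum.swap, rule sum.cong[OF refl], rule sum.swap)
    finally have eq: "complex_of_real (\<Sum>n=1..N. fejer R (p n)) =
      (\<Sum>j<R. \<Sum>k<R. \<Sum>n=1..N. e (of_int (int j - int k) * p n)) / of_nat R" .
    have "(\<Sum>n=1..N. fejer R (p n)) \<le> cmod (complex_of_real (\<Sum>n=1..N. fejer R (p n)))"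
      unfolding norm_of_real by (rule abs_ge_self)
    also have "\<dots> = cmod (\<Sum>j<R. \<Sum>k<R. \<Sum>n=1..N. e (of_int (int j - int k) * p n)) / real R"
      unfolding eq by (simp add: norm_divide)
    also have "cmod (\<Sum>j<R. \<Sum>k<R. \<Sum>n=1..N. e (of_int (int j - int k) * p n)) \<le>
      (\<Sum>j<R. \<Sum>k<R. (if j = k then real N else 0) + \<rho> * real N)"
    proof (intro sum_norm_le)
      fix j k assume jk: "j \<in> {..<R}" "k \<in> {..<R}"
      show "cmod (\<Sum>n=1..N. e (of_int (int j - int k) * p n)) \<le> (if j = k then real N else 0) + \<rho> * real N"
      proof (cases "j = k")
        case False
        then have "cmod (\<Sum>n=1..N. e (of_int (int j - int k) * p n)) \<le> \<rho> * real N"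
          using jk by (intro sums) auto
        then show ?thesis using False by simp
      qed (use \<rho> in simp)
    qed
    also have "\<dots> = real R * (real N + real R * (\<rho> * real N))"
      by (simp add: sum.distrib sum.delta algebra_simps)
    finally show ?thesis using R by (simp add: divide_right_mono)
  qed
  finally have "real (card B) \<le> (4 / real R) * (real N + real R * (\<rho> * real N))"
    using R by (simp add: field_simps)
  also have "\<dots> = (4 / real R + 4 * \<rho>) * real N" using R by (simp add: field_simps)
  finally show ?thesis by (simp add: B_def)
qed

lemma floor_approx_expand:
  "floor_approx H \<xi> x = (\<Sum>(q,j,k)\<in>{..<H} \<times> {..<H} \<times> {..<H}.
     (e (- \<xi> * (real q / real H)) * e (- (of_int (int j - int k) * (real q / real H))) / (of_nat H * of_nat H)) *
       e (of_int (int j - int k) * x))"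
proof -
  have split: "e (of_int d * (x - u)) = e (- (of_int d * u)) * e (of_int d * x)" for d u
    by (simp add: e_add[symmetric] algebra_simps)
  have "floor_approx H \<xi> x = (\<Sum>q<H. \<Sum>j<H. \<Sum>k<H.
      e (- \<xi> * (real q / real H)) * e (of_int (int j - int k) * (x - real q / real H)) / (of_nat H * of_nat H))"
    by (simp add: floor_approx_def fejer_expand sum_divide_distrib sum_distrib_left del: of_int_diff)
  also have "\<dots> = (\<Sum>q<H. \<Sum>j<H. \<Sum>k<H.
     (e (- \<xi> * (real q / real H)) * e (- (of_int (int j - int k) * (real q / real H))) / (of_nat H * of_nat H)) *
       e (of_int (int j - int k) * x))"
    unfolding split by (simp only: times_divide_eq_left mult.assoc)
  finally show ?thesis by (simp only: sum.cartesian_product)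
qed

text \<open>Each factor is a combination of \<open>H ^ 3\<close> characters with coefficients of
  modulus \<open>1 / H ^ 2\<close>, of total weight \<open>H\<close>; this is the source of
  \<open>H ^ card A\<close>. The weight \<open>w\<close> is arbitrary so that the induction can move
  one character into it.\<close>

lemma norm_sum_prod_floor_approx_le:
  fixes p :: "'i \<Rightarrow> nat \<Rightarrow> real" and w :: "nat \<Rightarrow> complex"
  assumes "finite A" "1 \<le> H"
    and "\<And>h. (\<And>i. i \<in> A \<Longrightarrow> \<bar>h i\<bar> < int H) \<Longrightarrow>
      cmod (\<Sum>n\<in>S. w n * e (\<Sum>i\<in>A. of_int (h i) * p i n)) \<le> B"
  shows "cmod (\<Sum>n\<in>S. w n * (\<Prod>i\<in>A. floor_approx H (\<xi> i) (p i n))) \<le> real H ^ card A * B"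
  using assms(1,3)
proof (induction A arbitrary: w rule: finite_induct)
  case empty
  then show ?case by simp
next
  case (insert a A)
  define c where "c = (\<lambda>(q,j,k). e (- \<xi> a * (real q / real H)) * e (- (of_int (int j - int k) * (real q / real H))) / (of_nat H * of_nat H))"
  define d where "d = (\<lambda>(q::nat,j,k). int j - int k)"
  define I where "I = {..<H} \<times> {..<H} \<times> {..<H}"
  have T: "floor_approx H (\<xi> a) x = (\<Sum>s\<in>I. c s * e (of_int (d s) * x))" for x
    unfolding floor_approx_expand c_def d_def I_def by (simp add: case_prod_beta)
  have inner: "cmod (\<Sum>n\<in>S. (w n * e (of_int (d s) * p a n)) * (\<Prod>i\<in>A. floor_approx H (\<xi> i) (p i n))) \<le> real H ^ card A * B"
    if s: "s \<in> I" for s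
  proof (rule insert.IH)
    fix h :: "'i \<Rightarrow> int" assume h: "\<And>i. i \<in> A \<Longrightarrow> \<bar>h i\<bar> < int H"
    define h' where "h' = h(a := d s)"
    have "\<bar>d s\<bar> < int H" using s by (auto simp: I_def d_def)
    then have "cmod (\<Sum>n\<in>S. w n * e (\<Sum>i\<in>insert a A. of_int (h' i) * p i n)) \<le> B"
      using h by (intro insert.prems) (auto simp: h'_def)
    moreover have "(\<Sum>i\<in>insert a A. of_int (h' i) * p i n) = of_int (d s) * p a n + (\<Sum>i\<in>A. of_int (h i) * p i n)" for n
    proof -
      have "(\<Sum>i\<in>A. of_int (h' i) * p i n) = (\<Sum>i\<in>A. of_int (h i) * p i n)"
        using insert.hyps by (intro sum.cong) (auto simp: h'_def)
      then show ?thesis using insert.hyps by (simp add: h'_def)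
    qed
    ultimately show "cmod (\<Sum>n\<in>S. w n * e (of_int (d s) * p a n) * e (\<Sum>i\<in>A. of_int (h i) * p i n)) \<le> B"
      by (simp add: e_add mult_ac)
  qed
  have "(\<Sum>n\<in>S. w n * (\<Prod>i\<in>insert a A. floor_approx H (\<xi> i) (p i n))) =
    (\<Sum>n\<in>S. \<Sum>s\<in>I. c s * ((w n * e (of_int (d s) * p a n)) * (\<Prod>i\<in>A. floor_approx H (\<xi> i) (p i n))))"
    using insert.hyps by (simp add: T sum_distrib_left sum_distrib_right mult_ac)
  also have "\<dots> = (\<Sum>s\<in>I. c s * (\<Sum>n\<in>S. (w n * e (of_int (d s) * p a n)) * (\<Prod>i\<in>A. floor_approx H (\<xi> i) (p i n))))"
    by (subst sum.swap) (simp add: sum_distrib_left)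
  also have "cmod \<dots> \<le> (\<Sum>s\<in>I. 1 / (real H * real H) * (real H ^ card A * B))"
  proof (rule sum_norm_le)
    fix s assume s: "s \<in> I"
    have "cmod (c s) = 1 / (real H * real H)" by (simp add: c_def case_prod_beta norm_mult norm_divide)
    then show "cmod (c s * (\<Sum>n\<in>S. (w n * e (of_int (d s) * p a n)) * (\<Prod>i\<in>A. floor_approx H (\<xi> i) (p i n))))
        \<le> 1 / (real H * real H) * (real H ^ card A * B)"
      using inner[OF s] by (simp only: norm_mult) (intro mult_left_mono, auto)
  qed
  also have "\<dots> = real H ^ card (insert a A) * B"
    using insert.hyps assms(2) by (simp add: I_def card_cartesian_product)
  finally show ?case .
qed

text \<open>Each floor is written as \<open>p - frac p\<close> and each
  \<open>e (- \<xi> * frac p)\<close> replaced by its approximation. Then \<open>joint\<close>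
  controls the resulting trigonometric polynomial, and \<open>single\<close> the points near the
  integers, where the approximation fails.\<close>

lemma norm_floor_sum_le:
  fixes p :: "'i \<Rightarrow> nat \<Rightarrow> real"
  assumes A: "finite A" and R: "1 \<le> R" and \<rho>: "0 \<le> \<rho>" and \<xi>: "\<And>i. i \<in> A \<Longrightarrow> \<bar>\<xi> i\<bar> \<le> 1/2"
    and joint: "\<And>h::'i \<Rightarrow> int. (\<And>i. i \<in> A \<Longrightarrow> \<bar>h i\<bar> < int (R ^ 3)) \<Longrightarrow>
      cmod (\<Sum>n=1..N. e (\<Sum>i\<in>A. (\<xi> i + of_int (h i)) * p i n)) \<le> \<rho> * real N"
    and single: "\<And>i j. i \<in> A \<Longrightarrow> 0 < \<bar>j::int\<bar> \<Longrightarrow> \<bar>j\<bar> < int R \<Longrightarrow> cmod (\<Sum>n=1..N. e (of_int j * p i n)) \<le> \<rho> * real N"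
  shows "cmod (\<Sum>n=1..N. e (\<Sum>i\<in>A. \<xi> i * of_int \<lfloor>p i n\<rfloor>)) \<le>
    (real (R ^ 3) ^ card A * \<rho> + real (card A) * (347 / real R + 8 * \<rho>)) * real N"
proof -
  \<comment> \<open>The approximation has an error of order \<open>1 / (H * r ^ 2)\<close> at
    distance \<open>r\<close> from the integers. For \<open>r\<close> of order \<open>1 / R\<close>
    this is of order \<open>1 / R\<close> when \<open>H = R ^ 3\<close>.\<close>
  define H where "H = R ^ 3"
  define r where "r = 1 / (13 * real R)"
  have H1: "1 \<le> H" using R by (simp add: H_def)
  have r0: "0 < r" using R by (simp add: r_def)
  define w where "w = (\<lambda>n. e (\<Sum>i\<in>A. \<xi> i * p i n))"
  define T where "T = (\<lambda>n. w n * (\<Prod>i\<in>A. floor_approx H (\<xi> i) (p i n)))"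
  define F where "F = (\<lambda>n. e (\<Sum>i\<in>A. \<xi> i * of_int \<lfloor>p i n\<rfloor>))"
  define bad where "bad = (\<lambda>i. {n \<in> {1..N}. frac (p i n) < r \<or> frac (p i n) > 1 - r})"
  have F: "F n = w n * (\<Prod>i\<in>A. e (- \<xi> i * frac (p i n)))" for n
  proof -
    have "(\<Sum>i\<in>A. \<xi> i * of_int \<lfloor>p i n\<rfloor>) = (\<Sum>i\<in>A. \<xi> i * p i n) + (\<Sum>i\<in>A. - \<xi> i * frac (p i n))"
      unfolding sum.distrib[symmetric] by (intro sum.cong) (auto simp: frac_def algebra_simps)
    then show ?thesis by (simp only: F_def w_def e_add e_sum[OF A, of "\<lambda>i. - \<xi> i * frac (p i n)"])
  qed
  have Tsum: "cmod (\<Sum>n=1..N. T n) \<le> real H ^ card A * (\<rho> * real N)"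
    unfolding T_def
  proof (rule norm_sum_prod_floor_approx_le[OF A H1])
    fix h :: "'i \<Rightarrow> int" assume h: "\<And>i. i \<in> A \<Longrightarrow> \<bar>h i\<bar> < int H"
    have "w n * e (\<Sum>i\<in>A. of_int (h i) * p i n) = e (\<Sum>i\<in>A. (\<xi> i + of_int (h i)) * p i n)" for n
      by (simp add: w_def e_add[symmetric] sum.distrib[symmetric] algebra_simps)
    then show "cmod (\<Sum>n=1..N. w n * e (\<Sum>i\<in>A. of_int (h i) * p i n)) \<le> \<rho> * real N"
      using joint[of h] h by (simp add: H_def)
  qed
  have err: "cmod (floor_approx H (\<xi> i) (p i n) - e (- \<xi> i * frac (p i n))) \<le> 339 / real R + (if n \<in> bad i then 2 else 0)"
    if i: "i \<in> A" and n: "n \<in> {1..N}" for i n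
  proof (cases "n \<in> bad i")
    case True
    have "cmod (floor_approx H (\<xi> i) (p i n) - e (- \<xi> i * frac (p i n))) \<le> 1 + 1"
      by (rule order_trans[OF norm_triangle_ineq4]) (intro add_mono norm_floor_approx_le H1, simp)
    also have "1 + 1 \<le> 339 / real R + 2" by simp
    finally show ?thesis using True by simp
  next
    case False
    have "cmod (floor_approx H (\<xi> i) (p i n) - e (- \<xi> i * frac (p i n))) \<le> pi * r + 2 / (real H * r\<^sup>2)"
      by (rule floor_approx_error[OF H1 \<xi>[OF i] r0]) (use False n in \<open>auto simp: bad_def\<close>)
    also have "2 / (real H * r\<^sup>2) = 338 / real R"
      using R by (simp add: H_def r_def power2_eq_square power3_eq_cube field_simps)
    also have "pi * r \<le> 1 / real R"
      using pi_less_4 R by (simp add: r_def field_simps)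
    finally show ?thesis using False by (simp add: field_simps)
  qed
  have cb: "real (card (bad i)) \<le> (4 / real R + 4 * \<rho>) * real N" if "i \<in> A" for i
    unfolding bad_def r_def by (rule card_near_integer_le[OF R \<rho> single[OF that]])
  have "cmod ((\<Sum>n=1..N. F n) - (\<Sum>n=1..N. T n)) \<le> (\<Sum>n=1..N. \<Sum>i\<in>A. 339 / real R + (if n \<in> bad i then 2 else 0))"
    unfolding sum_subtractf[symmetric]
  proof (rule sum_norm_le)
    fix n assume n: "n \<in> {1..N}"
    have "cmod (F n - T n) = cmod ((\<Prod>i\<in>A. floor_approx H (\<xi> i) (p i n)) - (\<Prod>i\<in>A. e (- \<xi> i * frac (p i n))))"
      unfolding F T_def right_diff_distrib[symmetric] by (simp add: norm_mult w_def norm_minus_commute)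
    also have "\<dots> \<le> (\<Sum>i\<in>A. cmod (floor_approx H (\<xi> i) (p i n) - e (- \<xi> i * frac (p i n))))"
      by (rule norm_prod_diff) (auto intro: norm_floor_approx_le H1)
    also have "\<dots> \<le> (\<Sum>i\<in>A. 339 / real R + (if n \<in> bad i then 2 else 0))"
      by (intro sum_mono err n)
    finally show "cmod (F n - T n) \<le> (\<Sum>i\<in>A. 339 / real R + (if n \<in> bad i then 2 else 0))" .
  qed
  also have "\<dots> = (\<Sum>i\<in>A. \<Sum>n=1..N. 339 / real R + (if n \<in> bad i then 2 else 0))" by (rule sum.swap)
  also have "\<dots> \<le> (\<Sum>i\<in>A. (347 / real R + 8 * \<rho>) * real N)"
  proof (rule sum_mono)
    fix i assume i: "i \<in> A"
    have "(\<Sum>n=1..N. if n \<in> bad i then 2 else 0) = 2 * real (card (bad i))"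
    proof -
      have "(\<Sum>n=1..N. if n \<in> bad i then 2 else 0 :: real) = (\<Sum>n\<in>{n\<in>{1..N}. n \<in> bad i}. 2)"
        by (rule sum.inter_filter[symmetric]) simp
      also have "{n\<in>{1..N}. n \<in> bad i} = bad i" by (auto simp: bad_def)
      finally show ?thesis by simp
    qed
    then have "(\<Sum>n=1..N. 339 / real R + (if n \<in> bad i then 2 else 0)) = 339 / real R * real N + 2 * real (card (bad i))"
      by (simp add: sum.distrib)
    also have "\<dots> \<le> 339 / real R * real N + 2 * ((4 / real R + 4 * \<rho>) * real N)"
      using cb[OF i] by simp
    also have "\<dots> = (347 / real R + 8 * \<rho>) * real N" by (simp add: field_simps)
    finally show "(\<Sum>n=1..N. 339 / real R + (if n \<in> bad i then 2 else 0)) \<le> (347 / real R + 8 * \<rho>) * real N" .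
  qed
  finally have "cmod ((\<Sum>n=1..N. F n) - (\<Sum>n=1..N. T n)) \<le> real (card A) * ((347 / real R + 8 * \<rho>) * real N)" by simp
  moreover have "cmod (\<Sum>n=1..N. F n) \<le> cmod ((\<Sum>n=1..N. F n) - (\<Sum>n=1..N. T n)) + cmod (\<Sum>n=1..N. T n)"
    by (metis diff_add_cancel norm_triangle_ineq)
  ultimately have "cmod (\<Sum>n=1..N. F n) \<le> real (card A) * ((347 / real R + 8 * \<rho>) * real N) + real H ^ card A * (\<rho> * real N)"
    using Tsum by linarith
  then show ?thesis by (simp add: F_def H_def algebra_simps)
qed

section \<open>Exponential sums along a tame family\<close>

text \<open>The asymptotic data of a tame family with uniform constants beyond
  \<open>T\<^sub>0\<close>. In \<open>gap\<close> the sign is fixed for each pair and order, which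
  makes the quotients of two derivatives strictly monotone in modulus; this is what confines the
  points where two terms have comparable size.\<close>

locale tame_family =
  fixes m :: nat and P :: "nat \<Rightarrow> real \<Rightarrow> real" and K :: nat and C\<^sub>0 T\<^sub>0 g :: real
  assumes m: "1 \<le> m" and K: "1 \<le> K" and C0: "1 \<le> C\<^sub>0" and T0: "1 \<le> T\<^sub>0" and g: "0 < g"
    and has_deriv: "i \<in> {1..m} \<Longrightarrow> T\<^sub>0 \<le> t \<Longrightarrow> k \<le> Suc K \<Longrightarrow>
      ((deriv ^^ k) (P i) has_real_derivative (deriv ^^ Suc k) (P i) t) (at t)"
    and nonzero: "i \<in> {1..m} \<Longrightarrow> T\<^sub>0 \<le> t \<Longrightarrow> k \<le> Suc K \<Longrightarrow> (deriv ^^ k) (P i) t \<noteq> 0"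
    and log_deriv_le: "i \<in> {1..m} \<Longrightarrow> T\<^sub>0 \<le> t \<Longrightarrow> k \<le> K \<Longrightarrow>
      \<bar>t * (deriv ^^ Suc k) (P i) t / (deriv ^^ k) (P i) t\<bar> \<le> C\<^sub>0"
    and log_deriv_ge: "i \<in> {1..m} \<Longrightarrow> T\<^sub>0 \<le> t \<Longrightarrow> g \<le> t * deriv (P i) t / P i t"
    and powr_le: "i \<in> {1..m} \<Longrightarrow> T\<^sub>0 \<le> t \<Longrightarrow> t powr g \<le> \<bar>P i t\<bar>"
    and deriv_K_le: "i \<in> {1..m} \<Longrightarrow> T\<^sub>0 \<le> t \<Longrightarrow> \<bar>(deriv ^^ K) (P i) t\<bar> \<le> t powr (-1/2)"
    and deriv_K_ge: "i \<in> {1..m} \<Longrightarrow> T\<^sub>0 \<le> t \<Longrightarrow> t powr (-1/16) * \<bar>P i t\<bar> \<le> t ^ K * \<bar>(deriv ^^ K) (P i) t\<bar>"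
    and gap: "i \<in> {1..m} \<Longrightarrow> j \<in> {1..m} \<Longrightarrow> i \<noteq> j \<Longrightarrow> k \<le> K \<Longrightarrow>
      (\<forall>t\<ge>T\<^sub>0. g \<le> t * (deriv ^^ Suc k) (P i) t / (deriv ^^ k) (P i) t - t * (deriv ^^ Suc k) (P j) t / (deriv ^^ k) (P j) t) \<or>
      (\<forall>t\<ge>T\<^sub>0. g \<le> t * (deriv ^^ Suc k) (P j) t / (deriv ^^ k) (P j) t - t * (deriv ^^ Suc k) (P i) t / (deriv ^^ k) (P i) t)"

lemma tame_imp_tame_family:
  assumes tame: "tame m P \<tau>" and m: "1 \<le> m"
  obtains K C\<^sub>0 T\<^sub>0 g where "tame_family m P K C\<^sub>0 T\<^sub>0 g"
proof -
  define L where "L = (\<lambda>i k t. t * (deriv ^^ Suc k) (P i) t / (deriv ^^ k) (P i) t)"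
  have sm: "smooth_at_top ((deriv ^^ k) (P i))" if "i \<in> {1..m}" for i k
    using tame that by (intro smooth_at_top_funpow_deriv) (auto simp: tame_def)
  have sl: "slope ((deriv ^^ k) (P i)) (\<tau> i - real k)" and \<tau>0: "0 < \<tau> i" if "i \<in> {1..m}" for i k
    using tame that by (auto simp: tame_def)
  have inj: "\<tau> i \<noteq> \<tau> j" if "i \<in> {1..m}" "j \<in> {1..m}" "i \<noteq> j" for i j
    using tame that by (auto simp: tame_def dest: inj_onD)
  have limL: "(L i k \<longlongrightarrow> \<tau> i - real k) at_top" if "i \<in> {1..m}" for i k
    using sl[OF that, of k] by (simp add: slope_def L_def)
  \<comment> \<open>Any common upper bound of the types would do; the sum is one, since they are
    positive.\<close>
  define s where "s = (\<Sum>i=1..m. \<tau> i)"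
  have s: "\<tau> i \<le> s" if "i \<in> {1..m}" for i
    unfolding s_def using \<tau>0 that by (intro member_le_sum) (auto intro: less_imp_le)
  have s0: "0 \<le> s" unfolding s_def using \<tau>0 by (intro sum_nonneg) (auto intro: less_imp_le)
  define K where "K = nat \<lceil>s\<rceil> + 1"
  have K: "\<tau> i + 1 \<le> real K" if "i \<in> {1..m}" for i
    using s[OF that] s0 unfolding K_def by linarith
  define C where "C = s + real K + 1"
  \<comment> \<open>All positive quantities that \<open>g\<close> has to stay below: the types and
    the distances between them.\<close>
  define A where "A = \<tau> ` {1..m} \<union> (\<lambda>(i, j). \<bar>\<tau> i - \<tau> j\<bar>) ` {(i, j). i \<in> {1..m} \<and> j \<in> {1..m} \<and> i \<noteq> j}"
  have "finite {(i, j). i \<in> {1..m} \<and> j \<in> {1..m} \<and> i \<noteq> j}"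
    by (rule finite_subset[of _ "{1..m} \<times> {1..m}"]) auto
  then have A: "finite A" "A \<noteq> {}" using m by (auto simp: A_def)
  define g where "g = Min A / 2"
  have "0 < Min A"
    using A inj \<tau>0 by (auto simp: Min_gr_iff A_def)
  then have g0: "0 < g" by (simp add: g_def)
  have g\<tau>: "g < \<tau> i" if "i \<in> {1..m}" for i
    using Min_le[OF A(1), of "\<tau> i"] that g0 by (auto simp: A_def g_def)
  have gd: "g < \<bar>\<tau> i - \<tau> j\<bar>" if "i \<in> {1..m}" "j \<in> {1..m}" "i \<noteq> j" for i j
  proof -
    have "\<bar>\<tau> i - \<tau> j\<bar> \<in> A" using that by (force simp: A_def)
    then show ?thesis using Min_le[OF A(1)] g0 by (force simp: g_def)
  qed
  have ev1: "eventually (\<lambda>t. ((deriv ^^ k) (P i) has_real_derivative (deriv ^^ Suc k) (P i) t) (at t) \<and>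
      (deriv ^^ k) (P i) t \<noteq> 0) at_top" if "i \<in> {1..m}" for i k
    using eventually_conj[OF smooth_at_top_DERIV[OF sm[OF that, of k]]] sl[OF that, of k] by (simp add: slope_def)
  have ev2: "eventually (\<lambda>t. \<bar>L i k t\<bar> \<le> C) at_top" if "i \<in> {1..m}" "k \<le> K" for i k
  proof -
    have "\<bar>\<tau> i - real k\<bar> < C" using s[OF that(1)] \<tau>0[OF that(1)] that(2) s0 by (auto simp: C_def)
    then have "eventually (\<lambda>t. \<bar>L i k t\<bar> < C) at_top"
      using order_tendstoD(2)[OF tendsto_rabs[OF limL[OF that(1)]]] by blast
    then show ?thesis by eventually_elim simp
  qed
  have ev3: "eventually (\<lambda>t. g \<le> L i 0 t \<and> t powr g \<le> \<bar>P i t\<bar> \<and> \<bar>(deriv ^^ K) (P i) t\<bar> \<le> t powr (-1/2) \<and>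
      t powr (-1/16) * \<bar>P i t\<bar> \<le> t ^ K * \<bar>(deriv ^^ K) (P i) t\<bar>) at_top" if i: "i \<in> {1..m}" for i
  proof -
    have "eventually (\<lambda>t. g < L i 0 t) at_top"
      using order_tendstoD(1)[OF limL[OF i, of 0]] g\<tau>[OF i] by simp
    moreover have "eventually (\<lambda>t. t powr g \<le> \<bar>P i t\<bar>) at_top"
      using slope_powr_le[OF sm[OF i, of 0] sl[OF i, of 0]] g\<tau>[OF i] by simp
    moreover have "eventually (\<lambda>t. \<bar>(deriv ^^ K) (P i) t\<bar> \<le> t powr (-1/2)) at_top"
      by (rule slope_le_powr[OF sm[OF i] sl[OF i]]) (use K[OF i] in simp)
    \<comment> \<open>The loss 1/16 is split evenly between this bound and the next one.\<close>
    moreover have "eventually (\<lambda>t. t powr (\<tau> i - real K - 1/32) \<le> \<bar>(deriv ^^ K) (P i) t\<bar>) at_top"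
      by (rule slope_powr_le[OF sm[OF i] sl[OF i]]) simp
    moreover have "eventually (\<lambda>t. \<bar>P i t\<bar> \<le> t powr (\<tau> i + 1/32)) at_top"
      using slope_le_powr[OF sm[OF i, of 0] sl[OF i, of 0], of "\<tau> i + 1/32"] by simp
    ultimately show ?thesis using eventually_gt_at_top[of 0]
    proof eventually_elim
      case (elim t)
      have "t powr (-1/16) * \<bar>P i t\<bar> \<le> t powr (-1/16) * t powr (\<tau> i + 1/32)"
        using elim by (intro mult_left_mono) auto
      also have "\<dots> = t powr real K * t powr (\<tau> i - real K - 1/32)"
        by (simp add: powr_add[symmetric])
      also have "\<dots> \<le> t ^ K * \<bar>(deriv ^^ K) (P i) t\<bar>"
        using elim by (simp add: powr_realpow mult_left_mono)
      finally show ?case using elim by auto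
    qed
  qed
  have ev4: "eventually (\<lambda>t. (\<tau> j < \<tau> i \<longrightarrow> g \<le> L i k t - L j k t) \<and> (\<tau> i < \<tau> j \<longrightarrow> g \<le> L j k t - L i k t)) at_top"
    if ij: "i \<in> {1..m}" "j \<in> {1..m}" "i \<noteq> j" for i j k
  proof -
    have lim: "((\<lambda>t. L i k t - L j k t) \<longlongrightarrow> \<tau> i - \<tau> j) at_top"
      using tendsto_diff[OF limL[OF ij(1), of k] limL[OF ij(2), of k]] by simp
    consider "\<tau> j < \<tau> i" | "\<tau> i < \<tau> j" using inj[OF ij] by linarith
    then show ?thesis
    proof cases
      case 1
      then have "eventually (\<lambda>t. g < L i k t - L j k t) at_top"
        using order_tendstoD(1)[OF lim] gd[OF ij] by simp
      then show ?thesis by eventually_elim (use 1 in auto)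
    next
      case 2
      then have "eventually (\<lambda>t. L i k t - L j k t < - g) at_top"
        using order_tendstoD(2)[OF lim] gd[OF ij] by simp
      then show ?thesis by eventually_elim (use 2 in auto)
    qed
  qed
  define good where "good = (\<lambda>t.
      (\<forall>i\<in>{1..m}. (\<forall>k\<in>{..Suc K}. ((deriv ^^ k) (P i) has_real_derivative (deriv ^^ Suc k) (P i) t) (at t) \<and>
      (deriv ^^ k) (P i) t \<noteq> 0)) \<and> (\<forall>i\<in>{1..m}. \<forall>k\<in>{..K}. \<bar>L i k t\<bar> \<le> C) \<and>
      (\<forall>i\<in>{1..m}. g \<le> L i 0 t \<and> t powr g \<le> \<bar>P i t\<bar> \<and> \<bar>(deriv ^^ K) (P i) t\<bar> \<le> t powr (-1/2) \<and>
      t powr (-1/16) * \<bar>P i t\<bar> \<le> t ^ K * \<bar>(deriv ^^ K) (P i) t\<bar>) \<and>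
      (\<forall>i\<in>{1..m}. \<forall>j\<in>{1..m} - {i}. \<forall>k\<in>{..K}.
      (\<tau> j < \<tau> i \<longrightarrow> g \<le> L i k t - L j k t) \<and> (\<tau> i < \<tau> j \<longrightarrow> g \<le> L j k t - L i k t)))"
  have "eventually (\<lambda>t. \<forall>i\<in>{1..m}. (\<forall>k\<in>{..Suc K}. ((deriv ^^ k) (P i) has_real_derivative (deriv ^^ Suc k) (P i) t) (at t) \<and>
      (deriv ^^ k) (P i) t \<noteq> 0)) at_top"
    by (intro eventually_ball_finite ballI finite_atLeastAtMost finite_atMost ev1)
  moreover have "eventually (\<lambda>t. \<forall>i\<in>{1..m}. \<forall>k\<in>{..K}. \<bar>L i k t\<bar> \<le> C) at_top"
    by (intro eventually_ball_finite ballI finite_atLeastAtMost finite_atMost ev2) auto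
  moreover have "eventually (\<lambda>t. \<forall>i\<in>{1..m}. g \<le> L i 0 t \<and> t powr g \<le> \<bar>P i t\<bar> \<and> \<bar>(deriv ^^ K) (P i) t\<bar> \<le> t powr (-1/2) \<and>
      t powr (-1/16) * \<bar>P i t\<bar> \<le> t ^ K * \<bar>(deriv ^^ K) (P i) t\<bar>) at_top"
    by (intro eventually_ball_finite ballI finite_atLeastAtMost ev3)
  moreover have "eventually (\<lambda>t. \<forall>i\<in>{1..m}. \<forall>j\<in>{1..m} - {i}. \<forall>k\<in>{..K}.
      (\<tau> j < \<tau> i \<longrightarrow> g \<le> L i k t - L j k t) \<and> (\<tau> i < \<tau> j \<longrightarrow> g \<le> L j k t - L i k t)) at_top"
    by (intro eventually_ball_finite ballI finite_atLeastAtMost finite_atMost finite_Diff ev4) auto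
  ultimately have "eventually good at_top"
    unfolding good_def by eventually_elim (intro conjI)
  then obtain T where T: "\<And>t. t \<ge> T \<Longrightarrow> good t" by (auto simp: eventually_at_top_linorder)
  have mono: "max T 1 \<le> t \<Longrightarrow> T \<le> t" for t :: real by simp
  have "tame_family m P K C (max T 1) g"
  proof (unfold_locales, goal_cases)
    case 1 show ?case by (rule m)
  next
    case 2 show ?case by (simp add: K_def)
  next
    case 3 show ?case using s0 by (simp add: C_def)
  next
    case 4 show ?case by simp
  next
    case 5 show ?case by (rule g0)
  next
    case (6 i t k) then show ?case using T[OF mono, unfolded good_def] by (meson atMost_iff)
  next
    case (7 i t k) then show ?case using T[OF mono, unfolded good_def] by (meson atMost_iff)
  next
    case (8 i t k) then show ?case using T[OF mono, unfolded good_def] unfolding L_def by (meson atMost_iff)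
  next
    case (9 i t)
    then have "g \<le> L i 0 t" using T[OF mono, unfolded good_def] by blast
    then show ?case by (simp add: L_def)
  next
    case (10 i t) then show ?case using T[OF mono, unfolded good_def] by blast
  next
    case (11 i t) then show ?case using T[OF mono, unfolded good_def] by blast
  next
    case (12 i t) then show ?case using T[OF mono, unfolded good_def] by blast
  next
    case (13 i j k)
    have *: "(\<tau> j < \<tau> i \<longrightarrow> g \<le> L i k t - L j k t) \<and> (\<tau> i < \<tau> j \<longrightarrow> g \<le> L j k t - L i k t)" if "max T 1 \<le> t" for t
      using T[OF mono[OF that], unfolded good_def] 13 by (metis Diff_iff atMost_iff singletonD)
    consider "\<tau> j < \<tau> i" | "\<tau> i < \<tau> j" using inj[OF 13(1-3)] by linarith
    then show ?case using * unfolding L_def by cases blast+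
  qed
  then show thesis by (rule that)
qed

section \<open>Sums without cancellation\<close>

definition separated :: "nat \<Rightarrow> (nat \<Rightarrow> real) \<Rightarrow> bool" where
  "separated m x \<longleftrightarrow> (\<forall>i\<in>{1..m}. \<forall>j\<in>{1..m}. i \<noteq> j \<longrightarrow>
     2 * real m * \<bar>x i\<bar> \<le> \<bar>x j\<bar> \<or> 2 * real m * \<bar>x j\<bar> \<le> \<bar>x i\<bar>)"

text \<open>The largest term exceeds each other one by a factor 2 m, so the others add up to at most
  half of it. Hence the sum is at least 1/2, and the sum of the moduli at most 3/2, of the largest
  modulus.\<close>

lemma separated_sum_abs_le:
  assumes "separated m x" "1 \<le> m"
  shows "(\<Sum>i=1..m. \<bar>x i\<bar>) \<le> 3 * \<bar>\<Sum>i=1..m. x i\<bar>"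
proof -
  obtain i where i: "i \<in> {1..m}" "\<And>j. j \<in> {1..m} \<Longrightarrow> \<bar>x j\<bar> \<le> \<bar>x i\<bar>"
    using obtains_MAX[of "{1..m}" "\<lambda>i. \<bar>x i\<bar>"] assms(2) by (metis Max_ge atLeastAtMost_iff empty_iff finite_atLeastAtMost finite_imageI imageI le_refl)
  have small: "\<bar>x j\<bar> \<le> \<bar>x i\<bar> / (2 * real m)" if j: "j \<in> {1..m} - {i}" for j
  proof -
    have "2 * real m * \<bar>x j\<bar> \<le> \<bar>x i\<bar> \<or> 2 * real m * \<bar>x i\<bar> \<le> \<bar>x j\<bar>"
      using assms(1) i(1) j unfolding separated_def by auto
    \<comment> \<open>If the relation points the other way, maximality of \<open>x i\<close> forces
      both terms to vanish.\<close>
    moreover have "2 * real m * \<bar>x j\<bar> \<le> \<bar>x i\<bar>" if "2 * real m * \<bar>x i\<bar> \<le> \<bar>x j\<bar>"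
    proof -
      have "2 * \<bar>x i\<bar> \<le> 2 * real m * \<bar>x i\<bar>" using assms(2) by (intro mult_right_mono) auto
      then have "x i = 0" "x j = 0" using that i(2)[of j] j by auto
      then show ?thesis by simp
    qed
    ultimately have "2 * real m * \<bar>x j\<bar> \<le> \<bar>x i\<bar>" by blast
    then show ?thesis using assms(2) by (simp add: field_simps)
  qed
  have "(\<Sum>j\<in>{1..m} - {i}. \<bar>x j\<bar>) \<le> (\<Sum>j\<in>{1..m} - {i}. \<bar>x i\<bar> / (2 * real m))"
    by (rule sum_mono) (rule small)
  also have "\<dots> = (real m - 1) * (\<bar>x i\<bar> / (2 * real m))" using i(1) assms(2) by (simp add: of_nat_diff)
  also have "\<dots> \<le> real m * (\<bar>x i\<bar> / (2 * real m))" by (intro mult_right_mono) auto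
  also have "\<dots> = \<bar>x i\<bar> / 2" using assms(2) by simp
  finally have rest: "(\<Sum>j\<in>{1..m} - {i}. \<bar>x j\<bar>) \<le> \<bar>x i\<bar> / 2" .
  have s1: "(\<Sum>j=1..m. \<bar>x j\<bar>) = \<bar>x i\<bar> + (\<Sum>j\<in>{1..m} - {i}. \<bar>x j\<bar>)"
    and s2: "(\<Sum>j=1..m. x j) = x i + (\<Sum>j\<in>{1..m} - {i}. x j)"
    by (rule sum.remove[OF _ i(1)]; simp)+
  have "\<bar>\<Sum>j\<in>{1..m} - {i}. x j\<bar> \<le> (\<Sum>j\<in>{1..m} - {i}. \<bar>x j\<bar>)" by (rule sum_abs)
  moreover have "\<bar>u\<bar> - \<bar>v\<bar> \<le> \<bar>u + v\<bar>" for u v :: real by arith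
  from this[of "x i" "\<Sum>j\<in>{1..m} - {i}. x j"]
  have "\<bar>x i\<bar> - \<bar>\<Sum>j\<in>{1..m} - {i}. x j\<bar> \<le> \<bar>x i + (\<Sum>j\<in>{1..m} - {i}. x j)\<bar>" .
  moreover have "u + s \<le> 3 * w" if "v \<le> s" "u - v \<le> w" "s \<le> u / 2" for u v w s :: real
    using that by linarith
  ultimately show ?thesis using rest unfolding s1 s2 by blast
qed

section \<open>Exponential sums with real coefficients\<close>

context tame_family
begin

lemma deriv_growth:
  assumes i: "i \<in> {1..m}" and k: "k \<le> K" and t: "T\<^sub>0 \<le> t" "t \<le> N"
  shows "\<bar>(deriv ^^ k) (P i) t\<bar> \<le> (N / t) powr C\<^sub>0 * \<bar>(deriv ^^ k) (P i) N\<bar>"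
    and "\<bar>(deriv ^^ k) (P i) N\<bar> \<le> (N / t) powr C\<^sub>0 * \<bar>(deriv ^^ k) (P i) t\<bar>"
proof -
  have t0: "0 < t" using t T0 by simp
  have bound: "- C\<^sub>0 \<le> u * (deriv ^^ Suc k) (P i) u / (deriv ^^ k) (P i) u \<and>
      u * (deriv ^^ Suc k) (P i) u / (deriv ^^ k) (P i) u \<le> C\<^sub>0" if "u \<in> {t..N}" for u
    using abs_le_iff[THEN iffD1, OF log_deriv_le[OF i _ k, of u]] that t by auto
  have *: "(N / t) powr (- C\<^sub>0) * \<bar>(deriv ^^ k) (P i) t\<bar> \<le> \<bar>(deriv ^^ k) (P i) N\<bar>"
    by (rule log_growth_ge[OF t0 t(2), where Q' = "(deriv ^^ Suc k) (P i)"])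
      (use has_deriv[OF i, of _ k] nonzero[OF i, of _ k] bound k t in
        \<open>auto simp del: funpow.simps\<close>)
  have "(N / t) powr C\<^sub>0 > 0" using t0 t by simp
  with * show "\<bar>(deriv ^^ k) (P i) t\<bar> \<le> (N / t) powr C\<^sub>0 * \<bar>(deriv ^^ k) (P i) N\<bar>"
    by (simp add: powr_minus field_simps)
  show "\<bar>(deriv ^^ k) (P i) N\<bar> \<le> (N / t) powr C\<^sub>0 * \<bar>(deriv ^^ k) (P i) t\<bar>"
    by (rule log_growth_le[OF t0 t(2), where Q' = "(deriv ^^ Suc k) (P i)"])
      (use has_deriv[OF i, of _ k] nonzero[OF i, of _ k] bound k t in
        \<open>auto simp del: funpow.simps\<close>)
qed

text \<open>The terms with \<open>n < N / R ^ a\<close> are estimated trivially. On the remaining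
  range each derivative changes by at most a fixed power of \<open>R\<close>, and separation forbids
  cancellation, so \<open>smooth_sum_bound\<close> applies with a tolerance \<sigma> that is at
  least a negative power of \<open>R\<close>. The lower bound \<open>R ^ E\<close> for
  \<open>X\<close> compensates for it.\<close>

lemma order_bound:
  assumes k: "1 \<le> k" "k \<le> K"
  obtains E R\<^sub>1 where "1 \<le> R\<^sub>1" and
    "\<And>R N \<theta> X. R\<^sub>1 \<le> R \<Longrightarrow> T\<^sub>0 * real R ^ a \<le> real N \<Longrightarrow>
      X = real N ^ k * (\<Sum>i=1..m. \<bar>\<theta> i * (deriv ^^ k) (P i) (real N)\<bar>) \<Longrightarrow>
      real R ^ E \<le> X \<Longrightarrow> X \<le> real N powr (real k - 1/4) \<Longrightarrow>
      (\<And>t. real N / real R ^ a \<le> t \<Longrightarrow> t \<le> real N \<Longrightarrow> separated m (\<lambda>i. \<theta> i * (deriv ^^ k) (P i) t)) \<Longrightarrow>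
      cmod (\<Sum>n=1..N. e (\<Sum>i=1..m. \<theta> i * P i (real n))) \<le> 3 * real N / real R ^ a"
proof -
  obtain c \<kappa> C where c: "0 < c" "0 < \<kappa>" "C \<ge> 1" and bound: "\<And>D N N0 X \<sigma>.
      (\<And>j t. j \<le> k \<Longrightarrow> t \<in> {real N0..real N} \<Longrightarrow> (D j has_real_derivative D (Suc j) t) (at t)) \<Longrightarrow>
      (\<And>t. t \<in> {real N0..real N} \<Longrightarrow> \<sigma> * X / real N ^ k \<le> \<bar>D k t\<bar> \<and> \<bar>D k t\<bar> \<le> X / (\<sigma> * real N ^ k) \<and>
           \<bar>D (Suc k) t\<bar> \<le> X / (\<sigma> * real N ^ Suc k)) \<Longrightarrow>
      1 \<le> N \<Longrightarrow> 1 \<le> X \<Longrightarrow> X \<le> real N powr (real k - 1/4) \<Longrightarrow> \<sigma> \<le> 1 \<Longrightarrow> X powr (-\<kappa>) \<le> \<sigma> \<Longrightarrow>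
      cmod (\<Sum>n\<in>{N0..<N}. e (D 0 (real n))) \<le> C * real N * X powr (-c)"
    using smooth_sum_bound[OF k(1)] by metis
  \<comment> \<open>\<open>R powr b\<close> bounds 1 / \<sigma>; the summand 1 is there because
    \<open>3 * C\<^sub>0 \<le> R\<close>. The two entries of the maximum in \<open>E\<close> make
    \<open>X powr c\<close> at least \<open>C * R ^ a\<close> and \<open>X powr \<kappa>\<close> at
    least \<open>R powr b\<close>.\<close>
  define b where "b = real a * (C\<^sub>0 + 1) + 1"
  define E where "E = nat \<lceil>max ((real a + 1) / c) (b / \<kappa>)\<rceil>"
  have "max ((real a + 1) / c) (b / \<kappa>) \<le> real E" unfolding E_def by (rule of_nat_ceiling)
  then have E: "real a + 1 \<le> real E * c" "b \<le> real E * \<kappa>"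
    using c by (simp_all add: pos_divide_le_eq)
  define R1 where "R1 = nat \<lceil>max C (3 * C\<^sub>0)\<rceil>"
  have "max C (3 * C\<^sub>0) \<le> real R1" unfolding R1_def by (rule of_nat_ceiling)
  then have R1: "C \<le> real R1" "3 * C\<^sub>0 \<le> real R1" by auto
  show thesis
  proof (rule that[of R1 E])
    show "1 \<le> R1" using R1 C0 by simp
    fix R N \<theta> X
    assume R: "R1 \<le> R" and N: "T\<^sub>0 * real R ^ a \<le> real N"
      and Xdef: "X = real N ^ k * (\<Sum>i=1..m. \<bar>\<theta> i * (deriv ^^ k) (P i) (real N)\<bar>)"
      and X: "real R ^ E \<le> X" "X \<le> real N powr (real k - 1/4)"
      and sep: "\<And>t. real N / real R ^ a \<le> t \<Longrightarrow> t \<le> real N \<Longrightarrow> separated m (\<lambda>i. \<theta> i * (deriv ^^ k) (P i) t)"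
    have RC: "C \<le> real R" "3 * C\<^sub>0 \<le> real R" using R R1 by linarith+
    have R_ge1: "1 \<le> real R" using RC C0 by simp
    have X1: "1 \<le> X" using X(1) one_le_power[OF R_ge1, of E] by simp
    have Ra: "1 \<le> real R ^ a" by (rule one_le_power[OF R_ge1])
    have "1 * real R ^ a \<le> T\<^sub>0 * real R ^ a" using T0 by (intro mult_right_mono) auto
    then have NR: "real R ^ a \<le> real N" using N by linarith
    then have N0: "0 < real N" using Ra by linarith
    define W where "W = real R ^ a"
    have W: "1 \<le> W" using Ra by (simp add: W_def)
    define N0 where "N0 = nat \<lceil>real N / W\<rceil>"
    have N0_ge: "real N / W \<le> real N0" unfolding N0_def by (rule of_nat_ceiling)
    have N0_le: "real N0 \<le> real N / W + 1"
    proof -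
      have "0 \<le> real N / W" using W by simp
      then show ?thesis unfolding N0_def by linarith
    qed
    have "real N / W \<le> real N" using W N0 by (simp add: divide_le_eq mult_le_cancel_left1)
    then have N0N: "N0 \<le> N" unfolding N0_def by (simp add: nat_le_iff ceiling_le_iff)
    have W0: "0 < W" using W by linarith
    have T0N: "T\<^sub>0 \<le> real N / W" using N pos_le_divide_eq[OF W0, of T\<^sub>0 "real N"] by (simp add: W_def)
    define D where "D = (\<lambda>j t. \<Sum>i=1..m. \<theta> i * (deriv ^^ j) (P i) t)"
    define Z where "Z = (\<lambda>t. \<Sum>i=1..m. \<bar>\<theta> i * (deriv ^^ k) (P i) t\<bar>)"
    \<comment> \<open>The 3 comes from \<open>separated_sum_abs_le\<close>, \<open>C\<^sub>0\<close>
      from passing to the next derivative, \<open>W powr C\<^sub>0\<close> from moving between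
      \<open>t\<close> and \<open>N\<close>, and the last \<open>W\<close> from replacing
      \<open>1 / t\<close> by \<open>1 / N\<close>.\<close>
    define \<sigma> where "\<sigma> = 1 / (3 * C\<^sub>0 * (W powr C\<^sub>0 * W))"
    have WC: "1 \<le> W powr C\<^sub>0" using W C0 by (intro ge_one_powr_ge_zero) auto
    have Wbig: "1 \<le> W powr C\<^sub>0 * W" using mult_mono[OF WC W] by simp
    have \<sigma>0: "0 < \<sigma>" using Wbig C0 by (simp add: \<sigma>_def)
    have \<sigma>1: "\<sigma> \<le> 1"
    proof -
      have "1 * 1 \<le> (3 * C\<^sub>0) * (W powr C\<^sub>0 * W)" using Wbig C0 by (intro mult_mono) auto
      then have *: "1 \<le> 3 * C\<^sub>0 * (W powr C\<^sub>0 * W)" by simp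
      have "1 / y \<le> 1" if "1 \<le> y" for y :: real using that by simp
      from this[OF *] show ?thesis unfolding \<sigma>_def .
    qed
    have XZ: "X = real N ^ k * Z (real N)" by (simp add: Xdef Z_def)
    have ZN0: "0 \<le> Z (real N)" by (simp add: Z_def sum_nonneg)
    have "cmod (\<Sum>n\<in>{N0..<N}. e (D 0 (real n))) \<le> C * real N * X powr (-c)"
    proof (rule bound[where \<sigma> = \<sigma>])
      fix j t assume j: "j \<le> k" and t: "t \<in> {real N0..real N}"
      have "T\<^sub>0 \<le> t" using t T0N N0_ge by auto
      then show "(D j has_real_derivative D (Suc j) t) (at t)"
        unfolding D_def using j k by (intro DERIV_sum DERIV_cmult has_deriv) auto
    next
      fix t assume t: "t \<in> {real N0..real N}"
      then have t1: "real N / W \<le> t" "t \<le> real N" using N0_ge by auto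
      then have tT: "T\<^sub>0 \<le> t" using T0N by simp
      then have t0: "0 < t" using T0 by simp
      have Nt: "real N / t \<le> W" "1 \<le> real N / t" using t1 t0 W by (auto simp: field_simps)
      have powN: "(real N / t) powr C\<^sub>0 \<le> W powr C\<^sub>0" using Nt C0 by (intro powr_mono2) auto
      have ZtN: "Z t \<le> W powr C\<^sub>0 * Z (real N)"
        unfolding Z_def sum_distrib_left
      proof (rule sum_mono)
        fix i assume i: "i \<in> {1..m}"
        have "\<bar>(deriv ^^ k) (P i) t\<bar> \<le> (real N / t) powr C\<^sub>0 * \<bar>(deriv ^^ k) (P i) (real N)\<bar>"
          by (rule deriv_growth(1)[OF i k(2) tT t1(2)])
        also have "\<dots> \<le> W powr C\<^sub>0 * \<bar>(deriv ^^ k) (P i) (real N)\<bar>" using powN by (intro mult_right_mono) auto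
        finally have "\<bar>\<theta> i\<bar> * \<bar>(deriv ^^ k) (P i) t\<bar> \<le> \<bar>\<theta> i\<bar> * (W powr C\<^sub>0 * \<bar>(deriv ^^ k) (P i) (real N)\<bar>)"
          by (intro mult_left_mono) auto
        then show "\<bar>\<theta> i * (deriv ^^ k) (P i) t\<bar> \<le> W powr C\<^sub>0 * \<bar>\<theta> i * (deriv ^^ k) (P i) (real N)\<bar>"
          by (simp add: abs_mult mult_ac)
      qed
      have ZNt: "Z (real N) \<le> W powr C\<^sub>0 * Z t"
        unfolding Z_def sum_distrib_left
      proof (rule sum_mono)
        fix i assume i: "i \<in> {1..m}"
        have "\<bar>(deriv ^^ k) (P i) (real N)\<bar> \<le> (real N / t) powr C\<^sub>0 * \<bar>(deriv ^^ k) (P i) t\<bar>"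
          by (rule deriv_growth(2)[OF i k(2) tT t1(2)])
        also have "\<dots> \<le> W powr C\<^sub>0 * \<bar>(deriv ^^ k) (P i) t\<bar>" using powN by (intro mult_right_mono) auto
        finally have "\<bar>\<theta> i\<bar> * \<bar>(deriv ^^ k) (P i) (real N)\<bar> \<le> \<bar>\<theta> i\<bar> * (W powr C\<^sub>0 * \<bar>(deriv ^^ k) (P i) t\<bar>)"
          by (intro mult_left_mono) auto
        then show "\<bar>\<theta> i * (deriv ^^ k) (P i) (real N)\<bar> \<le> W powr C\<^sub>0 * \<bar>\<theta> i * (deriv ^^ k) (P i) t\<bar>"
          by (simp add: abs_mult mult_ac)
      qed
      have Zt0: "0 \<le> Z t" by (simp add: Z_def sum_nonneg)
      have lower: "Z t \<le> 3 * \<bar>D k t\<bar>"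
        unfolding Z_def D_def using sep[of t] t1 m by (intro separated_sum_abs_le) (auto simp: W_def)
      have upper: "\<bar>D k t\<bar> \<le> Z t" unfolding Z_def D_def by (rule sum_abs)
      have next_le: "t * \<bar>D (Suc k) t\<bar> \<le> C\<^sub>0 * Z t"
      proof -
        have "t * \<bar>D (Suc k) t\<bar> \<le> t * (\<Sum>i=1..m. \<bar>\<theta> i * (deriv ^^ Suc k) (P i) t\<bar>)"
          unfolding D_def using t0 by (intro mult_left_mono sum_abs) auto
        also have "\<dots> \<le> C\<^sub>0 * Z t"
          unfolding Z_def sum_distrib_left
        proof (rule sum_mono)
          fix i assume i: "i \<in> {1..m}"
          have "\<bar>(deriv ^^ k) (P i) t\<bar> > 0" using nonzero[OF i tT, of k] k by simp
          then have "t * \<bar>(deriv ^^ Suc k) (P i) t\<bar> \<le> C\<^sub>0 * \<bar>(deriv ^^ k) (P i) t\<bar>"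
            using log_deriv_le[OF i tT k(2)] t0 by (simp add: abs_mult abs_divide pos_divide_le_eq del: funpow.simps)
          then have "\<bar>\<theta> i\<bar> * (t * \<bar>(deriv ^^ Suc k) (P i) t\<bar>) \<le> \<bar>\<theta> i\<bar> * (C\<^sub>0 * \<bar>(deriv ^^ k) (P i) t\<bar>)"
            by (intro mult_left_mono) auto
          then show "t * \<bar>\<theta> i * (deriv ^^ Suc k) (P i) t\<bar> \<le> C\<^sub>0 * \<bar>\<theta> i * (deriv ^^ k) (P i) t\<bar>"
            by (simp add: abs_mult mult_ac del: funpow.simps)
        qed
        finally show ?thesis .
      qed
      show "\<sigma> * X / real N ^ k \<le> \<bar>D k t\<bar> \<and> \<bar>D k t\<bar> \<le> X / (\<sigma> * real N ^ k) \<and> \<bar>D (Suc k) t\<bar> \<le> X / (\<sigma> * real N ^ Suc k)"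
      proof (intro conjI)
        have "Z (real N) \<le> 3 * (W powr C\<^sub>0 * \<bar>D k t\<bar>)"
          using ZNt mult_left_mono[OF lower, of "W powr C\<^sub>0"] by simp
        also have "W powr C\<^sub>0 * \<bar>D k t\<bar> \<le> C\<^sub>0 * (W powr C\<^sub>0 * W) * \<bar>D k t\<bar>"
        proof (rule mult_right_mono)
          have "1 * (W powr C\<^sub>0 * 1) \<le> C\<^sub>0 * (W powr C\<^sub>0 * W)" using W C0 by (intro mult_mono) auto
          then show "W powr C\<^sub>0 \<le> C\<^sub>0 * (W powr C\<^sub>0 * W)" by simp
        qed simp
        finally have "Z (real N) \<le> \<bar>D k t\<bar> / \<sigma>" by (simp add: \<sigma>_def mult_ac)
        then have "\<sigma> * Z (real N) \<le> \<bar>D k t\<bar>" using \<sigma>0 by (simp add: field_simps)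
        then show "\<sigma> * X / real N ^ k \<le> \<bar>D k t\<bar>" using N0 by (simp add: XZ)
        have s3: "W powr C\<^sub>0 * W * C\<^sub>0 \<le> 1 / \<sigma>"
        proof -
          have "(W powr C\<^sub>0 * W * C\<^sub>0) * 1 \<le> (W powr C\<^sub>0 * W * C\<^sub>0) * 3" using W C0 by (intro mult_left_mono) auto
          then show ?thesis by (simp add: \<sigma>_def mult_ac)
        qed
        have "W powr C\<^sub>0 * 1 * 1 \<le> W powr C\<^sub>0 * W * C\<^sub>0" using W C0 by (intro mult_mono) auto
        then have "W powr C\<^sub>0 * Z (real N) \<le> 1 / \<sigma> * Z (real N)" using s3 ZN0 by (intro mult_right_mono) auto
        then show "\<bar>D k t\<bar> \<le> X / (\<sigma> * real N ^ k)" using upper ZtN N0 by (simp add: XZ)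
        have "t * \<bar>D (Suc k) t\<bar> \<le> C\<^sub>0 * (W powr C\<^sub>0 * Z (real N))"
          by (rule order_trans[OF next_le], rule mult_left_mono[OF ZtN]) (use C0 in simp)
        then have "W * (t * \<bar>D (Suc k) t\<bar>) \<le> W * (C\<^sub>0 * (W powr C\<^sub>0 * Z (real N)))" using W by (intro mult_left_mono) auto
        also have "\<dots> = (W powr C\<^sub>0 * W * C\<^sub>0) * Z (real N)" by simp
        also have "\<dots> \<le> 1 / \<sigma> * Z (real N)" using s3 ZN0 by (intro mult_right_mono) auto
        finally have "W * t * \<bar>D (Suc k) t\<bar> \<le> Z (real N) / \<sigma>" by (simp add: mult_ac)
        moreover have "real N * \<bar>D (Suc k) t\<bar> \<le> W * t * \<bar>D (Suc k) t\<bar>"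
          using t1 W by (intro mult_right_mono) (auto simp: field_simps)
        ultimately have "real N * \<bar>D (Suc k) t\<bar> \<le> Z (real N) / \<sigma>" by simp
        then have "\<bar>D (Suc k) t\<bar> \<le> Z (real N) / \<sigma> / real N" by (subst pos_le_divide_eq[OF N0]) (simp add: mult.commute)
        also have "\<dots> = X / (\<sigma> * real N ^ Suc k)" using N0 by (simp add: XZ)
        finally show "\<bar>D (Suc k) t\<bar> \<le> X / (\<sigma> * real N ^ Suc k)" .
      qed
    next
      show "X powr (-\<kappa>) \<le> \<sigma>"
      proof -
        have "3 * C\<^sub>0 * (W powr C\<^sub>0 * W) \<le> real R powr b"
        proof -
          have "W powr C\<^sub>0 * W = real R powr (real a * (C\<^sub>0 + 1))"
            using R_ge1 by (simp add: W_def powr_realpow[symmetric] powr_powr powr_add[symmetric] algebra_simps)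
          moreover have "real R powr b = real R * real R powr (real a * (C\<^sub>0 + 1))"
            using R_ge1 by (simp add: b_def powr_add)
          ultimately show ?thesis using RC by (simp add: mult_right_mono)
        qed
        also have "\<dots> \<le> real R powr (real E * \<kappa>)" using E R_ge1 by (intro powr_mono) auto
        also have "\<dots> = (real R ^ E) powr \<kappa>" using R_ge1 by (simp add: powr_realpow[symmetric] powr_powr)
        also have "\<dots> \<le> X powr \<kappa>" using X c R_ge1 by (intro powr_mono2) auto
        finally have "3 * C\<^sub>0 * (W powr C\<^sub>0 * W) \<le> X powr \<kappa>" .
        moreover have "0 < 3 * C\<^sub>0 * (W powr C\<^sub>0 * W)" using C0 W by simp
        ultimately have "1 / (X powr \<kappa>) \<le> \<sigma>"
          unfolding \<sigma>_def inverse_eq_divide[symmetric] by (rule le_imp_inverse_le)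
        then show ?thesis by (simp add: powr_minus_divide)
      qed
    qed (use N0 X1 X \<sigma>1 in auto)
    also have "C * real N * X powr (-c) \<le> real N / W"
    proof -
      have "C * W \<le> real R powr (real a + 1)"
        using RC R_ge1 by (simp add: W_def powr_add powr_realpow mult_ac)
      also have "\<dots> \<le> real R powr (real E * c)" using E R_ge1 by (intro powr_mono) auto
      also have "\<dots> = (real R ^ E) powr c" using R_ge1 by (simp add: powr_realpow[symmetric] powr_powr)
      also have "\<dots> \<le> X powr c" using X c R_ge1 by (intro powr_mono2) auto
      finally have "C * W \<le> X powr c" .
      then have "C / X powr c \<le> 1 / W" using W X1 by (simp add: field_simps)
      then have "real N * (C / X powr c) \<le> real N * (1 / W)" by (intro mult_left_mono) auto
      then show ?thesis by (simp add: powr_minus_divide mult_ac)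
    qed
    finally have main: "cmod (\<Sum>n\<in>{N0..<N}. e (D 0 (real n))) \<le> real N / W" .
    have "1 \<le> N0"
    proof -
      have "0 < real N0" using N0_ge W N0 by (smt (verit) divide_pos_pos)
      then show ?thesis by simp
    qed
    \<comment> \<open>The initial segment, the main range and the last term cost at most
      \<open>N / W\<close> each; this is the 3 of the statement.\<close>
    then have "{1..N} = {1..<N0} \<union> {N0..<N} \<union> {N}" using N0N by auto
    then have "(\<Sum>n=1..N. e (D 0 (real n))) = (\<Sum>n\<in>{1..<N0} \<union> {N0..<N} \<union> {N}. e (D 0 (real n)))" by simp
    also have "\<dots> = (\<Sum>n\<in>{1..<N0}. e (D 0 (real n))) + (\<Sum>n\<in>{N0..<N}. e (D 0 (real n))) + e (D 0 (real N))"
      using N0N by (subst sum.union_disjoint, auto)+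
    also have "cmod \<dots> \<le> cmod (\<Sum>n\<in>{1..<N0}. e (D 0 (real n))) + cmod (\<Sum>n\<in>{N0..<N}. e (D 0 (real n))) + 1"
      by (rule order_trans[OF norm_triangle_ineq]) (simp add: norm_triangle_ineq)
    also have "\<dots> \<le> (real N0 - 1) + real N / W + 1"
      using norm_sum_e_le[of "\<lambda>n. D 0 (real n)" "{1..<N0}"] main \<open>1 \<le> N0\<close> by (simp add: of_nat_diff)
    also have "\<dots> \<le> 2 * (real N / W) + 1" using N0_le by simp
    also have "1 \<le> real N / W" using NR by (subst le_divide_eq_1_pos[OF W0]) (simp add: W_def)
    finally show "cmod (\<Sum>n=1..N. e (\<Sum>i=1..m. \<theta> i * P i (real n))) \<le> 3 * real N / real R ^ a"
      by (simp add: D_def W_def)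
  qed
qed

text \<open>If the phase \<open>Z\<close> is at most the square root of \<open>N\<close>, order 1 is
  used: \<open>t * P'\<close> and \<open>P\<close> agree up to constants, so \<open>X\<close> is as
  large as \<open>Z\<close>, yet below \<open>N powr (3/4)\<close>. Otherwise order \<open>K\<close>
  is used: its loss leaves \<open>X\<close> above \<open>N powr (7/16)\<close>, and the decay of the
  K-th derivative keeps it below \<open>N powr (K - 1/4)\<close>.\<close>

lemma exp_sum_bound:
  obtains E R\<^sub>1 where "1 \<le> R\<^sub>1" and
    "\<And>R N \<theta>. R\<^sub>1 \<le> R \<Longrightarrow> real R ^ E \<le> real N \<Longrightarrow>
      (\<And>i. i \<in> {1..m} \<Longrightarrow> \<bar>\<theta> i\<bar> \<le> real R ^ 3 + 1) \<Longrightarrow>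
      real R ^ E \<le> (\<Sum>i=1..m. \<bar>\<theta> i * P i (real N)\<bar>) \<Longrightarrow>
      (\<And>k t. k \<in> {1, K} \<Longrightarrow> real N / real R ^ a \<le> t \<Longrightarrow> t \<le> real N \<Longrightarrow>
         separated m (\<lambda>i. \<theta> i * (deriv ^^ k) (P i) t)) \<Longrightarrow>
      cmod (\<Sum>n=1..N. e (\<Sum>i=1..m. \<theta> i * P i (real n))) \<le> 3 * real N / real R ^ a"
proof -
  obtain E1 r1 where r1: "1 \<le> r1" and bound1: "\<And>R N \<theta> X. r1 \<le> R \<Longrightarrow> T\<^sub>0 * real R ^ a \<le> real N \<Longrightarrow>
      X = real N ^ 1 * (\<Sum>i=1..m. \<bar>\<theta> i * (deriv ^^ 1) (P i) (real N)\<bar>) \<Longrightarrow>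
      real R ^ E1 \<le> X \<Longrightarrow> X \<le> real N powr (real 1 - 1/4) \<Longrightarrow>
      (\<And>t. real N / real R ^ a \<le> t \<Longrightarrow> t \<le> real N \<Longrightarrow> separated m (\<lambda>i. \<theta> i * (deriv ^^ 1) (P i) t)) \<Longrightarrow>
      cmod (\<Sum>n=1..N. e (\<Sum>i=1..m. \<theta> i * P i (real n))) \<le> 3 * real N / real R ^ a"
  proof (rule order_bound[OF le_refl K, of a], goal_cases)
    case (1 E R)
    show ?case by (rule that[OF 1(2)], rule 1(3)) blast+
  qed
  obtain EK rK where rK: "1 \<le> rK" and boundK: "\<And>R N \<theta> X. rK \<le> R \<Longrightarrow> T\<^sub>0 * real R ^ a \<le> real N \<Longrightarrow>
      X = real N ^ K * (\<Sum>i=1..m. \<bar>\<theta> i * (deriv ^^ K) (P i) (real N)\<bar>) \<Longrightarrow>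
      real R ^ EK \<le> X \<Longrightarrow> X \<le> real N powr (real K - 1/4) \<Longrightarrow>
      (\<And>t. real N / real R ^ a \<le> t \<Longrightarrow> t \<le> real N \<Longrightarrow> separated m (\<lambda>i. \<theta> i * (deriv ^^ K) (P i) t)) \<Longrightarrow>
      cmod (\<Sum>n=1..N. e (\<Sum>i=1..m. \<theta> i * P i (real n))) \<le> 3 * real N / real R ^ a"
  proof (rule order_bound[OF K le_refl, of a], goal_cases)
    case (1 E R)
    show ?case by (rule that[OF 1(2)], rule 1(3)) blast+
  qed
  define r where "r = nat \<lceil>max (max C\<^sub>0 T\<^sub>0) (1 / g)\<rceil>"
  have "max (max C\<^sub>0 T\<^sub>0) (1 / g) \<le> real r" unfolding r_def by (rule of_nat_ceiling)
  then have r: "C\<^sub>0 \<le> real r" "T\<^sub>0 \<le> real r" "1 / g \<le> real r" by auto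
  show thesis
  \<comment> \<open>\<open>E1\<close> serves the first order and \<open>a\<close> the start of the
    range; \<open>3 * EK\<close> gives \<open>R ^ EK \<le> N powr (1/3)\<close>; 21 exceeds 4 * 5,
    as the coefficients at order \<open>K\<close> need
    \<open>R ^ 5 \<le> N powr (1/4)\<close>.\<close>
  proof (rule that[of "r1 + rK + r + m + 2" "E1 + 3 * EK + a + 21"])
    show "1 \<le> r1 + rK + r + m + 2" by simp
    fix R N \<theta>
    assume R: "r1 + rK + r + m + 2 \<le> R" and N: "real R ^ (E1 + 3 * EK + a + 21) \<le> real N"
      and \<theta>: "\<And>i. i \<in> {1..m} \<Longrightarrow> \<bar>\<theta> i\<bar> \<le> real R ^ 3 + 1"
      and A: "real R ^ (E1 + 3 * EK + a + 21) \<le> (\<Sum>i=1..m. \<bar>\<theta> i * P i (real N)\<bar>)"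
      and sep: "\<And>k t. k \<in> {1, K} \<Longrightarrow> real N / real R ^ a \<le> t \<Longrightarrow> t \<le> real N \<Longrightarrow>
         separated m (\<lambda>i. \<theta> i * (deriv ^^ k) (P i) t)"
    have R2: "2 \<le> real R" "real m \<le> real R" "C\<^sub>0 \<le> real R" "T\<^sub>0 \<le> real R" "1 / g \<le> real R" "r1 \<le> R" "rK \<le> R"
      using R r by linarith+
    have R1: "1 \<le> real R" using R2 by simp
    have pow: "real R ^ j \<le> real N" if "j \<le> E1 + 3 * EK + a + 21" for j
      using power_increasing[OF that R1] N by linarith
    have N0: "0 < real N" and N1: "1 \<le> real N" using pow[of 0] by auto
    have NT0: "T\<^sub>0 * real R ^ a \<le> real N"
    proof -
      have "T\<^sub>0 * real R ^ a \<le> real R ^ Suc a" using R2 by (simp add: mult_right_mono)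
      also have "\<dots> \<le> real N" by (rule pow) simp
      finally show ?thesis .
    qed
    have "T\<^sub>0 * 1 \<le> T\<^sub>0 * real R ^ a" using T0 by (intro mult_left_mono one_le_power R1) auto
    then have NT: "T\<^sub>0 \<le> real N" using NT0 by linarith
    have root: "real R ^ j \<le> real N powr (1/4)" if "4 * j \<le> E1 + 3 * EK + a + 21" for j
    proof -
      have "(real R ^ (4 * j)) powr (1/4) \<le> real N powr (1/4)" using pow[OF that] by (intro powr_mono2) auto
      moreover have "(real R ^ (4 * j)) powr (1/4) = real R ^ j" using R1 by (simp add: powr_realpow[symmetric] powr_powr)
      ultimately show ?thesis by simp
    qed
    define Z where "Z = (\<Sum>i=1..m. \<bar>\<theta> i * P i (real N)\<bar>)"
    show "cmod (\<Sum>n=1..N. e (\<Sum>i=1..m. \<theta> i * P i (real n))) \<le> 3 * real N / real R ^ a"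
    proof (cases "Z \<le> real N powr (1/2)")
      case True
      define X where "X = real N ^ 1 * (\<Sum>i=1..m. \<bar>\<theta> i * (deriv ^^ 1) (P i) (real N)\<bar>)"
      have Xeq: "X = (\<Sum>i=1..m. \<bar>\<theta> i\<bar> * \<bar>real N * deriv (P i) (real N)\<bar>)"
        by (simp add: X_def sum_distrib_left abs_mult mult_ac)
      have ratio: "g * \<bar>P i (real N)\<bar> \<le> \<bar>real N * deriv (P i) (real N)\<bar>"
        "\<bar>real N * deriv (P i) (real N)\<bar> \<le> C\<^sub>0 * \<bar>P i (real N)\<bar>" if i: "i \<in> {1..m}" for i
      proof -
        have nz: "\<bar>P i (real N)\<bar> > 0" using nonzero[OF i NT, of 0] by simp
        have "g \<le> \<bar>real N * deriv (P i) (real N) / P i (real N)\<bar>" using log_deriv_ge[OF i NT] by linarith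
        then show "g * \<bar>P i (real N)\<bar> \<le> \<bar>real N * deriv (P i) (real N)\<bar>"
          unfolding abs_divide using nz by (simp add: pos_le_divide_eq)
        have "\<bar>real N * deriv (P i) (real N) / P i (real N)\<bar> \<le> C\<^sub>0" using log_deriv_le[OF i NT, of 0] by simp
        then show "\<bar>real N * deriv (P i) (real N)\<bar> \<le> C\<^sub>0 * \<bar>P i (real N)\<bar>"
          unfolding abs_divide using nz by (simp add: pos_divide_le_eq)
      qed
      have lower: "g * Z \<le> X"
        unfolding Xeq Z_def sum_distrib_left
      proof (rule sum_mono)
        fix i assume "i \<in> {1..m}"
        from mult_left_mono[OF ratio(1)[OF this], of "\<bar>\<theta> i\<bar>"]
        show "g * \<bar>\<theta> i * P i (real N)\<bar> \<le> \<bar>\<theta> i\<bar> * \<bar>real N * deriv (P i) (real N)\<bar>"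
          by (simp add: abs_mult mult_ac)
      qed
      have upper: "X \<le> C\<^sub>0 * Z"
        unfolding Xeq Z_def sum_distrib_left
      proof (rule sum_mono)
        fix i assume "i \<in> {1..m}"
        from mult_left_mono[OF ratio(2)[OF this], of "\<bar>\<theta> i\<bar>"]
        show "\<bar>\<theta> i\<bar> * \<bar>real N * deriv (P i) (real N)\<bar> \<le> C\<^sub>0 * \<bar>\<theta> i * P i (real N)\<bar>"
          by (simp add: abs_mult mult_ac)
      qed
      show ?thesis
      proof (rule bound1[OF R2(6) NT0 X_def])
        have "real R ^ E1 \<le> g * (real R * real R ^ E1)"
        proof -
          have "1 \<le> g * real R" using R2(5) g by (simp add: pos_divide_le_eq mult.commute)
          then have "1 * real R ^ E1 \<le> (g * real R) * real R ^ E1" by (intro mult_right_mono) auto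
          then show ?thesis by (simp add: mult_ac)
        qed
        also have "real R * real R ^ E1 \<le> real R ^ (E1 + 3 * EK + a + 21)"
          using power_increasing[of "Suc E1" "E1 + 3 * EK + a + 21" "real R"] R1 by simp
        also have "\<dots> \<le> Z" using A by (simp add: Z_def)
        finally have "real R ^ E1 \<le> g * Z" using g by simp
        then show "real R ^ E1 \<le> X" using lower by simp
        have "X \<le> C\<^sub>0 * real N powr (1/2)" by (rule order_trans[OF upper], rule mult_left_mono[OF True]) (use C0 in simp)
        also have "\<dots> \<le> real N powr (1/4) * real N powr (1/2)"
          using root[of 1] R2 by (intro mult_right_mono) auto
        also have "\<dots> = real N powr (real 1 - 1/4)" by (simp add: powr_add[symmetric])
        finally show "X \<le> real N powr (real 1 - 1/4)" .
        show "separated m (\<lambda>i. \<theta> i * (deriv ^^ 1) (P i) t)" if "real N / real R ^ a \<le> t" "t \<le> real N" for t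
          by (rule sep) (use that in auto)
      qed
    next
      case False
      define X where "X = real N ^ K * (\<Sum>i=1..m. \<bar>\<theta> i * (deriv ^^ K) (P i) (real N)\<bar>)"
      show ?thesis
      proof (rule boundK[OF R2(7) NT0 X_def])
        have "real R ^ EK \<le> real N powr (1/3)"
        proof -
          have "(real R ^ (3 * EK)) powr (1/3) \<le> real N powr (1/3)" using pow[of "3 * EK"] by (intro powr_mono2) auto
          moreover have "(real R ^ (3 * EK)) powr (1/3) = real R ^ EK" using R1 by (simp add: powr_realpow[symmetric] powr_powr)
          ultimately show ?thesis by simp
        qed
        also have "\<dots> \<le> real N powr (-1/16 + 1/2)" using N1 by (intro powr_mono) auto
        also have "\<dots> = real N powr (-1/16) * real N powr (1/2)" by (rule powr_add)
        also have "\<dots> \<le> real N powr (-1/16) * Z" using False by (intro mult_left_mono) auto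
        also have "\<dots> \<le> X"
          unfolding X_def Z_def sum_distrib_left
        proof (rule sum_mono)
          fix i assume "i \<in> {1..m}"
          from mult_left_mono[OF deriv_K_ge[OF this NT], of "\<bar>\<theta> i\<bar>"]
          show "real N powr (-1/16) * \<bar>\<theta> i * P i (real N)\<bar> \<le> real N ^ K * \<bar>\<theta> i * (deriv ^^ K) (P i) (real N)\<bar>"
            by (simp add: abs_mult mult_ac)
        qed
        finally show "real R ^ EK \<le> X" .
        have mR: "real m * (real R ^ 3 + 1) \<le> real R ^ 5"
        proof -
          have "1 \<le> real R ^ 3" using one_le_power[OF R1] .
          then have "real R ^ 3 + 1 \<le> 2 * real R ^ 3" by simp
          also have "\<dots> \<le> real R * real R ^ 3" using R2 by (intro mult_right_mono) auto
          finally have "real m * (real R ^ 3 + 1) \<le> real R * (real R * real R ^ 3)" using R2 by (intro mult_mono) auto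
          then show ?thesis by (simp add: eval_nat_numeral)
        qed
        have "X \<le> real N ^ K * (\<Sum>i=1..m. (real R ^ 3 + 1) * real N powr (-1/2))"
          unfolding X_def
        proof (intro mult_left_mono sum_mono)
          fix i assume i: "i \<in> {1..m}"
          show "\<bar>\<theta> i * (deriv ^^ K) (P i) (real N)\<bar> \<le> (real R ^ 3 + 1) * real N powr (-1/2)"
            unfolding abs_mult using \<theta>[OF i] deriv_K_le[OF i NT] by (intro mult_mono) auto
        qed simp
        also have "\<dots> = (real m * (real R ^ 3 + 1)) * (real N powr real K * real N powr (-1/2))"
          using N0 by (simp add: powr_realpow)
        also have "\<dots> \<le> real N powr (1/4) * (real N powr real K * real N powr (-1/2))"
          by (intro mult_right_mono order_trans[OF mR root]) auto
        also have "real N powr (1/4) * (real N powr real K * real N powr (-1/2)) = real N powr (real K - 1/4)"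
          by (simp add: powr_add[symmetric])
        finally show "X \<le> real N powr (real K - 1/4)" .
        show "separated m (\<lambda>i. \<theta> i * (deriv ^^ K) (P i) t)" if "real N / real R ^ a \<le> t" "t \<le> real N" for t
          by (rule sep) (use that in auto)
      qed
    qed
  qed
qed

end

section \<open>Counting jumps\<close>

lemma card_spaced_le:
  fixes x :: "nat \<Rightarrow> real"
  assumes S: "finite S" and h: "0 < h" and \<Lambda>: "0 \<le> \<Lambda>"
    and sub: "S \<subseteq> {..J}" and step: "\<And>j. j < J \<Longrightarrow> x j + h \<le> x (Suc j)"
    and diam: "\<And>i j. i \<in> S \<Longrightarrow> j \<in> S \<Longrightarrow> \<bar>x i - x j\<bar> \<le> \<Lambda>"
  shows "real (card S) \<le> \<Lambda> / h + 1"
proof (cases "S = {}")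
  case False
  define a b where "a = Min S" and "b = Max S"
  have ab: "a \<in> S" "b \<in> S" "S \<subseteq> {a..b}" using S False by (auto simp: a_def b_def)
  then have "a \<le> b" "b \<le> J" using sub by auto
  have "x a + h * real n \<le> x (a + n)" if "a + n \<le> J" for n
    using that
  proof (induction n)
    case (Suc n)
    then show ?case using step[of "a + n"] by (simp add: algebra_simps)
  qed simp
  from this[of "b - a"] \<open>a \<le> b\<close> \<open>b \<le> J\<close> have "h * (real b - real a) \<le> x b - x a" by (simp add: of_nat_diff)
  also have "\<dots> \<le> \<Lambda>" using diam[OF ab(2,1)] by simp
  finally have "real b - real a \<le> \<Lambda> / h" using h by (simp add: field_simps)
  moreover have "card S \<le> card {a..b}" using ab(3) by (intro card_mono) auto
  then have "real (card S) \<le> real b - real a + 1" using \<open>a \<le> b\<close> by (simp add: of_nat_diff)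
  ultimately show ?thesis by simp
qed (use h \<Lambda> in simp)

text \<open>Indices with \<open>N j\<close> in some \<open>U s\<close> are bad and are counted set
  by set. A jump between two indices that are not bad leads from \<open>A\<close> to its complement,
  and by \<open>persist\<close> this cannot happen twice.\<close>

lemma jumps_le:
  fixes N :: "nat \<Rightarrow> nat" and U :: "'s \<Rightarrow> nat set"
  assumes I: "finite I" and h: "0 < h" and \<Lambda>: "0 \<le> \<Lambda>"
    and step: "\<And>j. j < J \<Longrightarrow> ln (real (N j)) + h \<le> ln (real (N (Suc j)))"
    and mono: "\<And>i j. i \<le> j \<Longrightarrow> j \<le> J \<Longrightarrow> N i \<le> N j"
    and diam: "\<And>s i j. s \<in> I \<Longrightarrow> i \<le> J \<Longrightarrow> j \<le> J \<Longrightarrow> N i \<in> U s \<Longrightarrow> N j \<in> U s \<Longrightarrow>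
      \<bar>ln (real (N i)) - ln (real (N j))\<bar> \<le> \<Lambda>"
    and good: "\<And>j. j < J \<Longrightarrow> N j \<notin> (\<Union>s\<in>I. U s) \<Longrightarrow> N (Suc j) \<notin> (\<Union>s\<in>I. U s) \<Longrightarrow> A (N j) \<and> \<not> A (N (Suc j))"
    and persist: "\<And>M M'. M \<notin> (\<Union>s\<in>I. U s) \<Longrightarrow> M \<le> M' \<Longrightarrow> A M' \<Longrightarrow> A M"
  shows "real J \<le> 2 * (real (card I) * (\<Lambda> / h + 1)) + 1"
proof -
  define bad where "bad = {j. j \<le> J \<and> N j \<in> (\<Union>s\<in>I. U s)}"
  define T where "T = {j. j < J \<and> j \<notin> bad \<and> Suc j \<notin> bad}"
  have "bad = (\<Union>s\<in>I. {j. j \<le> J \<and> N j \<in> U s})" by (auto simp: bad_def)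
  then have "card bad \<le> (\<Sum>s\<in>I. card {j. j \<le> J \<and> N j \<in> U s})"
    using card_UN_le[OF I, of "\<lambda>s. {j. j \<le> J \<and> N j \<in> U s}"] by simp
  then have "real (card bad) \<le> (\<Sum>s\<in>I. real (card {j. j \<le> J \<and> N j \<in> U s}))"
    by (metis of_nat_le_iff of_nat_sum)
  also have "\<dots> \<le> (\<Sum>s\<in>I. \<Lambda> / h + 1)"
  proof (rule sum_mono)
    fix s assume s: "s \<in> I"
    show "real (card {j. j \<le> J \<and> N j \<in> U s}) \<le> \<Lambda> / h + 1"
      by (rule card_spaced_le[where x = "\<lambda>j. ln (real (N j))" and J = J]) (use h \<Lambda> step diam[OF s] in auto)
  qed
  finally have cb: "real (card bad) \<le> real (card I) * (\<Lambda> / h + 1)" by simp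
  have fin: "finite bad" "finite T" by (auto simp: bad_def T_def)
  have "i = j" if "i \<in> T" "j \<in> T" for i j
  proof -
    have *: "\<not> i < j" if "i \<in> T" "j \<in> T" for i j
    proof
      assume "i < j"
      have i: "i < J" "N (Suc i) \<notin> (\<Union>s\<in>I. U s)" "N i \<notin> (\<Union>s\<in>I. U s)"
        and j: "j < J" "N (Suc j) \<notin> (\<Union>s\<in>I. U s)" "N j \<notin> (\<Union>s\<in>I. U s)"
        using that by (auto simp: T_def bad_def)
      have "\<not> A (N (Suc i))" using good[OF i(1,3,2)] by simp
      moreover have "A (N j)" using good[OF j(1,3,2)] by simp
      moreover have "N (Suc i) \<le> N j" using \<open>i < j\<close> j(1) by (intro mono) auto
      ultimately show False using persist[OF i(2)] by blast
    qed
    show ?thesis using *[OF that] *[OF that(2,1)] by simp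
  qed
  then have cT: "card T \<le> 1" using fin by (metis card_le_Suc0_iff_eq One_nat_def)
  \<comment> \<open>A jump is spoiled by a bad left or a bad right end, hence the factor 2. At 0 the
    truncated difference returns an index that is already bad.\<close>
  have "{..<J} \<subseteq> bad \<union> (\<lambda>j. j - 1) ` bad \<union> T"
  proof
    fix j assume "j \<in> {..<J}"
    then show "j \<in> bad \<union> (\<lambda>j. j - 1) ` bad \<union> T"
      using image_eqI[of j "\<lambda>j. j - 1" "Suc j" bad] by (auto simp: T_def)
  qed
  then have "card {..<J} \<le> card (bad \<union> (\<lambda>j. j - 1) ` bad \<union> T)" using fin by (intro card_mono) auto
  also have "\<dots> \<le> card bad + card ((\<lambda>j. j - 1) ` bad) + card T"
    using card_Un_le[of "bad \<union> (\<lambda>j. j - 1) ` bad" T] card_Un_le[of bad "(\<lambda>j. j - 1) ` bad"] by simp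
  also have "card ((\<lambda>j. j - 1) ` bad) \<le> card bad" by (rule card_image_le) (rule fin)
  finally have "real J \<le> 2 * real (card bad) + 1" using cT by simp
  then show ?thesis using cb by simp
qed

text \<open>The new terms and the changed normalisation of the old ones contribute at most
  \<open>1 - N / M\<close> each.\<close>

lemma exp_avg_diff_le:
  assumes "1 \<le> N" "N \<le> M"
  shows "cmod (exp_avg m P \<xi> M - exp_avg m P \<xi> N) \<le> 2 * (1 - real N / real M)"
proof -
  define f where "f = (\<lambda>n. \<Sum>i=1..m. \<xi> i * of_int \<lfloor>P i (real n)\<rfloor>)"
  have avg: "exp_avg m P \<xi> n = of_real (1 / real n) * (\<Sum>k=1..n. e (f k))" for n
    by (simp add: exp_avg_def f_def)
  have "{1..M} = {1..N} \<union> {N<..M}" using assms by auto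
  then have split: "(\<Sum>n=1..M. e (f n)) = (\<Sum>n=1..N. e (f n)) + (\<Sum>n\<in>{N<..M}. e (f n))"
    by (simp only:) (subst sum.union_disjoint; auto)
  have NM: "0 < real N" "0 < real M" "real N \<le> real M" using assms by auto
  have "exp_avg m P \<xi> M - exp_avg m P \<xi> N =
    of_real (1 / real M) * (\<Sum>n\<in>{N<..M}. e (f n)) - of_real (1 / real N - 1 / real M) * (\<Sum>n=1..N. e (f n))"
    unfolding avg split by (simp add: algebra_simps)
  also have "cmod \<dots> \<le> (1 / real M) * real (card {N<..M}) + (1 / real N - 1 / real M) * real (card {1..N})"
  proof (rule order_trans[OF norm_triangle_ineq4 add_mono])
    show "cmod (of_real (1 / real M) * (\<Sum>n\<in>{N<..M}. e (f n))) \<le> (1 / real M) * real (card {N<..M})"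
      unfolding norm_mult norm_of_real using norm_sum_e_le[of f "{N<..M}"] by (intro mult_mono) auto
    have "1 / real M \<le> 1 / real N" using NM by (intro divide_left_mono) auto
    then show "cmod (of_real (1 / real N - 1 / real M) * (\<Sum>n=1..N. e (f n))) \<le> (1 / real N - 1 / real M) * real (card {1..N})"
      unfolding norm_mult norm_of_real using norm_sum_e_le[of f "{1..N}"] by (intro mult_mono) auto
  qed
  also have "\<dots> = 2 * (1 - real N / real M)"
    using NM by (simp add: of_nat_diff field_simps)
  finally show ?thesis .
qed

lemma norm_exp_avg_le: "1 \<le> N \<Longrightarrow> cmod (exp_avg m P \<xi> N) \<le> 1"
  using norm_sum_e_le[of "\<lambda>n. \<Sum>i=1..m. \<xi> i * of_int \<lfloor>P i (real n)\<rfloor>" "{1..N}"]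
  by (simp add: exp_avg_def norm_divide norm_mult)

text \<open>The floors are integers, so integral parts of the coefficients are invisible; this
  permits |\<xi> i| <= 1/2.\<close>

lemma exp_avg_round: "exp_avg m P \<xi> = exp_avg m P (\<lambda>i. \<xi> i - of_int (round (\<xi> i)))"
proof
  fix N
  have "e (\<Sum>i=1..m. \<xi> i * of_int \<lfloor>P i (real n)\<rfloor>) =
    e (\<Sum>i=1..m. (\<xi> i - of_int (round (\<xi> i))) * of_int \<lfloor>P i (real n)\<rfloor>)" for n
  proof -
    have "(\<Sum>i=1..m. \<xi> i * of_int \<lfloor>P i (real n)\<rfloor>) =
      (\<Sum>i=1..m. (\<xi> i - of_int (round (\<xi> i))) * of_int \<lfloor>P i (real n)\<rfloor>) + of_int (\<Sum>i=1..m. round (\<xi> i) * \<lfloor>P i (real n)\<rfloor>)"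
      by (simp add: sum.distrib[symmetric] algebra_simps)
    then show ?thesis by (simp only: e_plus_of_int)
  qed
  then show "exp_avg m P \<xi> N = exp_avg m P (\<lambda>i. \<xi> i - of_int (round (\<xi> i))) N"
    by (simp add: exp_avg_def)
qed

section \<open>Monotonicity and exceptional sets\<close>

context tame_family
begin

lemma abs_mono:
  assumes i: "i \<in> {1..m}" and st: "T\<^sub>0 \<le> s" "s \<le> t"
  shows "\<bar>P i s\<bar> \<le> \<bar>P i t\<bar>"
proof -
  have s0: "0 < s" using st T0 by simp
  have "(t / s) powr 0 * \<bar>P i s\<bar> \<le> \<bar>P i t\<bar>"
  proof (rule log_growth_ge[OF s0 st(2), where Q' = "deriv (P i)"])
    fix u assume u: "u \<in> {s..t}"
    then have uT: "T\<^sub>0 \<le> u" using st by simp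
    show "(P i has_real_derivative deriv (P i) u) (at u)" using has_deriv[OF i uT, of 0] by simp
    show "P i u \<noteq> 0" using nonzero[OF i uT, of 0] by simp
    show "0 \<le> u * deriv (P i) u / P i u" using log_deriv_ge[OF i uT] g by linarith
  qed
  then show ?thesis using s0 st by simp
qed

lemma abs_ge_1: "i \<in> {1..m} \<Longrightarrow> T\<^sub>0 \<le> t \<Longrightarrow> 1 \<le> \<bar>P i t\<bar>"
  using powr_le[of i t] ge_one_powr_ge_zero[of t g] T0 g by simp

text \<open>Nothing is known about \<open>P i\<close> below \<open>T\<^sub>0\<close>, but only
  finitely many values occur there, and they are absorbed since |P i N| >= 1. The same bound absorbs
  the rounding.\<close>

lemma floor_le:
  obtains B where "1 \<le> B" and
    "\<And>i n N. i \<in> {1..m} \<Longrightarrow> T\<^sub>0 \<le> real N \<Longrightarrow> n \<le> N \<Longrightarrow> \<bar>real_of_int \<lfloor>P i (real n)\<rfloor>\<bar> \<le> B * \<bar>P i (real N)\<bar>"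
proof -
  define S where "S = (\<Sum>i=1..m. \<Sum>n\<le>nat \<lceil>T\<^sub>0\<rceil>. \<bar>real_of_int \<lfloor>P i (real n)\<rfloor>\<bar>)"
  have S0: "0 \<le> S" by (simp add: S_def sum_nonneg)
  show thesis
  proof (rule that[of "S + 2"])
    show "1 \<le> S + 2" using S0 by simp
    fix i n N assume i: "i \<in> {1..m}" and N: "T\<^sub>0 \<le> real N" and n: "n \<le> N"
    have P1: "1 \<le> \<bar>P i (real N)\<bar>" by (rule abs_ge_1[OF i N])
    show "\<bar>real_of_int \<lfloor>P i (real n)\<rfloor>\<bar> \<le> (S + 2) * \<bar>P i (real N)\<bar>"
    proof (cases "T\<^sub>0 \<le> real n")
      case True
      have "\<bar>real_of_int \<lfloor>P i (real n)\<rfloor>\<bar> \<le> \<bar>P i (real n)\<bar> + 1" by linarith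
      also have "\<dots> \<le> 2 * \<bar>P i (real N)\<bar>" using abs_mono[OF i True, of "real N"] n P1 by simp
      also have "\<dots> \<le> (S + 2) * \<bar>P i (real N)\<bar>" using S0 by (intro mult_right_mono) auto
      finally show ?thesis .
    next
      case False
      then have "n \<le> nat \<lceil>T\<^sub>0\<rceil>" by linarith
      then have "\<bar>real_of_int \<lfloor>P i (real n)\<rfloor>\<bar> \<le> (\<Sum>n\<le>nat \<lceil>T\<^sub>0\<rceil>. \<bar>real_of_int \<lfloor>P i (real n)\<rfloor>\<bar>)"
        by (intro member_le_sum) auto
      also have "\<dots> \<le> S"
        unfolding S_def using i by (intro member_le_sum[where f = "\<lambda>i. \<Sum>n\<le>nat \<lceil>T\<^sub>0\<rceil>. \<bar>real_of_int \<lfloor>P i (real n)\<rfloor>\<bar>"]) (auto intro: sum_nonneg)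
      also have "\<dots> \<le> (S + 2) * 1" using S0 by simp
      also have "\<dots> \<le> (S + 2) * \<bar>P i (real N)\<bar>" using P1 S0 by (intro mult_left_mono) auto
      finally show ?thesis .
    qed
  qed
qed

text \<open>A whole range of \<open>t\<close> is inspected, not \<open>N\<close> alone, because the
  estimate of the exponential sums needs separation throughout that range. The condition on
  \<open>N\<close> keeps the range beyond \<open>T\<^sub>0\<close>.\<close>

definition crossing :: "nat \<Rightarrow> nat \<Rightarrow> nat \<Rightarrow> real \<Rightarrow> (real \<Rightarrow> real) \<Rightarrow> nat set" where
  "crossing F a R c G = {N. T\<^sub>0 * real R ^ a \<le> real N \<and>
     (\<exists>t. real N / real R ^ a \<le> t \<and> t \<le> real N \<and> 1 / real R ^ F \<le> \<bar>c * G t\<bar> \<and> \<bar>c * G t\<bar> \<le> real R ^ F)}"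

text \<open>As a function of ln t, ln |G| is monotone with rate at least \<open>g\<close>, so it
  crosses a window of length \<open>2 * F * ln R\<close> within \<open>2 * F / g * ln R\<close>.
  Each \<open>N\<close> exceeds its \<open>t\<close> by a factor between 1 and \<open>R ^ a\<close>,
  always in the same direction, hence only one summand \<open>a\<close>.\<close>

lemma crossing_diameter:
  assumes D: "\<And>t. T\<^sub>0 \<le> t \<Longrightarrow> (G has_real_derivative G' t) (at t)" and nz: "\<And>t. T\<^sub>0 \<le> t \<Longrightarrow> G t \<noteq> 0"
    and mono: "(\<forall>t\<ge>T\<^sub>0. g \<le> t * G' t / G t) \<or> (\<forall>t\<ge>T\<^sub>0. t * G' t / G t \<le> - g)"
    and R: "1 \<le> R" and N: "N1 \<in> crossing F a R c G" "N2 \<in> crossing F a R c G"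
  shows "\<bar>ln (real N1) - ln (real N2)\<bar> \<le> (2 * real F / g + real a) * ln (real R)"
proof -
  have R1: "1 \<le> real R" using R by simp
  have RF: "1 \<le> real R ^ F" "1 \<le> real R ^ a" by (intro one_le_power R1)+
  have lnR: "0 \<le> ln (real R)" using R1 by simp
  have diam: "ln t2 - ln t1 \<le> 2 * real F / g * ln (real R)"
    if t: "T\<^sub>0 \<le> t1" "t1 \<le> t2" and b: "1 / real R ^ F \<le> \<bar>c * G t1\<bar>" "\<bar>c * G t1\<bar> \<le> real R ^ F"
      "1 / real R ^ F \<le> \<bar>c * G t2\<bar>" "\<bar>c * G t2\<bar> \<le> real R ^ F" for t1 t2
  proof -
    have t0: "0 < t1" using t T0 by simp
    define u v w where "u = \<bar>c * G t1\<bar>" and "v = \<bar>c * G t2\<bar>" and "w = (t2 / t1) powr g"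
    have w0: "0 < w" using t t0 by (simp add: w_def)
    from mono have "w * \<bar>G t1\<bar> \<le> \<bar>G t2\<bar> \<or> w * \<bar>G t2\<bar> \<le> \<bar>G t1\<bar>"
    proof
      assume *: "\<forall>t\<ge>T\<^sub>0. g \<le> t * G' t / G t"
      have "w * \<bar>G t1\<bar> \<le> \<bar>G t2\<bar>"
        unfolding w_def by (rule log_growth_ge[OF t0 t(2), where Q' = G']) (use D nz * t in auto)
      then show ?thesis ..
    next
      assume *: "\<forall>t\<ge>T\<^sub>0. t * G' t / G t \<le> - g"
      have "\<bar>G t2\<bar> \<le> (t2 / t1) powr (- g) * \<bar>G t1\<bar>"
        by (rule log_growth_le[OF t0 t(2), where Q' = G']) (use D nz * t in auto)
      then have "w * \<bar>G t2\<bar> \<le> w * ((t2 / t1) powr (- g) * \<bar>G t1\<bar>)" using w0 by (intro mult_left_mono) auto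
      also have "\<dots> = \<bar>G t1\<bar>" using w0 by (simp add: w_def powr_minus)
      finally show ?thesis ..
    qed
    then have "w * u \<le> v \<or> w * v \<le> u"
      unfolding u_def v_def abs_mult
      using mult_left_mono[of "w * \<bar>G t1\<bar>" "\<bar>G t2\<bar>" "\<bar>c\<bar>"] mult_left_mono[of "w * \<bar>G t2\<bar>" "\<bar>G t1\<bar>" "\<bar>c\<bar>"]
      by (auto simp: mult_ac)
    moreover have "w * (1 / real R ^ F) \<le> w * u" "w * (1 / real R ^ F) \<le> w * v"
      using b w0 by (auto simp: u_def v_def intro!: mult_left_mono simp del: times_divide_eq_right)
    ultimately have "w * (1 / real R ^ F) \<le> real R ^ F" using b unfolding u_def v_def by linarith
    moreover have "0 < real R ^ F" using RF by linarith
    ultimately have "w \<le> real R ^ F * real R ^ F" by (simp add: pos_divide_le_eq)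
    then have "ln w \<le> ln (real R ^ F * real R ^ F)" using w0 by simp
    also have "\<dots> = 2 * real F * ln (real R)" using R1 by (simp add: ln_mult ln_realpow)
    also have "ln w = g * (ln t2 - ln t1)" using t t0 by (simp add: w_def ln_powr ln_div)
    finally show ?thesis using g by (simp add: field_simps)
  qed
  from N(1) obtain t1 where t1: "T\<^sub>0 * real R ^ a \<le> real N1" "real N1 / real R ^ a \<le> t1" "t1 \<le> real N1"
    "1 / real R ^ F \<le> \<bar>c * G t1\<bar>" "\<bar>c * G t1\<bar> \<le> real R ^ F" by (auto simp: crossing_def)
  from N(2) obtain t2 where t2: "T\<^sub>0 * real R ^ a \<le> real N2" "real N2 / real R ^ a \<le> t2" "t2 \<le> real N2"
    "1 / real R ^ F \<le> \<bar>c * G t2\<bar>" "\<bar>c * G t2\<bar> \<le> real R ^ F" by (auto simp: crossing_def)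
  have Ra: "0 < real R ^ a" using RF by linarith
  have close: "T\<^sub>0 \<le> t \<and> ln t \<le> ln (real N) \<and> ln (real N) \<le> ln t + real a * ln (real R)"
    if "T\<^sub>0 * real R ^ a \<le> real N" "real N / real R ^ a \<le> t" "t \<le> real N" for t N
  proof -
    have "T\<^sub>0 \<le> real N / real R ^ a" using that(1) by (simp add: pos_le_divide_eq[OF Ra])
    then have tT: "T\<^sub>0 \<le> t" using that by simp
    then have t0: "0 < t" using T0 by simp
    have "real N \<le> t * real R ^ a" using that(2) by (simp add: pos_divide_le_eq[OF Ra])
    then have "ln (real N) \<le> ln (t * real R ^ a)" using t0 that(3) by simp
    also have "\<dots> = ln t + real a * ln (real R)" using t0 R1 by (simp add: ln_mult ln_realpow)
    finally show ?thesis using tT t0 that(3) by simp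
  qed
  note c1 = close[OF t1(1-3)] and c2 = close[OF t2(1-3)]
  have "\<bar>ln t1 - ln t2\<bar> \<le> 2 * real F / g * ln (real R)"
  proof (cases "t1 \<le> t2")
    case True
    moreover have "ln t1 \<le> ln t2" using True c1 T0 by simp
    ultimately show ?thesis using diam[of t1 t2] c1 t1 t2 by simp
  next
    case False
    moreover have "ln t2 \<le> ln t1" using False c2 T0 by simp
    ultimately show ?thesis using diam[of t2 t1] c2 t1 t2 by simp
  qed
  then show ?thesis using c1 c2 by (simp add: distrib_right abs_le_iff)
qed

text \<open>With \<open>s = 2, 3, 4\<close>, the terms of index \<open>i\<close> and \<open>j\<close> in the \<open>k\<close>-th derivative become comparable when,
  respectively, none, the second or both of \<open>\<xi>\<^sub>i, \<xi>\<^sub>j\<close> have been shifted by a nonzero integer; a shifted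
  coefficient has size between \<open>1/2\<close> and \<open>R\<^sup>3 + 1\<close>, which is absorbed by the margin \<open>R\<^sup>F\<close>. For \<open>\<xi>\<^sub>j = 0\<close> the
  quotient \<open>\<xi>\<^sub>i / \<xi>\<^sub>j = 0\<close> gives the empty set.\<close>

definition exceptional :: "nat \<Rightarrow> nat \<Rightarrow> nat \<Rightarrow> (nat \<Rightarrow> real) \<Rightarrow> nat \<times> nat \<times> nat \<times> nat \<Rightarrow> nat set" where
  "exceptional F a R \<xi> = (\<lambda>(s, i, j, k).
     let Q = (\<lambda>t. (deriv ^^ k) (P i) t / (deriv ^^ k) (P j) t) in
     if s = 0 then {N. 1 \<le> N \<and> real N < real R ^ F}
     else if s = 1 then crossing F a R (\<xi> i) (P i)
     else if i = j then {}
     else if s = 2 then crossing F a R (\<xi> i / \<xi> j) Q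
     else if s = 3 then crossing F a R (\<xi> i) Q
     else crossing F a R 1 Q)"

definition exceptional_index :: "(nat \<times> nat \<times> nat \<times> nat) set" where
  "exceptional_index = {0..4} \<times> {1..m} \<times> {1..m} \<times> {1, K}"

text \<open>The logarithmic derivative of a quotient is the difference of the logarithmic
  derivatives, which \<open>gap\<close> keeps away from 0 with a fixed sign. The last summand
  \<open>F\<close> covers the range \<open>N < R ^ F\<close>.\<close>

lemma exceptional_diameter:
  assumes s: "s \<in> exceptional_index" and R: "1 \<le> R"
    and N: "N1 \<in> exceptional F a R \<xi> s" "N2 \<in> exceptional F a R \<xi> s"
  shows "\<bar>ln (real N1) - ln (real N2)\<bar> \<le> (2 * real F / g + real a + real F) * ln (real R)"
proof -
  obtain c i j k where ijk: "s = (c, i, j, k)" "i \<in> {1..m}" "j \<in> {1..m}" "k \<in> {1, K}"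
    using s by (auto simp: exceptional_index_def)
  have kK: "k \<le> K" using ijk(4) K by auto
  have lnR: "0 \<le> ln (real R)" using R by simp
  have weaken: "x \<le> (2 * real F / g + real a + real F) * ln (real R)" if "x \<le> (2 * real F / g + real a) * ln (real R)" for x
    using that lnR by (simp add: distrib_right add_increasing2)
  define Q where "Q = (\<lambda>t. (deriv ^^ k) (P i) t / (deriv ^^ k) (P j) t)"
  have cross: "\<bar>ln (real N1) - ln (real N2)\<bar> \<le> (2 * real F / g + real a) * ln (real R)"
    if "i \<noteq> j" "N1 \<in> crossing F a R x Q" "N2 \<in> crossing F a R x Q" for x
  proof -
    define A B where "A = (\<lambda>t. (deriv ^^ k) (P i) t)" and "B = (\<lambda>t. (deriv ^^ k) (P j) t)"
    define A' B' where "A' = (\<lambda>t. (deriv ^^ Suc k) (P i) t)" and "B' = (\<lambda>t. (deriv ^^ Suc k) (P j) t)"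
    have nzA: "A t \<noteq> 0" and nzB: "B t \<noteq> 0" if "T\<^sub>0 \<le> t" for t
      using nonzero[OF ijk(2) that, of k] nonzero[OF ijk(3) that, of k] kK by (auto simp: A_def B_def)
    have DA: "(A has_real_derivative A' t) (at t)" and DB: "(B has_real_derivative B' t) (at t)" if "T\<^sub>0 \<le> t" for t
      using has_deriv[OF ijk(2) that, of k] has_deriv[OF ijk(3) that, of k] kK
      by (auto simp: A_def B_def A'_def B'_def simp del: funpow.simps)
    have Q: "Q = (\<lambda>t. A t / B t)" by (simp add: Q_def A_def B_def)
    define Q' where "Q' = (\<lambda>t. (A' t * B t - A t * B' t) / (B t * B t))"
    have log: "t * Q' t / Q t = t * A' t / A t - t * B' t / B t" if "T\<^sub>0 \<le> t" for t
      using nzA[OF that] nzB[OF that] by (simp add: Q Q'_def field_simps)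
    have gap': "(\<forall>t\<ge>T\<^sub>0. g \<le> t * A' t / A t - t * B' t / B t) \<or> (\<forall>t\<ge>T\<^sub>0. g \<le> t * B' t / B t - t * A' t / A t)"
      using gap[OF ijk(2,3) that(1) kK] by (simp only: A_def B_def A'_def B'_def)
    show ?thesis
    proof (rule crossing_diameter[where G' = Q', OF _ _ _ R that(2,3)])
      show "(Q has_real_derivative Q' t) (at t)" if "T\<^sub>0 \<le> t" for t
        unfolding Q Q'_def by (rule DERIV_divide[OF DA[OF that] DB[OF that] nzB[OF that]])
      show "Q t \<noteq> 0" if "T\<^sub>0 \<le> t" for t using nzA[OF that] nzB[OF that] by (simp add: Q)
      from gap' show "(\<forall>t\<ge>T\<^sub>0. g \<le> t * Q' t / Q t) \<or> (\<forall>t\<ge>T\<^sub>0. t * Q' t / Q t \<le> - g)"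
      proof
        assume "\<forall>t\<ge>T\<^sub>0. g \<le> t * A' t / A t - t * B' t / B t"
        then have "\<forall>t\<ge>T\<^sub>0. g \<le> t * Q' t / Q t" using log by auto
        then show ?thesis ..
      next
        assume *: "\<forall>t\<ge>T\<^sub>0. g \<le> t * B' t / B t - t * A' t / A t"
        have "t * Q' t / Q t \<le> - g" if "T\<^sub>0 \<le> t" for t
          unfolding log[OF that] using *[rule_format, OF that] by linarith
        then show ?thesis by blast
      qed
    qed
  qed
  consider "c = 0" | "c = 1" | "c \<noteq> 0" "c \<noteq> 1" "i \<noteq> j"
    using N(1) by (auto simp: exceptional_def ijk(1) Let_def split: if_splits)
  then show ?thesis
  proof cases
    case 1
    then have N': "1 \<le> N1" "real N1 \<le> real R ^ F" "1 \<le> N2" "real N2 \<le> real R ^ F"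
      using N by (auto simp: exceptional_def ijk(1))
    have "0 \<le> ln (real n) \<and> ln (real n) \<le> real F * ln (real R)" if "1 \<le> n" "real n \<le> real R ^ F" for n
    proof -
      have "ln (real n) \<le> ln (real R ^ F)" using that R by (subst ln_le_cancel_iff) auto
      then show ?thesis using that R by (simp add: ln_realpow)
    qed
    from this[OF N'(1,2)] this[OF N'(3,4)]
    have "\<bar>ln (real N1) - ln (real N2)\<bar> \<le> real F * ln (real R)" by linarith
    also have "\<dots> \<le> (2 * real F / g + real a + real F) * ln (real R)"
      using lnR g by (intro mult_right_mono) auto
    finally show ?thesis .
  next
    case 2
    then have N': "N1 \<in> crossing F a R (\<xi> i) (P i)" "N2 \<in> crossing F a R (\<xi> i) (P i)"
      using N by (auto simp: exceptional_def ijk(1))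
    show ?thesis
    proof (rule weaken, rule crossing_diameter[where G' = "deriv (P i)", OF _ _ _ R N'])
      show "(P i has_real_derivative deriv (P i) t) (at t)" if "T\<^sub>0 \<le> t" for t
        using has_deriv[OF ijk(2) that, of 0] by simp
      show "P i t \<noteq> 0" if "T\<^sub>0 \<le> t" for t using nonzero[OF ijk(2) that, of 0] by simp
      show "(\<forall>t\<ge>T\<^sub>0. g \<le> t * deriv (P i) t / P i t) \<or> (\<forall>t\<ge>T\<^sub>0. t * deriv (P i) t / P i t \<le> - g)"
        using log_deriv_ge[OF ijk(2)] by blast
    qed
  next
    case 3
    then obtain x where "N1 \<in> crossing F a R x Q" "N2 \<in> crossing F a R x Q"
      using N by (auto simp: exceptional_def ijk(1) Q_def Let_def split: if_splits)
    then show ?thesis using weaken cross 3 by blast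
  qed
qed

end

text \<open>Because \<open>M * L \<le> B\<close>, the factor \<open>w\<close> cannot bring a ratio
  \<open>z\<close> from outside the window from \<open>1 / B\<close> to \<open>B\<close> to a size
  strictly between \<open>1 / M\<close> and \<open>M\<close>.\<close>

lemma dominance_of_ratio:
  fixes x y :: real
  assumes eq: "x = w * z * y" and y: "0 \<le> y" and z: "z < 1 / B \<or> B < z" "0 \<le> z"
    and w: "1 / L \<le> w" "w \<le> L" and L: "0 < L" "M * L \<le> B" and M: "0 < M"
  shows "M * x \<le> y \<or> M * y \<le> x"
proof -
  have B: "0 < B" using L M by (meson less_le_trans mult_pos_pos)
  have w0: "0 < w" using w(1) L(1) by (meson divide_pos_pos less_le_trans zero_less_one)
  from z(1) show ?thesis
  proof
    assume "z < 1 / B"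
    then have "M * (w * z) \<le> M * (L * (1 / B))" using w w0 z M by (intro mult_left_mono mult_mono) auto
    also have "\<dots> \<le> 1" using L B by simp
    finally have "M * (w * z) * y \<le> 1 * y" using y by (intro mult_right_mono) auto
    then show ?thesis unfolding eq by (simp add: mult_ac)
  next
    assume "B < z"
    have "M \<le> 1 / L * B" using L by (simp add: field_simps)
    also have "\<dots> \<le> w * z" using w w0 B \<open>B < z\<close> by (intro mult_mono) auto
    finally have "M * y \<le> w * z * y" using y by (intro mult_right_mono) auto
    then show ?thesis unfolding eq by simp
  qed
qed

section \<open>The two regimes off the exceptional sets\<close>

context tame_family
begin

text \<open>For each pair the quotient of the coefficients is split in modulus as
  \<open>w * c\<close>, where \<open>c\<close> is one of the constants in \<open>exceptional\<close>
  and \<open>w\<close> lies between \<open>1 / L\<close> and \<open>L\<close>. A shifted coefficient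
  can go into \<open>w\<close>, being bounded from both sides; an unshifted one may be arbitrarily
  small and has to stay in \<open>c\<close>.\<close>

lemma nonexceptional_separated:
  assumes N: "N \<notin> (\<Union>s\<in>exceptional_index. exceptional F a R \<xi> s)" and TN: "T\<^sub>0 * real R ^ a \<le> real N"
    and R: "1 \<le> R" and F: "4 * real m * (real R ^ 3 + 1) \<le> real R ^ F"
    and \<xi>: "\<And>i. i \<in> {1..m} \<Longrightarrow> \<bar>\<xi> i\<bar> \<le> 1/2" and h: "\<And>i. i \<in> {1..m} \<Longrightarrow> \<bar>h i\<bar> < int (R ^ 3)"
    and k: "k \<in> {1, K}" and t: "real N / real R ^ a \<le> t" "t \<le> real N"
  shows "separated m (\<lambda>i. (\<xi> i + of_int (h i)) * (deriv ^^ k) (P i) t)"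
proof -
  define \<theta> where "\<theta> = (\<lambda>i. \<xi> i + of_int (h i))"
  define Q where "Q = (\<lambda>i. (deriv ^^ k) (P i) t)"
  define L where "L = 2 * (real R ^ 3 + 1)"
  have R1: "1 \<le> real R" using R by simp
  have R3: "1 \<le> real R ^ 3" by (rule one_le_power[OF R1])
  have L: "0 < L" "2 * real m * L \<le> real R ^ F" "1 \<le> L" "1 / L \<le> 1" using R3 F by (auto simp: L_def algebra_simps)
  have kK: "k \<le> K" using k K by auto
  have Ra: "0 < real R ^ a" using R1 by simp
  have tT: "T\<^sub>0 \<le> t" using TN t(1) pos_le_divide_eq[OF Ra, of T\<^sub>0 "real N"] by linarith
  have Q0: "Q i \<noteq> 0" if "i \<in> {1..m}" for i using nonzero[OF that tT, of k] kK by (simp add: Q_def)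
  have out: "\<bar>c * (Q i / Q j)\<bar> < 1 / real R ^ F \<or> real R ^ F < \<bar>c * (Q i / Q j)\<bar>"
    if ij: "i \<in> {1..m}" "j \<in> {1..m}" "i \<noteq> j" and c: "c = \<xi> i / \<xi> j \<or> c = \<xi> i \<or> c = 1" for i j c
  proof -
    obtain s where s: "s \<in> {2, 3, 4::nat}" "(s = 2 \<longrightarrow> c = \<xi> i / \<xi> j) \<and> (s = 3 \<longrightarrow> c = \<xi> i) \<and> (s = 4 \<longrightarrow> c = 1)"
      using c by force
    then have "(s, i, j, k) \<in> exceptional_index" using ij k by (auto simp: exceptional_index_def)
    then have "N \<notin> exceptional F a R \<xi> (s, i, j, k)" using N by blast
    moreover have "exceptional F a R \<xi> (s, i, j, k) = crossing F a R c (\<lambda>t. (deriv ^^ k) (P i) t / (deriv ^^ k) (P j) t)"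
      using s ij(3) by (auto simp: exceptional_def Let_def)
    ultimately have "N \<notin> crossing F a R c (\<lambda>t. (deriv ^^ k) (P i) t / (deriv ^^ k) (P j) t)" by simp
    then show ?thesis using TN t unfolding crossing_def Q_def by force
  qed
  have \<theta>_le: "\<bar>\<theta> i\<bar> \<le> real R ^ 3 + 1" if "i \<in> {1..m}" for i
  proof -
    have "\<bar>real_of_int (h i)\<bar> \<le> real R ^ 3" using h[OF that] by (metis less_imp_le of_int_abs of_int_le_iff of_int_of_nat_eq of_nat_power)
    then show ?thesis using \<xi>[OF that] unfolding \<theta>_def by linarith
  qed
  have \<theta>_ge: "1/2 \<le> \<bar>\<theta> i\<bar>" if "i \<in> {1..m}" "h i \<noteq> 0" for i
  proof -
    have "1 \<le> \<bar>h i\<bar>" using that by linarith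
    then have "1 \<le> \<bar>real_of_int (h i)\<bar>" by (metis of_int_1_le_iff of_int_abs)
    then show ?thesis using \<xi>[OF that(1)] unfolding \<theta>_def by linarith
  qed
  have ratio: "2 * real m * \<bar>\<theta> i * Q i\<bar> \<le> \<bar>\<theta> j * Q j\<bar> \<or> 2 * real m * \<bar>\<theta> j * Q j\<bar> \<le> \<bar>\<theta> i * Q i\<bar>"
    if ij: "i \<in> {1..m}" "j \<in> {1..m}" "i \<noteq> j" and c: "c = \<xi> i / \<xi> j \<or> c = \<xi> i \<or> c = 1"
      and w: "\<bar>\<theta> i\<bar> = w * \<bar>c\<bar> * \<bar>\<theta> j\<bar>" "1 / L \<le> w" "w \<le> L" for i j c w
  proof (rule dominance_of_ratio[where B = "real R ^ F" and L = L])
    show "\<bar>\<theta> i * Q i\<bar> = w * \<bar>c * (Q i / Q j)\<bar> * \<bar>\<theta> j * Q j\<bar>"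
      using w(1) Q0[OF ij(2)] by (simp add: abs_mult abs_divide)
  qed (use out[OF ij c] w L m in auto)
  \<comment> \<open>Only the pair of a shifted first and an unshifted second coefficient is missing;
    it follows by exchanging the indices.\<close>
  have half: "2 * real m * \<bar>\<theta> i * Q i\<bar> \<le> \<bar>\<theta> j * Q j\<bar> \<or> 2 * real m * \<bar>\<theta> j * Q j\<bar> \<le> \<bar>\<theta> i * Q i\<bar>"
    if ij: "i \<in> {1..m}" "j \<in> {1..m}" "i \<noteq> j" and hij: "h i = 0 \<or> h j \<noteq> 0" for i j
  proof (cases "\<theta> i = 0 \<or> \<theta> j = 0")
    case True then show ?thesis by auto
  next
    case nz: False
    have pos: "0 < \<bar>\<theta> j\<bar>" "0 < \<bar>\<theta> i\<bar>" using nz by auto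
    consider "h i = 0" "h j = 0" | "h i = 0" "h j \<noteq> 0" | "h i \<noteq> 0" "h j \<noteq> 0" using hij by blast
    then show ?thesis
    proof cases
      case 1
      then have "\<theta> i = \<xi> i" "\<theta> j = \<xi> j" by (auto simp: \<theta>_def)
      then show ?thesis using nz L by (intro ratio[OF ij, of "\<xi> i / \<xi> j" 1]) (auto simp: abs_divide)
    next
      case 2
      then have eq: "\<theta> i = \<xi> i" by (simp add: \<theta>_def)
      show ?thesis
      proof (rule ratio[OF ij, of "\<xi> i" "1 / \<bar>\<theta> j\<bar>"])
        have "\<bar>\<theta> j\<bar> \<le> L" using \<theta>_le[OF ij(2)] R3 by (simp add: L_def)
        then show "1 / L \<le> 1 / \<bar>\<theta> j\<bar>" using pos by (intro divide_left_mono) (auto intro!: mult_pos_pos L(1))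
        have "1 / \<bar>\<theta> j\<bar> \<le> 1 / (1/2)" using \<theta>_ge[OF ij(2) 2(2)] by (intro divide_left_mono) auto
        also have "\<dots> \<le> L" using R3 by (simp add: L_def)
        finally show "1 / \<bar>\<theta> j\<bar> \<le> L" .
      qed (use nz eq in auto)
    next
      case 3
      note ge = \<theta>_ge[OF ij(1) 3(1)] \<theta>_ge[OF ij(2) 3(2)]
      show ?thesis
      proof (rule ratio[OF ij, of 1 "\<bar>\<theta> i\<bar> / \<bar>\<theta> j\<bar>"])
        have "\<bar>\<theta> j\<bar> \<le> L * (1/2)" using \<theta>_le[OF ij(2)] by (simp add: L_def)
        also have "\<dots> \<le> L * \<bar>\<theta> i\<bar>" using ge L by (intro mult_left_mono) auto
        finally show "1 / L \<le> \<bar>\<theta> i\<bar> / \<bar>\<theta> j\<bar>" using L pos by (simp add: field_simps)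
        have "\<bar>\<theta> i\<bar> \<le> L * (1/2)" using \<theta>_le[OF ij(1)] by (simp add: L_def)
        also have "\<dots> \<le> L * \<bar>\<theta> j\<bar>" using ge L by (intro mult_left_mono) auto
        finally show "\<bar>\<theta> i\<bar> / \<bar>\<theta> j\<bar> \<le> L" using pos by (simp add: pos_divide_le_eq)
      qed (use nz in auto)
    qed
  qed
  have "2 * real m * \<bar>\<theta> i * Q i\<bar> \<le> \<bar>\<theta> j * Q j\<bar> \<or> 2 * real m * \<bar>\<theta> j * Q j\<bar> \<le> \<bar>\<theta> i * Q i\<bar>"
    if ij: "i \<in> {1..m}" "j \<in> {1..m}" "i \<noteq> j" for i j
  proof (cases "h i = 0 \<or> h j \<noteq> 0")
    case True
    then show ?thesis by (rule half[OF ij])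
  next
    case False
    then show ?thesis using half[OF ij(2,1)] ij(3) by auto
  qed
  then show ?thesis unfolding separated_def \<theta>_def Q_def by blast
qed

text \<open>A phase that is not tiny is huge, since \<open>N\<close> avoids the crossing sets of the
  \<open>P i\<close>. After an integer shift \<open>h\<close> some phase is still at least
  \<open>R ^ E\<close>: the huge one if \<open>h\<close> vanishes, and otherwise one with a shifted
  coefficient, which is at least 1/2 while \<open>P i\<close> itself is large.\<close>

lemma dichotomy:
  obtains M :: real and F a R\<^sub>0 :: nat where "1 \<le> M" "1 \<le> R\<^sub>0" "1 \<le> F" and
    "\<And>R \<xi> N. R\<^sub>0 \<le> R \<Longrightarrow> (\<And>i. i \<in> {1..m} \<Longrightarrow> \<bar>\<xi> i\<bar> \<le> 1/2) \<Longrightarrow> 1 \<le> N \<Longrightarrow>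
      N \<notin> (\<Union>s\<in>exceptional_index. exceptional F a R \<xi> s) \<Longrightarrow>
      T\<^sub>0 \<le> real N \<and>
      (if \<forall>i\<in>{1..m}. \<bar>\<xi> i * P i (real N)\<bar> < 1 / real R ^ F then cmod (exp_avg m P \<xi> N - 1) \<le> M / real R
       else cmod (exp_avg m P \<xi> N) \<le> M / real R \<and> (\<exists>i\<in>{1..m}. real R ^ F < \<bar>\<xi> i * P i (real N)\<bar>))"
proof -
  \<comment> \<open>Expanding the \<open>m\<close> Fejer polynomials costs
    \<open>(R ^ 3) ^ m\<close>; the further power of \<open>R\<close> is the gain.\<close>
  define a where "a = 3 * m + 1"
  obtain E R1 where R1: "1 \<le> R1" and bound: "\<And>R N \<theta>. R1 \<le> R \<Longrightarrow> real R ^ E \<le> real N \<Longrightarrow>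
      (\<And>i. i \<in> {1..m} \<Longrightarrow> \<bar>\<theta> i\<bar> \<le> real R ^ 3 + 1) \<Longrightarrow>
      real R ^ E \<le> (\<Sum>i=1..m. \<bar>\<theta> i * P i (real N)\<bar>) \<Longrightarrow>
      (\<And>k t. k \<in> {1, K} \<Longrightarrow> real N / real R ^ a \<le> t \<Longrightarrow> t \<le> real N \<Longrightarrow>
         separated m (\<lambda>i. \<theta> i * (deriv ^^ k) (P i) t)) \<Longrightarrow>
      cmod (\<Sum>n=1..N. e (\<Sum>i=1..m. \<theta> i * P i (real n))) \<le> 3 * real N / real R ^ a"
  proof (rule exp_sum_bound[of a], goal_cases)
    case (1 E R)
    show ?case by (rule that[OF 1(2)], rule 1(3)) blast+
  qed
  obtain B where B: "1 \<le> B" "\<And>i n N. i \<in> {1..m} \<Longrightarrow> T\<^sub>0 \<le> real N \<Longrightarrow> n \<le> N \<Longrightarrow>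
      \<bar>real_of_int \<lfloor>P i (real n)\<rfloor>\<bar> \<le> B * \<bar>P i (real N)\<bar>"
    by (rule floor_le) blast
  \<comment> \<open>Ensures \<open>N powr g \<ge> 2 * R ^ E\<close> for
    \<open>N \<ge> R ^ G\<close>, so that even a coefficient 1/2 yields a phase of size
    \<open>R ^ E\<close>.\<close>
  define G where "G = nat \<lceil>(real E + 1) / g\<rceil>"
  have "(real E + 1) / g \<le> real G" unfolding G_def by (rule of_nat_ceiling)
  then have G: "real E + 1 \<le> real G * g" using g by (simp add: pos_divide_le_eq)
  \<comment> \<open>Besides \<open>E\<close>, \<open>a\<close> and \<open>G\<close>, the 6 leaves
    room for one power more than \<open>R ^ a\<close> and for the \<open>R ^ 5\<close> in the
    separation margin.\<close>
  define F where "F = E + a + G + 6"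
  define R0 where "R0 = R1 + nat \<lceil>T\<^sub>0\<rceil> + 4 * m + 4"
  \<comment> \<open>371 is 347 + 8 * 3, from \<open>norm_floor_sum_le\<close> with the relative
    error \<open>3 / R ^ a\<close>. The last term bounds the first regime, with 7 in place of 2
    pi.\<close>
  define M where "M = 3 + 371 * real m + 7 * (real m * B)"
  have mB: "1 \<le> real m * B" using mult_mono[of 1 "real m" 1 B] m B by simp
  show thesis
  proof (rule that[of M R0 F a])
    show "1 \<le> M" using mB by (simp add: M_def)
    show "1 \<le> R0" "1 \<le> F" by (auto simp: R0_def F_def)
    fix R \<xi> N
    assume R: "R0 \<le> R" and \<xi>: "\<And>i. i \<in> {1..m} \<Longrightarrow> \<bar>\<xi> i\<bar> \<le> 1/2" and N: "1 \<le> N"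
      and good: "N \<notin> (\<Union>s\<in>exceptional_index. exceptional F a R \<xi> s)"
    have RR: "R1 \<le> R" "T\<^sub>0 \<le> real R" "4 * real m \<le> real R" "4 \<le> real R"
      using R unfolding R0_def by linarith+
    have Rge1: "1 \<le> real R" "1 \<le> R" using RR by auto
    have R0: "0 < real R" using Rge1 by simp
    have "(0, 1, 1, 1) \<in> exceptional_index" using m by (simp add: exceptional_index_def)
    then have "N \<notin> exceptional F a R \<xi> (0, 1, 1, 1)" using good by blast
    then have NF: "real R ^ F \<le> real N" using N by (simp add: exceptional_def)
    have pow: "real R ^ j \<le> real N" if "j \<le> F" for j
      using power_increasing[OF that Rge1(1)] NF by linarith
    have TN: "T\<^sub>0 * real R ^ a \<le> real N"
    proof -
      have "T\<^sub>0 * real R ^ a \<le> real R ^ Suc a" using RR by (simp add: mult_right_mono)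
      also have "\<dots> \<le> real N" by (rule pow) (simp add: F_def)
      finally show ?thesis .
    qed
    have Ra1: "1 \<le> real R ^ a" by (rule one_le_power[OF Rge1(1)])
    have "T\<^sub>0 * 1 \<le> T\<^sub>0 * real R ^ a" using Ra1 T0 by (intro mult_left_mono) auto
    then have NT: "T\<^sub>0 \<le> real N" using TN by linarith
    have N0: "0 < real N" using N by simp
    have big: "4 * real m * (real R ^ 3 + 1) \<le> real R ^ F"
    proof -
      have "1 \<le> real R ^ 3" by (rule one_le_power[OF Rge1(1)])
      then have "real R ^ 3 + 1 \<le> 2 * real R ^ 3" by simp
      also have "\<dots> \<le> real R * real R ^ 3" using RR by (intro mult_right_mono) auto
      finally have "4 * real m * (real R ^ 3 + 1) \<le> real R * (real R * real R ^ 3)" using RR by (intro mult_mono) auto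
      also have "\<dots> = real R ^ 5" by (simp add: eval_nat_numeral)
      also have "\<dots> \<le> real R ^ F" by (rule power_increasing[OF _ Rge1(1)]) (simp add: F_def)
      finally show ?thesis .
    qed
    have RaE: "real R ^ E \<le> real R ^ F" by (rule power_increasing[OF _ Rge1(1)]) (simp add: F_def)
    have Pbig: "2 * real R ^ E \<le> \<bar>P i (real N)\<bar>" if "i \<in> {1..m}" for i
    proof -
      have "2 * real R ^ E \<le> real R powr (real E + 1)"
        using RR R0 by (simp add: powr_add powr_realpow)
      also have "\<dots> \<le> real R powr (real G * g)" using G Rge1 by (intro powr_mono) auto
      also have "\<dots> = (real R ^ G) powr g" using R0 by (simp add: powr_realpow[symmetric] powr_powr)
      also have "\<dots> \<le> real N powr g" using pow[of G] g R0 by (intro powr_mono2) (auto simp: F_def)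
      also have "\<dots> \<le> \<bar>P i (real N)\<bar>" by (rule powr_le[OF that NT])
      finally show ?thesis .
    qed
    have avg: "exp_avg m P \<xi> N = of_real (1 / real N) * (\<Sum>n=1..N. e (\<Sum>i=1..m. \<xi> i * of_int \<lfloor>P i (real n)\<rfloor>))"
      by (simp add: exp_avg_def)
    have out: "\<bar>\<xi> i * P i (real N)\<bar> < 1 / real R ^ F \<or> real R ^ F < \<bar>\<xi> i * P i (real N)\<bar>" if i: "i \<in> {1..m}" for i
    proof -
      have "(1, i, 1, 1) \<in> exceptional_index" using m i by (simp add: exceptional_index_def)
      then have "N \<notin> exceptional F a R \<xi> (1, i, 1, 1)" using good by blast
      then have "N \<notin> crossing F a R (\<xi> i) (P i)" by (simp add: exceptional_def)
      moreover have "real N / real R ^ a \<le> real N"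
        using divide_left_mono[OF Ra1, of "real N"] Rge1 by simp
      ultimately show ?thesis using TN unfolding crossing_def by force
    qed
    show "T\<^sub>0 \<le> real N \<and>
      (if \<forall>i\<in>{1..m}. \<bar>\<xi> i * P i (real N)\<bar> < 1 / real R ^ F then cmod (exp_avg m P \<xi> N - 1) \<le> M / real R
       else cmod (exp_avg m P \<xi> N) \<le> M / real R \<and> (\<exists>i\<in>{1..m}. real R ^ F < \<bar>\<xi> i * P i (real N)\<bar>))"
    proof (cases "\<forall>i\<in>{1..m}. \<bar>\<xi> i * P i (real N)\<bar> < 1 / real R ^ F")
      case True
      define f where "f = (\<lambda>n. \<Sum>i=1..m. \<xi> i * of_int \<lfloor>P i (real n)\<rfloor>)"
      have f: "\<bar>f n\<bar> \<le> real m * B / real R" if n: "n \<in> {1..N}" for n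
      proof -
        have "\<bar>f n\<bar> \<le> (\<Sum>i=1..m. \<bar>\<xi> i * of_int \<lfloor>P i (real n)\<rfloor>\<bar>)" unfolding f_def by (rule sum_abs)
        also have "\<dots> \<le> (\<Sum>i=1..m. B / real R)"
        proof (rule sum_mono)
          fix i assume i: "i \<in> {1..m}"
          have "\<bar>\<xi> i * of_int \<lfloor>P i (real n)\<rfloor>\<bar> \<le> \<bar>\<xi> i\<bar> * (B * \<bar>P i (real N)\<bar>)"
            unfolding abs_mult using B(2)[OF i NT, of n] n by (intro mult_left_mono) auto
          also have "\<dots> = B * \<bar>\<xi> i * P i (real N)\<bar>" by (simp add: abs_mult)
          also have "\<dots> \<le> B * (1 / real R ^ F)" using True i B by (intro mult_left_mono) (auto intro: less_imp_le)
          also have "\<dots> \<le> B * (1 / real R ^ 1)"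
            using B R0 by (intro mult_left_mono divide_left_mono power_increasing Rge1) (auto simp: F_def)
          finally show "\<bar>\<xi> i * of_int \<lfloor>P i (real n)\<rfloor>\<bar> \<le> B / real R" by simp
        qed
        finally show ?thesis by simp
      qed
      have "exp_avg m P \<xi> N - 1 = of_real (1 / real N) * (\<Sum>n=1..N. e (f n) - e 0)"
        unfolding avg f_def[symmetric] using N by (simp add: f_def sum_subtractf field_simps)
      then have "cmod (exp_avg m P \<xi> N - 1) = (1 / real N) * cmod (\<Sum>n=1..N. e (f n) - e 0)"
        by (simp only: norm_mult norm_of_real) simp
      also have "\<dots> \<le> (1 / real N) * (\<Sum>n=1..N. 7 * (real m * B / real R))"
      proof (intro mult_left_mono sum_norm_le)
        fix n assume n: "n \<in> {1..N}"
        have "cmod (e (f n) - e 0) \<le> 2 * pi * \<bar>f n - 0\<bar>" by (rule e_Lipschitz)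
        also have "\<dots> \<le> 7 * (real m * B / real R)" using f[OF n] pi_approx by (intro mult_mono) auto
        finally show "cmod (e (f n) - e 0) \<le> 7 * (real m * B / real R)" .
      qed simp
      also have "\<dots> = 7 * (real m * B) / real R" using N by simp
      also have "\<dots> \<le> M / real R" by (intro divide_right_mono) (auto simp: M_def)
      finally show ?thesis using True NT by simp
    next
      case False
      then obtain i0 where i0: "i0 \<in> {1..m}" "real R ^ F < \<bar>\<xi> i0 * P i0 (real N)\<bar>" using out by blast
      have "cmod (\<Sum>n=1..N. e (\<Sum>i\<in>{1..m}. \<xi> i * of_int \<lfloor>P i (real n)\<rfloor>)) \<le>
        (real (R ^ 3) ^ card {1..m} * (3 / real R ^ a) + real (card {1..m}) * (347 / real R + 8 * (3 / real R ^ a))) * real N"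
      proof (rule norm_floor_sum_le)
        fix h :: "nat \<Rightarrow> int" assume h: "\<And>i. i \<in> {1..m} \<Longrightarrow> \<bar>h i\<bar> < int (R ^ 3)"
        have "cmod (\<Sum>n=1..N. e (\<Sum>i=1..m. (\<xi> i + of_int (h i)) * P i (real n))) \<le> 3 * real N / real R ^ a"
        proof (rule bound[OF RR(1)])
          show "real R ^ E \<le> real N" by (rule pow) (simp add: F_def)
          show "\<bar>\<xi> i + of_int (h i)\<bar> \<le> real R ^ 3 + 1" if "i \<in> {1..m}" for i
          proof -
            have "\<bar>real_of_int (h i)\<bar> \<le> real R ^ 3"
              using h[OF that] by (metis less_imp_le of_int_abs of_int_le_iff of_int_of_nat_eq of_nat_power)
            then show ?thesis using \<xi>[OF that] by linarith
          qed
          have "\<exists>i\<in>{1..m}. real R ^ E \<le> \<bar>(\<xi> i + of_int (h i)) * P i (real N)\<bar>"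
          proof (cases "\<forall>i\<in>{1..m}. h i = 0")
            case True
            then show ?thesis using i0 RaE by (intro bexI[of _ i0]) auto
          next
            case False
            then obtain i where i: "i \<in> {1..m}" "h i \<noteq> 0" by blast
            have "1 \<le> \<bar>h i\<bar>" using i by linarith
            then have "1 \<le> \<bar>real_of_int (h i)\<bar>" by (metis of_int_1_le_iff of_int_abs)
            then have "1/2 \<le> \<bar>\<xi> i + of_int (h i)\<bar>" using \<xi>[OF i(1)] by linarith
            then have "1/2 * (2 * real R ^ E) \<le> \<bar>\<xi> i + of_int (h i)\<bar> * \<bar>P i (real N)\<bar>"
              using Pbig[OF i(1)] by (intro mult_mono) auto
            then show ?thesis using i by (intro bexI[of _ i]) (auto simp: abs_mult)
          qed
          then obtain i where i: "i \<in> {1..m}" "real R ^ E \<le> \<bar>(\<xi> i + of_int (h i)) * P i (real N)\<bar>" by blast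
          note i(2)
          also have "\<bar>(\<xi> i + of_int (h i)) * P i (real N)\<bar> \<le> (\<Sum>i=1..m. \<bar>(\<xi> i + of_int (h i)) * P i (real N)\<bar>)"
            using i(1) by (intro member_le_sum[where f = "\<lambda>i. \<bar>(\<xi> i + of_int (h i)) * P i (real N)\<bar>"]) auto
          finally show "real R ^ E \<le> (\<Sum>i=1..m. \<bar>(\<xi> i + of_int (h i)) * P i (real N)\<bar>)" .
          show "separated m (\<lambda>i. (\<xi> i + of_int (h i)) * (deriv ^^ k) (P i) t)"
            if "k \<in> {1, K}" "real N / real R ^ a \<le> t" "t \<le> real N" for k t
            by (rule nonexceptional_separated[OF good TN Rge1(2) big \<xi> h that])
        qed
        then show "cmod (\<Sum>n=1..N. e (\<Sum>i\<in>{1..m}. (\<xi> i + of_int (h i)) * P i (real n))) \<le> 3 / real R ^ a * real N"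
          by simp
      next
        fix i :: nat and j :: int
        assume i: "i \<in> {1..m}" and j: "0 < \<bar>j\<bar>" "\<bar>j\<bar> < int R"
        \<comment> \<open>A single frequency \<open>j\<close> is treated as a family with one
          nonzero coefficient, which is trivially separated.\<close>
        define \<theta> where "\<theta> = (\<lambda>l. if l = i then real_of_int j else 0)"
        have j1: "1 \<le> \<bar>real_of_int j\<bar>" using j(1) by (metis of_int_1_le_iff of_int_abs int_one_le_iff_zero_less)
        have jR: "\<bar>real_of_int j\<bar> \<le> real R" using j(2) by (metis less_imp_le of_int_abs of_int_le_iff of_int_of_nat_eq)
        have one: "(\<Sum>l=1..m. \<theta> l * x l) = of_int j * x i" for x :: "nat \<Rightarrow> real"
        proof -
          have "(\<Sum>l=1..m. \<theta> l * x l) = (\<Sum>l=1..m. if l = i then of_int j * x l else 0)"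
            by (intro sum.cong) (auto simp: \<theta>_def)
          then show ?thesis using i by simp
        qed
        have "cmod (\<Sum>n=1..N. e (\<Sum>l=1..m. \<theta> l * P l (real n))) \<le> 3 * real N / real R ^ a"
        proof (rule bound[OF RR(1)])
          show "real R ^ E \<le> real N" by (rule pow) (simp add: F_def)
          have "real R * 1 \<le> real R * real R ^ 2" by (intro mult_left_mono one_le_power Rge1) auto
          then have R3: "real R \<le> real R ^ 3" by (simp add: eval_nat_numeral)
          have \<theta>R: "\<bar>\<theta> l\<bar> \<le> real R" for l using jR by (simp add: \<theta>_def)
          show "\<bar>\<theta> l\<bar> \<le> real R ^ 3 + 1" for l using \<theta>R[of l] R3 by linarith
          have "1 * (2 * real R ^ E) \<le> \<bar>real_of_int j\<bar> * \<bar>P i (real N)\<bar>" using j1 Pbig[OF i] by (intro mult_mono) auto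
          moreover have "0 \<le> real R ^ E" by simp
          ultimately have "real R ^ E \<le> \<bar>real_of_int j\<bar> * \<bar>P i (real N)\<bar>" by linarith
          then have "real R ^ E \<le> \<bar>\<theta> i * P i (real N)\<bar>" by (simp add: \<theta>_def abs_mult)
          also have "\<dots> \<le> (\<Sum>l=1..m. \<bar>\<theta> l * P l (real N)\<bar>)"
            using i by (intro member_le_sum[where f = "\<lambda>l. \<bar>\<theta> l * P l (real N)\<bar>"]) auto
          finally show "real R ^ E \<le> (\<Sum>l=1..m. \<bar>\<theta> l * P l (real N)\<bar>)" .
          show "separated m (\<lambda>l. \<theta> l * (deriv ^^ k) (P l) t)" for k t by (auto simp: separated_def \<theta>_def)
        qed
        then show "cmod (\<Sum>n=1..N. e (of_int j * P i (real n))) \<le> 3 / real R ^ a * real N"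
          unfolding one by simp
      qed (use \<xi> Rge1 in auto)
      also have "real (R ^ 3) ^ card {1..m} * (3 / real R ^ a) = 3 / real R"
        using R0 by (simp add: a_def power_mult)
      also have "(3 / real R + real (card {1..m}) * (347 / real R + 8 * (3 / real R ^ a))) * real N \<le> (M / real R) * real N"
      proof (rule mult_right_mono)
        have "3 / real R ^ a \<le> 3 / real R ^ 1"
          using R0 by (intro divide_left_mono power_increasing Rge1) (auto simp: a_def)
        then have "real m * (347 / real R + 8 * (3 / real R ^ a)) \<le> real m * (347 / real R + 8 * (3 / real R))"
          by (intro mult_left_mono) auto
        also have "\<dots> = 371 * real m / real R" using R0 by (simp add: field_simps)
        finally have "3 / real R + real m * (347 / real R + 8 * (3 / real R ^ a)) \<le> (3 + 371 * real m) / real R"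
          by (simp add: add_divide_distrib)
        also have "\<dots> \<le> M / real R" using mB by (intro divide_right_mono) (auto simp: M_def)
        finally show "3 / real R + real (card {1..m}) * (347 / real R + 8 * (3 / real R ^ a)) \<le> M / real R" by simp
      qed simp
      finally have "cmod (\<Sum>n=1..N. e (\<Sum>i=1..m. \<xi> i * of_int \<lfloor>P i (real n)\<rfloor>)) \<le> (M / real R) * real N" .
      then have "(1 / real N) * cmod (\<Sum>n=1..N. e (\<Sum>i=1..m. \<xi> i * of_int \<lfloor>P i (real n)\<rfloor>)) \<le> M / real R"
        using N0 by (simp add: pos_divide_le_eq)
      moreover have "cmod (exp_avg m P \<xi> N) = (1 / real N) * cmod (\<Sum>n=1..N. e (\<Sum>i=1..m. \<xi> i * of_int \<lfloor>P i (real n)\<rfloor>))"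
        unfolding avg norm_mult norm_of_real by simp
      ultimately have "cmod (exp_avg m P \<xi> N) \<le> M / real R" by simp
      then show ?thesis using False NT i0 by auto
    qed
  qed
qed

section \<open>Jumps along a chain\<close>

lemma exceptional_index_finite: "finite exceptional_index" "card exceptional_index \<le> 10 * m * m"
proof -
  have "card exceptional_index = 5 * (m * (m * card {1, K}))"
    by (simp add: exceptional_index_def card_cartesian_product del: card_insert_if)
  moreover have "card {1, K} \<le> 2" using card_insert_le_m1[of 2 "{K}" 1] by simp
  then have "m * (m * card {1, K}) \<le> m * (m * 2)" by (intro mult_left_mono) auto
  ultimately show "card exceptional_index \<le> 10 * m * m" by (simp add: mult_ac)
qed (simp add: exceptional_index_def)

text \<open>The estimate \<open>ln R \<le> R\<close> is crude, but \<Lambda> = O(1 / \<delta>)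
  already gives the exponent 2. The bound \<delta> \<le> 2 is recorded for the later passage to the
  exponent 2 + \<epsilon>.\<close>

lemma jumps_bounded:
  obtains C where "0 \<le> C" and
    "\<And>\<delta> \<xi> N J. 0 < \<delta> \<Longrightarrow> 1 \<le> J \<Longrightarrow> (\<And>j. j \<le> J \<Longrightarrow> 1 \<le> N j) \<Longrightarrow>
      (\<And>j. j < J \<Longrightarrow> N j \<le> N (Suc j) \<and> \<delta> \<le> cmod (exp_avg m P \<xi> (N (Suc j)) - exp_avg m P \<xi> (N j))) \<Longrightarrow>
      \<delta> \<le> 2 \<and> real J \<le> C / \<delta>\<^sup>2"
proof -
  obtain M F a R0 where M: "1 \<le> M" and R0: "1 \<le> R0" and F: "1 \<le> F" and dich:
    "\<And>R \<xi> N. R0 \<le> R \<Longrightarrow> (\<And>i. i \<in> {1..m} \<Longrightarrow> \<bar>\<xi> i\<bar> \<le> 1/2) \<Longrightarrow> 1 \<le> N \<Longrightarrow>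
      N \<notin> (\<Union>s\<in>exceptional_index. exceptional F a R \<xi> s) \<Longrightarrow>
      T\<^sub>0 \<le> real N \<and>
      (if \<forall>i\<in>{1..m}. \<bar>\<xi> i * P i (real N)\<bar> < 1 / real R ^ F then cmod (exp_avg m P \<xi> N - 1) \<le> M / real R
       else cmod (exp_avg m P \<xi> N) \<le> M / real R \<and> (\<exists>i\<in>{1..m}. real R ^ F < \<bar>\<xi> i * P i (real N)\<bar>))"
    by (rule dichotomy) blast
  define W where "W = 2 * real F / g + real a + real F"
  have W: "0 \<le> W" using g by (simp add: W_def)
  define Y where "Y = 2 * real R0 + 4 + 2 * M"
  have Y: "0 \<le> Y" using M by (simp add: Y_def)
  define C where "C = 20 * real m * real m * (2 * W * Y + 4) + 4"
  show thesis
  proof (rule that[of C])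
    show "0 \<le> C" using W Y by (simp add: C_def)
    fix \<delta> :: real and \<xi> N and J :: nat
    assume \<delta>: "0 < \<delta>" and J: "1 \<le> J" and N1: "\<And>j. j \<le> J \<Longrightarrow> 1 \<le> N j"
      and jump: "\<And>j. j < J \<Longrightarrow> N j \<le> N (Suc j) \<and> \<delta> \<le> cmod (exp_avg m P \<xi> (N (Suc j)) - exp_avg m P \<xi> (N j))"
    define \<zeta> where "\<zeta> = (\<lambda>i. \<xi> i - of_int (round (\<xi> i)))"
    have avg: "exp_avg m P \<xi> = exp_avg m P \<zeta>" unfolding \<zeta>_def by (rule exp_avg_round)
    have \<zeta>: "\<bar>\<zeta> i\<bar> \<le> 1/2" for i
      using of_int_round_abs_le[of "\<xi> i"] by (simp add: \<zeta>_def abs_minus_commute)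
    have "\<delta> \<le> cmod (exp_avg m P \<xi> (N (Suc 0)) - exp_avg m P \<xi> (N 0))" using jump[of 0] J by simp
    also have "\<dots> \<le> cmod (exp_avg m P \<xi> (N (Suc 0))) + cmod (exp_avg m P \<xi> (N 0))"
      by (rule norm_triangle_ineq4)
    also have "\<dots> \<le> 1 + 1"
      using J by (intro add_mono norm_exp_avg_le N1) auto
    finally have "\<delta> \<le> 1 + 1" .
    then have \<delta>2: "\<delta> \<le> 2" by simp
    define R where "R = R0 + nat \<lceil>2 * M / \<delta>\<rceil> + 1"
    have R: "R0 \<le> R" "1 \<le> R" by (auto simp: R_def)
    have "2 * M / \<delta> \<le> real (nat \<lceil>2 * M / \<delta>\<rceil>)" by (rule of_nat_ceiling)
    then have "2 * M / \<delta> < real R" by (simp add: R_def)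
    then have small: "2 * (M / real R) < \<delta>" using \<delta> R by (simp add: field_simps)
    have RY: "real R \<le> Y / \<delta>"
    proof -
      have "0 \<le> 2 * M / \<delta>" using M \<delta> by simp
      then have "real R \<le> (real R0 + 2) + 2 * M / \<delta>" unfolding R_def by linarith
      also have "real R0 + 2 \<le> (2 * real R0 + 4) / \<delta>"
        using mult_left_mono[OF \<delta>2, of "real R0 + 2"] \<delta> by (simp add: pos_le_divide_eq)
      finally show ?thesis by (simp add: Y_def add_divide_distrib)
    qed
    define \<Lambda> where "\<Lambda> = W * ln (real R)"
    have lnR: "0 \<le> ln (real R)" "ln (real R) \<le> real R" using R ln_le_minus_one[of "real R"] by auto
    have \<Lambda>: "0 \<le> \<Lambda>" "\<Lambda> \<le> W * real R" using W lnR by (auto simp: \<Lambda>_def mult_left_mono)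
    have incr: "N i \<le> N j" if "i \<le> j" "j \<le> J" for i j
      using that
    proof (induction j)
      case (Suc j)
      then show ?case using jump[of j] by (cases "i = Suc j") auto
    qed simp
    define near where "near = (\<lambda>n. \<forall>i\<in>{1..m}. \<bar>\<zeta> i * P i (real n)\<bar> < 1 / real R ^ F)"
    have near_iff: "near n \<longleftrightarrow> (\<forall>i\<in>{1..m}. \<bar>\<zeta> i * P i (real n)\<bar> < 1 / real R ^ F)" for n
      by (simp only: near_def)
    have dich': "T\<^sub>0 \<le> real n" "near n \<Longrightarrow> cmod (exp_avg m P \<zeta> n - 1) \<le> M / real R"
      "\<not> near n \<Longrightarrow> cmod (exp_avg m P \<zeta> n) \<le> M / real R \<and> (\<exists>i\<in>{1..m}. real R ^ F < \<bar>\<zeta> i * P i (real n)\<bar>)"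
      if "1 \<le> n" "n \<notin> (\<Union>s\<in>exceptional_index. exceptional F a R \<zeta> s)" for n
      using dich[OF R(1) \<zeta> that] unfolding near_iff[symmetric] by simp_all
    have "real J \<le> 2 * (real (card exceptional_index) * (\<Lambda> / (\<delta> / 2) + 1)) + 1"
    \<comment> \<open>\<open>persist\<close> ranges over all natural numbers, so 0, where the
      dichotomy says nothing, is put into \<open>A\<close>.\<close>
    proof (rule jumps_le[where N = "\<lambda>j. if j \<le> J then N j else N J" and U = "exceptional F a R \<zeta>" and A = "\<lambda>n. n = 0 \<or> near n"])
      show "finite exceptional_index" by (rule exceptional_index_finite)
      show "0 < \<delta> / 2" using \<delta> by simp
      show "0 \<le> \<Lambda>" by (rule \<Lambda>)
    next
      fix j assume j: "j < J"
      have pos: "1 \<le> N j" "N j \<le> N (Suc j)" using N1[of j] jump[OF j] j by auto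
      have "\<delta> \<le> 2 * (1 - real (N j) / real (N (Suc j)))"
        using order_trans[OF conjunct2[OF jump[OF j]] exp_avg_diff_le[OF pos]] .
      then have "real (N j) / real (N (Suc j)) - 1 \<le> - (\<delta> / 2)" by simp
      moreover have "ln (real (N j) / real (N (Suc j))) \<le> real (N j) / real (N (Suc j)) - 1"
        by (rule ln_le_minus_one) (use pos in auto)
      moreover have "ln (real (N j) / real (N (Suc j))) = ln (real (N j)) - ln (real (N (Suc j)))"
        using pos by (simp add: ln_div)
      ultimately have "ln (real (N j)) + \<delta> / 2 \<le> ln (real (N (Suc j)))" by linarith
      then show "ln (real (if j \<le> J then N j else N J)) + \<delta> / 2 \<le> ln (real (if Suc j \<le> J then N (Suc j) else N J))"
        using j by simp
    next
      fix i j assume "i \<le> j" "j \<le> J"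
      then show "(if i \<le> J then N i else N J) \<le> (if j \<le> J then N j else N J)" using incr by auto
    next
      fix s i j assume s: "s \<in> exceptional_index" "i \<le> J" "j \<le> J"
        "(if i \<le> J then N i else N J) \<in> exceptional F a R \<zeta> s" "(if j \<le> J then N j else N J) \<in> exceptional F a R \<zeta> s"
      then show "\<bar>ln (real (if i \<le> J then N i else N J)) - ln (real (if j \<le> J then N j else N J))\<bar> \<le> \<Lambda>"
        using exceptional_diameter[OF s(1) R(2), of "N i" F a \<zeta> "N j"] by (simp add: \<Lambda>_def W_def)
    next
      fix j assume j: "j < J" and g1': "(if j \<le> J then N j else N J) \<notin> (\<Union>s\<in>exceptional_index. exceptional F a R \<zeta> s)"
        and g2': "(if Suc j \<le> J then N (Suc j) else N J) \<notin> (\<Union>s\<in>exceptional_index. exceptional F a R \<zeta> s)"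
      have g1: "N j \<notin> (\<Union>s\<in>exceptional_index. exceptional F a R \<zeta> s)" using g1' j by simp
      have g2: "N (Suc j) \<notin> (\<Union>s\<in>exceptional_index. exceptional F a R \<zeta> s)" using g2' j by simp
      have p1: "1 \<le> N j" and p2: "1 \<le> N (Suc j)" using N1[of j] N1[of "Suc j"] j by auto
      note d1 = dich'[OF p1 g1] and d2 = dich'[OF p2 g2]
      define x y where "x = exp_avg m P \<zeta> (N j)" and "y = exp_avg m P \<zeta> (N (Suc j))"
      have dist: "\<delta> \<le> cmod (y - x)" using jump[OF j] by (simp add: x_def y_def avg)
      have "near (N j) \<and> \<not> near (N (Suc j))"
      proof (rule ccontr)
        assume contr: "\<not> (near (N j) \<and> \<not> near (N (Suc j)))"
        consider "near (N j)" "near (N (Suc j))" | "\<not> near (N j)" "\<not> near (N (Suc j))" | "\<not> near (N j)" "near (N (Suc j))"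
          using contr by blast
        then show False
        proof cases
          case 1
          then have "cmod (x - 1) \<le> M / real R" "cmod (y - 1) \<le> M / real R" using d1 d2 by (auto simp: x_def y_def)
          then have "cmod (y - x) \<le> 2 * (M / real R)" using norm_triangle_ineq4[of "y - 1" "x - 1"] by simp
          then show False using dist small by simp
        next
          case 2
          then have "cmod x \<le> M / real R" "cmod y \<le> M / real R" using d1 d2 by (auto simp: x_def y_def)
          then have "cmod (y - x) \<le> 2 * (M / real R)" using norm_triangle_ineq4[of y x] by simp
          then show False using dist small by simp
        next
          \<comment> \<open>A return from a huge to a tiny phase contradicts the monotonicity of |P
            i|.\<close>
          case 3
          then obtain i where i: "i \<in> {1..m}" "real R ^ F < \<bar>\<zeta> i * P i (real (N j))\<bar>" using d1 by auto
          have "\<bar>P i (real (N j))\<bar> \<le> \<bar>P i (real (N (Suc j)))\<bar>"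
            by (rule abs_mono[OF i(1)]) (use d1 jump[OF j] in auto)
          then have "\<bar>\<zeta> i * P i (real (N j))\<bar> \<le> \<bar>\<zeta> i * P i (real (N (Suc j)))\<bar>"
            unfolding abs_mult by (intro mult_left_mono) auto
          moreover have "\<bar>\<zeta> i * P i (real (N (Suc j)))\<bar> < 1 / real R ^ F" using 3 i(1) by (simp add: near_def)
          moreover have "1 \<le> real R ^ F" using R by (intro one_le_power) auto
          then have "1 / real R ^ F \<le> real R ^ F" by (smt (verit) divide_le_eq_1)
          ultimately show False using i(2) by linarith
        qed
      qed
      then show "((if j \<le> J then N j else N J) = 0 \<or> near (if j \<le> J then N j else N J)) \<and>
        \<not> ((if Suc j \<le> J then N (Suc j) else N J) = 0 \<or> near (if Suc j \<le> J then N (Suc j) else N J))"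
        using j p2 by simp
    next
      fix n n' assume good: "n \<notin> (\<Union>s\<in>exceptional_index. exceptional F a R \<zeta> s)" and le: "n \<le> n'" and n': "n' = 0 \<or> near n'"
      show "n = 0 \<or> near n"
      proof (cases "n = 0")
        case False
        then have n1: "1 \<le> n" by simp
        note T = dich'(1)[OF n1 good]
        have "near n'" using n' le False by simp
        have "near n"
          unfolding near_def
        proof
          fix i assume i: "i \<in> {1..m}"
          have "\<bar>\<zeta> i * P i (real n)\<bar> \<le> \<bar>\<zeta> i * P i (real n')\<bar>"
            unfolding abs_mult using abs_mono[OF i T, of "real n'"] le by (intro mult_left_mono) auto
          then show "\<bar>\<zeta> i * P i (real n)\<bar> < 1 / real R ^ F" using \<open>near n'\<close> i unfolding near_def by force
        qed
        then show ?thesis ..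
      qed simp
    qed
    also have "\<dots> \<le> 2 * (10 * real m * real m * ((2 * W * Y + 4) / \<delta>\<^sup>2)) + 4 / \<delta>\<^sup>2"
    proof (intro add_mono mult_left_mono mult_mono)
      have "real (card exceptional_index) \<le> real (10 * m * m)" using exceptional_index_finite(2) by (rule of_nat_mono)
      then show "real (card exceptional_index) \<le> 10 * real m * real m" by simp
      \<comment> \<open>As \<delta> \<le> 2, additive constants are absorbed into multiples of 1 /
        \<delta>^2.\<close>
      have \<delta>4: "\<delta>\<^sup>2 \<le> 4" using power_mono[OF \<delta>2, of 2] \<delta> by simp
      show four: "1 \<le> 4 / \<delta>\<^sup>2" using \<delta>4 \<delta> by simp
      have "\<Lambda> \<le> W * (Y / \<delta>)" using \<Lambda>(2) mult_left_mono[OF RY W] by linarith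
      then have "\<Lambda> / (\<delta> / 2) \<le> W * (Y / \<delta>) / (\<delta> / 2)" using \<delta> by (intro divide_right_mono) auto
      also have "\<dots> = 2 * W * Y / \<delta>\<^sup>2" using \<delta> by (simp add: power2_eq_square)
      finally show "\<Lambda> / (\<delta> / 2) + 1 \<le> (2 * W * Y + 4) / \<delta>\<^sup>2" using four by (simp add: add_divide_distrib)
      show "0 \<le> \<Lambda> / (\<delta> / 2) + 1" using \<Lambda>(1) \<delta> by simp
    qed auto
    also have "\<dots> = C / \<delta>\<^sup>2" using \<delta> by (simp add: C_def field_simps)
    finally show "\<delta> \<le> 2 \<and> real J \<le> C / \<delta>\<^sup>2" using \<delta>2 by simp
  qed
qed

end

text \<open>One estimate for arbitrary index sets, from which both parts of the theorem are read
  off.\<close>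

lemma tame_jump_count_le:
  assumes "tame m P \<tau>" "1 \<le> m" "0 < \<epsilon>"
  shows "\<exists>C. \<forall>D\<subseteq>{1..}. \<forall>\<delta>>0. \<forall>\<xi>::nat \<Rightarrow> real.
    ereal_of_enat (jump_count \<delta> (exp_avg m P \<xi>) D) \<le> ereal (C * \<delta> powr (- (2 + \<epsilon>)))"
proof -
  obtain K C\<^sub>0 T\<^sub>0 g where "tame_family m P K C\<^sub>0 T\<^sub>0 g"
    using tame_imp_tame_family[OF assms(1,2)] .
  then interpret tame_family m P K C\<^sub>0 T\<^sub>0 g .
  obtain C where C: "0 \<le> C" and bound: "\<And>\<delta> \<xi> N J. 0 < \<delta> \<Longrightarrow> 1 \<le> J \<Longrightarrow> (\<And>j. j \<le> J \<Longrightarrow> 1 \<le> N j) \<Longrightarrow>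
      (\<And>j. j < J \<Longrightarrow> N j \<le> N (Suc j) \<and> \<delta> \<le> cmod (exp_avg m P \<xi> (N (Suc j)) - exp_avg m P \<xi> (N j))) \<Longrightarrow>
      \<delta> \<le> 2 \<and> real J \<le> C / \<delta>\<^sup>2"
    by (rule jumps_bounded) blast
  show ?thesis
  \<comment> \<open>A jump forces \<delta> \<le> 2, so raising the exponent from 2 to 2 + \<epsilon>
    costs the factor \<open>2 powr \<epsilon>\<close>; for larger \<delta> there are no
    jumps.\<close>
  proof (intro exI[of _ "C * 2 powr \<epsilon>"] allI impI)
    fix D :: "nat set" and \<delta> :: real and \<xi> :: "nat \<Rightarrow> real" assume D: "D \<subseteq> {1..}" and \<delta>: "0 < \<delta>"
    define B where "B = C * 2 powr \<epsilon> * \<delta> powr (- (2 + \<epsilon>))"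
    have B: "0 \<le> B" using C by (simp add: B_def)
    \<comment> \<open>The count is an extended natural number, so it is compared with the integer
      part of \<open>B\<close>.\<close>
    have "jump_count \<delta> (exp_avg m P \<xi>) D \<le> enat (nat \<lfloor>B\<rfloor>)"
      unfolding jump_count_def
    proof (rule SUP_least, clarify)
      fix J :: nat and N assume J: "1 \<le> J" and N: "\<forall>j\<le>J. N j \<in> D"
        and jump: "\<forall>j<J. N j \<le> N (Suc j) \<and> \<delta> \<le> cmod (exp_avg m P \<xi> (N (Suc j)) - exp_avg m P \<xi> (N j))"
      have b: "\<delta> \<le> 2 \<and> real J \<le> C / \<delta>\<^sup>2"
        by (rule bound[OF \<delta> J, of N \<xi>]) (use N D jump in auto)
      have "real J \<le> C * \<delta> powr (-2)" using b \<delta> by (simp add: powr_minus powr_numeral divide_inverse)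
      also have "\<delta> powr (-2) = \<delta> powr \<epsilon> * \<delta> powr (- (2 + \<epsilon>))" using \<delta> by (simp add: powr_add[symmetric])
      also have "C * \<dots> \<le> C * (2 powr \<epsilon> * \<delta> powr (- (2 + \<epsilon>)))"
        using b \<delta> assms(3) C by (intro mult_left_mono mult_right_mono powr_mono2) auto
      finally have "real J \<le> B" by (simp add: B_def mult_ac)
      then show "enat J \<le> enat (nat \<lfloor>B\<rfloor>)" by (simp add: le_nat_floor)
    qed
    then have "ereal_of_enat (jump_count \<delta> (exp_avg m P \<xi>) D) \<le> ereal_of_enat (enat (nat \<lfloor>B\<rfloor>))"
      by (simp only: ereal_of_enat_le_iff)
    also have "\<dots> \<le> ereal B" using B by simp
    finally show "ereal_of_enat (jump_count \<delta> (exp_avg m P \<xi>) D) \<le> ereal (C * 2 powr \<epsilon> * \<delta> powr (- (2 + \<epsilon>)))"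
      by (simp add: B_def)
  qed
qed

theorem corollary2p1:
  fixes m :: nat and P :: "nat \<Rightarrow> real \<Rightarrow> real"
  assumes "m \<ge> 1"
  shows
    "(class_P m P \<longrightarrow>
       (\<forall>\<epsilon>>0. \<forall>l>1. \<exists>C::real. \<forall>D. lacunary l D \<longrightarrow> (\<forall>\<delta>>0. \<forall>\<xi> :: nat \<Rightarrow> real.
          ereal_of_enat (jump_count \<delta> (exp_avg m P \<xi>) D) \<le> ereal (C * \<delta> powr (- (2 + \<epsilon>))))))
     \<and>
     (class_P' m P \<longrightarrow>
       (\<forall>\<epsilon>>0. \<exists>C::real. \<forall>\<delta>>0. \<forall>\<xi> :: nat \<Rightarrow> real.
          ereal_of_enat (jump_count \<delta> (exp_avg m P \<xi>) {1..}) \<le> ereal (C * \<delta> powr (- (2 + \<epsilon>)))))"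
proof (intro conjI impI allI)
  fix \<epsilon> l :: real assume P: "class_P m P" and \<epsilon>: "0 < \<epsilon>"
  obtain \<tau> where "tame m P \<tau>" by (rule class_P_tame[OF P])
  from tame_jump_count_le[OF this assms \<epsilon>] obtain C where
    "\<forall>D\<subseteq>{1..}. \<forall>\<delta>>0. \<forall>\<xi>::nat \<Rightarrow> real.
       ereal_of_enat (jump_count \<delta> (exp_avg m P \<xi>) D) \<le> ereal (C * \<delta> powr (- (2 + \<epsilon>)))" ..
  moreover have "D \<subseteq> {1..}" if "lacunary l D" for D
    using that by (simp add: lacunary_def)
  ultimately show "\<exists>C::real. \<forall>D. lacunary l D \<longrightarrow> (\<forall>\<delta>>0. \<forall>\<xi> :: nat \<Rightarrow> real.
    ereal_of_enat (jump_count \<delta> (exp_avg m P \<xi>) D) \<le> ereal (C * \<delta> powr (- (2 + \<epsilon>))))"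
    by (intro exI[of _ C]) simp
next
  fix \<epsilon> :: real assume P: "class_P' m P" and \<epsilon>: "0 < \<epsilon>"
  obtain \<tau> where "tame m P \<tau>" by (rule class_P'_tame[OF P])
  from tame_jump_count_le[OF this assms \<epsilon>] obtain C where
    "\<forall>D\<subseteq>{1..}. \<forall>\<delta>>0. \<forall>\<xi>::nat \<Rightarrow> real.
       ereal_of_enat (jump_count \<delta> (exp_avg m P \<xi>) D) \<le> ereal (C * \<delta> powr (- (2 + \<epsilon>)))" ..
  then show "\<exists>C::real. \<forall>\<delta>>0. \<forall>\<xi> :: nat \<Rightarrow> real.
    ereal_of_enat (jump_count \<delta> (exp_avg m P \<xi>) {1..}) \<le> ereal (C * \<delta> powr (- (2 + \<epsilon>)))"
    by (intro exI[of _ C]) simp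
qed

end
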